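(* Let $\phi\in\mathbb{Q}(x)$ be a rational function of degree $2$ having a $2$-periodic critical point, and suppose that $\operatorname{Aut}(\phi)$ is nontrivial. Then there exists $v\in\mathbb{Q}\setminus\{0,4\}$ such that $\phi$ is linearly conjugate over $\mathbb{Q}$ to \[\psi_v:=\frac{2x-1}{vx^2-1}.\] Moreover, for any such $v$ with $v\neq 1$: (a) if $v\notin\operatorname{Im}\alpha\cup\operatorname{Im}\beta$, then $G_{3,\phi}\cong W$; (b) if $v\in\operatorname{Im}\alpha$, then $G_{3,\phi}\cong A$, $K$, or $M$; (c) if $v\in\operatorname{Im}\beta$, then $G_{3,\phi}\cong B$ or $M$; (d) if $v\in\operatorname{Im}\mu$, then $G_{3,\phi}\cong M$; (e) if $v\in\operatorname{Im}\kappa$, then $G_{3,\phi}\cong K$.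
   Context: The degree of a rational function $p/q$ ($p,q$ coprime) is $\max\{\deg p,\deg q\}$. A point $P\in\mathbb{P}^1(\overline{\mathbb{Q}})$ is $n$-periodic for $\phi$ if $\phi^n(P)=P$ with $n$ minimal. A critical point is a ramification point of $\phi:\mathbb{P}^1\to\mathbb{P}^1$. Two maps $\phi,\psi$ are linearly conjugate over $\mathbb{Q}$ if $\psi=\sigma^{-1}\circ\phi\circ\sigma$ for some degree-one $\sigma\in\mathbb{Q}(x)$. $\operatorname{Aut}(\phi)$ is the group of degree-one $\sigma\in\overline{\mathbb{Q}}(x)$ with $\sigma^{-1}\circ\phi\circ\sigma=\phi$. $G_{3,\phi}=\operatorname{Gal}(\mathbb{Q}_{3,\phi}/\mathbb{Q})$ where $\mathbb{Q}_{3,\phi}$ is the compositum of the fields of definition of all $3$-periodic points of $\phi$ in $\mathbb{P}^1(\overline{\mathbb{Q}})$. For $\rho\in\mathbb{Q}(t)$, $\operatorname{Im}\rho$ denotes the set of values $\rho(u)$ for $u\in\mathbb{Q}$ at which $\rho$ is defined. Set $\alpha(t)=\frac{(1+t)^2}{1-t+t^2}$, $\beta(t)=t^2(3-t)$, $\kappa(t)=\frac{(t^3-3t^2-6t-1)^2}{(1+t+t^2)^3}$, $\mu(t)=\alpha\!\left(\frac{t^3-3t-1}{t^3+3t^2-1}\right)$. Groups: $W$ is the centralizer of $(1,2,3)(4,5,6)$ in $S_6$ (so $W\cong(\mathbb{Z}/3\mathbb{Z})\wr S_2$). Up to conjugacy in $W$, the maximal subgroups of $W$ are $A$ (order $9$),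 $B$ (cyclic of order $6$) and $C$ (non-cyclic of order $6$). Up to conjugacy in $W$, the maximal subgroups of $A$ are $J,K,M$, where $J$ is the one contained in a conjugate of $C$, $M$ is the one contained in a conjugate of $B$, and $K$ is the remaining one. *)

theory Defs
  imports "HOL-Computational_Algebra.Computational_Algebra"
begin

(* P^1 over C: None is the point at infinity. Qbar is the set of algebraic complex numbers. *)
type_synonym p1 = "complex option"

(* a rational function p/q in Q(x), given by numerator and denominator *)
type_synonym ratfun = "rat poly \<times> rat poly"

definition cpoly :: "rat poly \<Rightarrow> complex poly" where
  "cpoly p = map_poly of_rat p"

definition rf_ok :: "ratfun \<Rightarrow> bool" where
  "rf_ok \<phi> \<longleftrightarrow> coprime (fst \<phi>) (snd \<phi>) \<and> snd \<phi> \<noteq> 0"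

definition rf_deg :: "ratfun \<Rightarrow> nat" where
  "rf_deg \<phi> = max (degree (fst \<phi>)) (degree (snd \<phi>))"

definition rf_eval :: "ratfun \<Rightarrow> p1 \<Rightarrow> p1" where
  "rf_eval \<phi> P = (let p = cpoly (fst \<phi>); q = cpoly (snd \<phi>) in
     (case P of
        Some z \<Rightarrow> (if poly q z = 0 then None else Some (poly p z / poly q z))
      | None \<Rightarrow> (if degree p > degree q then None
                 else if degree p = degree q then Some (lead_coeff p / lead_coeff q)
                 else Some 0)))"

(* ramification index e_P: multiplicity of P in the fibre over phi(P) *)
definition rf_ram :: "ratfun \<Rightarrow> p1 \<Rightarrow> nat" where
  "rf_ram \<phi> P = (let p = cpoly (fst \<phi>); q = cpoly (snd \<phi>); d = rf_deg \<phi> in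
     (case (P, rf_eval \<phi> P) of
        (Some a, Some c) \<Rightarrow> order a (p - smult c q)
      | (Some a, None) \<Rightarrow> order a q
      | (None, Some c) \<Rightarrow> d - degree (p - smult c q)
      | (None, None) \<Rightarrow> d - degree q))"

definition critical_pt :: "ratfun \<Rightarrow> p1 \<Rightarrow> bool" where
  "critical_pt \<phi> P \<longleftrightarrow> rf_ram \<phi> P \<ge> 2"

definition alg_pt :: "p1 \<Rightarrow> bool" where
  "alg_pt P \<longleftrightarrow> (\<forall>z. P = Some z \<longrightarrow> algebraic z)"

definition periodic_pt :: "(p1 \<Rightarrow> p1) \<Rightarrow> nat \<Rightarrow> p1 \<Rightarrow> bool" where
  "periodic_pt f n P \<longleftrightarrow> 0 < n \<and> (f ^^ n) P = P \<and> (\<forall>m. 0 < m \<and> m < n \<longrightarrow> (f ^^ m) P \<noteq> P)"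

definition mob :: "complex \<Rightarrow> complex \<Rightarrow> complex \<Rightarrow> complex \<Rightarrow> p1 \<Rightarrow> p1" where
  "mob a b c d P = (case P of
      Some z \<Rightarrow> (if c * z + d = 0 then None else Some ((a * z + b) / (c * z + d)))
    | None \<Rightarrow> (if c = 0 then None else Some (a / c)))"

(* psi = sigma^-1 o phi o sigma for some sigma in PGL_2(Q), i.e. sigma o psi = phi o sigma *)
definition lin_conj_Q :: "ratfun \<Rightarrow> ratfun \<Rightarrow> bool" where
  "lin_conj_Q \<phi> \<psi> \<longleftrightarrow> (\<exists>a b c d :: rat. a * d - b * c \<noteq> 0 \<and>
     (\<forall>P. mob (of_rat a) (of_rat b) (of_rat c) (of_rat d) (rf_eval \<psi> P)
          = rf_eval \<phi> (mob (of_rat a) (of_rat b) (of_rat c) (of_rat d) P)))"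

definition aut_nontrivial :: "ratfun \<Rightarrow> bool" where
  "aut_nontrivial \<phi> \<longleftrightarrow> (\<exists>a b c d. algebraic a \<and> algebraic b \<and> algebraic c \<and> algebraic d \<and>
     a * d - b * c \<noteq> 0 \<and> (\<exists>P. mob a b c d P \<noteq> P) \<and>
     (\<forall>P. mob a b c d (rf_eval \<phi> P) = rf_eval \<phi> (mob a b c d P)))"

definition psi :: "rat \<Rightarrow> ratfun" where
  "psi v = ([:-1, 2:], [:-1, 0, v:])"

definition per3 :: "ratfun \<Rightarrow> p1 set" where
  "per3 \<phi> = {P. alg_pt P \<and> periodic_pt (rf_eval \<phi>) 3 P}"

definition is_subfield :: "complex set \<Rightarrow> bool" where
  "is_subfield F \<longleftrightarrow> 0 \<in> F \<and> 1 \<in> F \<and> (\<forall>x\<in>F. \<forall>y\<in>F. x + y \<in> F \<and> x * y \<in> F) \<and>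
     (\<forall>x\<in>F. - x \<in> F \<and> (x \<noteq> 0 \<longrightarrow> inverse x \<in> F))"

definition gen_field :: "complex set \<Rightarrow> complex set" where
  "gen_field S = \<Inter>{F. is_subfield F \<and> S \<subseteq> F}"

definition Q3 :: "ratfun \<Rightarrow> complex set" where
  "Q3 \<phi> = gen_field {z. Some z \<in> per3 \<phi>}"

(* field automorphisms of K (they fix Q automatically): Gal(K/Q) for K = Q3 *)
definition field_auts :: "complex set \<Rightarrow> (complex \<Rightarrow> complex) set" where
  "field_auts K = {\<sigma>. bij_betw \<sigma> K K \<and>
     (\<forall>x\<in>K. \<forall>y\<in>K. \<sigma> (x + y) = \<sigma> x + \<sigma> y \<and> \<sigma> (x * y) = \<sigma> x * \<sigma> y)}"

definition perm_of_list :: "nat list \<Rightarrow> nat \<Rightarrow> nat" where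
  "perm_of_list xs i = (if i < length xs then xs ! i else i)"

(* (1,2,3)(4,5,6), 0-indexed *)
definition pi6 :: "nat \<Rightarrow> nat" where
  "pi6 = perm_of_list [1,2,0,4,5,3]"

definition W6 :: "(nat \<Rightarrow> nat) set" where
  "W6 = {f. bij_betw f {0..<6} {0..<6} \<and> (\<forall>i\<ge>6. f i = i) \<and> f \<circ> pi6 = pi6 \<circ> f}"

(* A: order 9, generated by (1,2,3) and (4,5,6) *)
definition A6 :: "(nat \<Rightarrow> nat) set" where
  "A6 = {perm_of_list [i, (i+1) mod 3, (i+2) mod 3, 3 + j, 3 + (j+1) mod 3, 3 + (j+2) mod 3]
          | i j. i < 3 \<and> j < 3}"

(* B: cyclic of order 6, generated by (1,5,2,6,3,4) *)
definition B6 :: "(nat \<Rightarrow> nat) set" where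
  "B6 = perm_of_list ` {[0,1,2,3,4,5], [4,5,3,0,1,2], [1,2,0,4,5,3],
                        [5,3,4,1,2,0], [2,0,1,5,3,4], [3,4,5,2,0,1]}"

(* C: non-cyclic of order 6, generated by (1,4)(2,5)(3,6) and (1,2,3)(4,6,5) *)
definition C6 :: "(nat \<Rightarrow> nat) set" where
  "C6 = perm_of_list ` {[0,1,2,3,4,5], [1,2,0,5,3,4], [2,0,1,4,5,3],
                        [3,4,5,0,1,2], [4,5,3,2,0,1], [5,3,4,1,2,0]}"

(* J = <(1,2,3)(4,6,5)> (contained in C) *)
definition J6 :: "(nat \<Rightarrow> nat) set" where
  "J6 = perm_of_list ` {[0,1,2,3,4,5], [1,2,0,5,3,4], [2,0,1,4,5,3]}"

(* K = <(1,2,3)> *)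
definition K6 :: "(nat \<Rightarrow> nat) set" where
  "K6 = perm_of_list ` {[0,1,2,3,4,5], [1,2,0,3,4,5], [2,0,1,3,4,5]}"

(* M = <(1,2,3)(4,5,6)> (contained in B) *)
definition M6 :: "(nat \<Rightarrow> nat) set" where
  "M6 = perm_of_list ` {[0,1,2,3,4,5], [1,2,0,4,5,3], [2,0,1,5,3,4]}"

(* G_{3,phi} is isomorphic to H (as a subgroup of W, up to conjugacy in W):
   for some labelling of the 3-periodic points by 0..5 on which phi acts as pi6,
   the permutations induced by Gal(Q3/Q) form exactly H. *)
definition G3_is :: "ratfun \<Rightarrow> (nat \<Rightarrow> nat) set \<Rightarrow> bool" where
  "G3_is \<phi> H \<longleftrightarrow> (\<exists>lab. bij_betw lab {0..<6} (per3 \<phi>) \<and>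
     (\<forall>i<6. rf_eval \<phi> (lab i) = lab (pi6 i)) \<and>
     (\<lambda>\<sigma> i. if i < 6 then the_inv_into {0..<6} lab (map_option \<sigma> (lab i)) else i)
        ` field_auts (Q3 \<phi>) = H)"

definition alpha :: "rat \<Rightarrow> rat" where "alpha t = (1 + t)^2 / (1 - t + t^2)"
definition beta :: "rat \<Rightarrow> rat" where "beta t = t^2 * (3 - t)"
definition kappa :: "rat \<Rightarrow> rat" where
  "kappa t = (t^3 - 3*t^2 - 6*t - 1)^2 / (1 + t + t^2)^3"
definition mu :: "rat \<Rightarrow> rat" where
  "mu t = alpha ((t^3 - 3*t - 1) / (t^3 + 3*t^2 - 1))"

definition Im_alpha :: "rat set" where "Im_alpha = {alpha u | u. 1 - u + u^2 \<noteq> 0}"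
definition Im_beta :: "rat set" where "Im_beta = range beta"
definition Im_kappa :: "rat set" where "Im_kappa = {kappa u | u. 1 + u + u^2 \<noteq> 0}"
definition Im_mu :: "rat set" where
  "Im_mu = {mu u | u. u^3 + 3*u^2 - 1 \<noteq> 0 \<and>
     (let w = (u^3 - 3*u - 1) / (u^3 + 3*u^2 - 1) in 1 - w + w^2 \<noteq> 0)}"

end

theory Submission
  imports Defs
begin

text \<open>
  Over \<open>\<complex>\<close> a map \<open>\<phi>\<close> as in the theorem is conjugate to \<open>y \<mapsto> 1/y\<^sup>2\<close>: both critical points lie on the
  2-cycle. Moving a generic rational point, its image and its second image to \<open>\<infinity>, 0, 1\<close> by a rational
  substitution turns \<open>\<phi>\<close> into \<open>\<psi>\<^sub>v\<close>.

  The fixed points of \<open>\<psi>\<^sub>v\<close> are the inverses of the roots \<open>t\<^sub>0, t\<^sub>1, t\<^sub>2\<close> of \<open>t\<^sup>3 - 3t\<^sup>2 + v\<close>, and sending them to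
  \<open>0, \<infinity>, 1\<close> turns \<open>\<psi>\<^sub>v\<close> into \<open>x \<mapsto> x(x - 2)/(1 - 2x)\<close>, whose 3-periodic points are the roots
  \<open>\<gamma>\<close> of \<open>x\<^sup>3 - 3x + 1\<close> and their inverses. Hence the Galois group acts on the 3-periodic points through
  its actions on the \<open>\<gamma>\<close>, by a cyclic group of order 3, and on the \<open>t\<^sub>i\<close>, where permuting the \<open>t\<^sub>i\<close> amounts to
  one of the six substitutions permuting \<open>0, 1, \<infinity>\<close>. This identifies \<open>W\<close> with \<open>C\<^sub>3 \<times> S\<^sub>3\<close>.
  The image in \<open>C\<^sub>3\<close> is never trivial because \<open>\<gamma>\<close> is irrational. The image in \<open>S\<^sub>3\<close> is governed by the
  discriminant \<open>27v(4 - v)\<close>, a square exactly for \<open>v \<in> Im \<alpha>\<close>, and by the rational roots, which exist exactly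
  for \<open>v \<in> Im \<beta>\<close>; for \<open>v \<in> Im \<mu>\<close> all \<open>t\<^sub>i\<close> are rational, and for \<open>v \<in> Im \<kappa>\<close> a 3-periodic point is.
\<close>

section \<open>Subfields of the complex numbers and their embeddings\<close>

text \<open>The model \<open>gfun\<close> is chosen for descent. The automorphism group of
  \<open>1/y^2\<close> has order 6 and acts faithfully on the three fixed points; with these at 0, 1
  and infinity it consists of maps with rational coefficients. The Moebius map carrying
  \<open>gfun\<close> to \<open>psi v\<close> is determined by the order of the \<open>t\<close>, so
  a Galois automorphism changes it only by one of these six maps, and its effect on the 3-periodic
  points can be computed.

  The group is given by automorphisms of \<open>Q3\<close>, while the computation takes place in the
  splitting field \<open>E\<close> of both cubics. Only the inclusion of \<open>Q3\<close> in
  \<open>E\<close> is used: automorphisms of \<open>Q3\<close> extend to \<open>E\<close>, and those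
  of \<open>E\<close> permute the 3-periodic points, hence restrict to \<open>Q3\<close>. For this,
  embeddings of subfields into the complex numbers are extended one root at a time.

  \<open>G3_is\<close> demands equality with one fixed subgroup for some labelling. The freedom of
  conjugation is spent on two choices: a rational \<open>t\<close> is numbered \<open>t1\<close>, to
  meet \<open>B6\<close>, and the two 3-cycles are exchanged when the group fixes the wrong one, to
  meet \<open>K6\<close>.\<close>

lemma subfield_0: "is_subfield F \<Longrightarrow> 0 \<in> F"
  and subfield_1: "is_subfield F \<Longrightarrow> 1 \<in> F"
  and subfield_add: "is_subfield F \<Longrightarrow> x \<in> F \<Longrightarrow> y \<in> F \<Longrightarrow> x + y \<in> F"
  and subfield_mult: "is_subfield F \<Longrightarrow> x \<in> F \<Longrightarrow> y \<in> F \<Longrightarrow> x * y \<in> F"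
  and subfield_uminus: "is_subfield F \<Longrightarrow> x \<in> F \<Longrightarrow> - x \<in> F"
  by (auto simp: is_subfield_def)

lemma subfield_inverse: "is_subfield F \<Longrightarrow> x \<in> F \<Longrightarrow> inverse x \<in> F"
  by (cases "x = 0") (auto simp: is_subfield_def)

lemma subfield_diff: "is_subfield F \<Longrightarrow> x \<in> F \<Longrightarrow> y \<in> F \<Longrightarrow> x - y \<in> F"
  using subfield_add[of F x "-y"] subfield_uminus[of F y] by simp

lemma subfield_divide: "is_subfield F \<Longrightarrow> x \<in> F \<Longrightarrow> y \<in> F \<Longrightarrow> x / y \<in> F"
  by (simp add: divide_inverse subfield_mult subfield_inverse)

lemma subfield_sum: "is_subfield F \<Longrightarrow> (\<And>i. i \<in> A \<Longrightarrow> f i \<in> F) \<Longrightarrow> sum f A \<in> F"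
  by (induction A rule: infinite_finite_induct) (auto simp: subfield_0 subfield_add)

lemma subfield_power: "is_subfield F \<Longrightarrow> x \<in> F \<Longrightarrow> x ^ n \<in> F"
  by (induction n) (auto simp: subfield_1 subfield_mult)

lemma subfield_of_nat: "is_subfield F \<Longrightarrow> of_nat n \<in> F"
  by (induction n) (auto simp: subfield_0 subfield_1 subfield_add)

lemma subfield_of_int: "is_subfield F \<Longrightarrow> of_int n \<in> F"
  by (cases n) (auto simp: subfield_of_nat subfield_uminus subfield_diff subfield_1
      simp flip: of_nat_Suc simp del: of_nat_Suc)

lemma subfield_Rats: "is_subfield F \<Longrightarrow> x \<in> \<rat> \<Longrightarrow> x \<in> F"
  by (elim Rats_cases') (auto intro!: subfield_divide subfield_of_int)

lemma subfield_numeral: "is_subfield F \<Longrightarrow> numeral n \<in> F"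
  by (simp add: subfield_Rats)

lemmas subfield_intros = subfield_0 subfield_1 subfield_add subfield_mult subfield_uminus
  subfield_inverse subfield_diff subfield_divide subfield_power subfield_numeral

lemma is_subfield_Rats: "is_subfield \<rat>"
  by (auto simp: is_subfield_def)

lemma is_subfield_gen_field: "is_subfield (gen_field S)"
  unfolding is_subfield_def gen_field_def by blast

lemma gen_field_superset: "S \<subseteq> gen_field S"
  unfolding gen_field_def by blast

lemma gen_field_minimal: "is_subfield F \<Longrightarrow> S \<subseteq> F \<Longrightarrow> gen_field S \<subseteq> F"
  unfolding gen_field_def by blast

text \<open>An embedding of \<open>F\<close> into the complex numbers. Its values outside
  \<open>F\<close> are arbitrary and its image need not lie in \<open>F\<close>, which lets it be
  extended root by root; \<open>\<tau> 1 = 1\<close> excludes the zero map.\<close>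

definition field_hom :: "complex set \<Rightarrow> (complex \<Rightarrow> complex) \<Rightarrow> bool" where
  "field_hom F \<tau> \<longleftrightarrow> \<tau> 1 = 1 \<and>
     (\<forall>x\<in>F. \<forall>y\<in>F. \<tau> (x + y) = \<tau> x + \<tau> y \<and> \<tau> (x * y) = \<tau> x * \<tau> y)"

lemma field_hom_subset: "field_hom F \<tau> \<Longrightarrow> G \<subseteq> F \<Longrightarrow> field_hom G \<tau>"
  unfolding field_hom_def by blast

context
  fixes F :: "complex set" and \<tau> :: "complex \<Rightarrow> complex"
  assumes F: "is_subfield F" and \<tau>: "field_hom F \<tau>"
begin

lemma field_hom_1: "\<tau> 1 = 1"
  and field_hom_add: "x \<in> F \<Longrightarrow> y \<in> F \<Longrightarrow> \<tau> (x + y) = \<tau> x + \<tau> y"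
  and field_hom_mult: "x \<in> F \<Longrightarrow> y \<in> F \<Longrightarrow> \<tau> (x * y) = \<tau> x * \<tau> y"
  using \<tau> by (auto simp: field_hom_def)

lemma field_hom_0: "\<tau> 0 = 0"
  using field_hom_add[of 0 0] subfield_0[OF F] by simp

lemma field_hom_uminus: "x \<in> F \<Longrightarrow> \<tau> (- x) = - \<tau> x"
  using field_hom_add[of x "- x"] subfield_uminus[OF F, of x] field_hom_0
  by (simp add: eq_neg_iff_add_eq_0 add.commute)

lemma field_hom_diff: "x \<in> F \<Longrightarrow> y \<in> F \<Longrightarrow> \<tau> (x - y) = \<tau> x - \<tau> y"
  using field_hom_add[of x "- y"] subfield_uminus[OF F, of y] field_hom_uminus[of y] by simp

lemma field_hom_eq_0_iff: "x \<in> F \<Longrightarrow> \<tau> x = 0 \<longleftrightarrow> x = 0"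
  using field_hom_mult[of x "inverse x"] subfield_inverse[OF F, of x] field_hom_0 field_hom_1
  by (cases "x = 0") auto

lemma field_hom_inj: "inj_on \<tau> F"
proof (rule inj_onI)
  fix x y assume "x \<in> F" "y \<in> F" "\<tau> x = \<tau> y"
  then show "x = y"
    using field_hom_diff[of x y] field_hom_eq_0_iff[of "x - y"] subfield_diff[OF F, of x y] by simp
qed

lemma field_hom_inverse: "x \<in> F \<Longrightarrow> \<tau> (inverse x) = inverse (\<tau> x)"
  using field_hom_mult[of x "inverse x"] subfield_inverse[OF F, of x] field_hom_0 field_hom_1
  by (cases "x = 0") (auto simp: inverse_unique)

lemma field_hom_divide: "x \<in> F \<Longrightarrow> y \<in> F \<Longrightarrow> \<tau> (x / y) = \<tau> x / \<tau> y"
  by (simp add: divide_inverse field_hom_mult field_hom_inverse subfield_inverse[OF F])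

lemma field_hom_power: "x \<in> F \<Longrightarrow> \<tau> (x ^ n) = \<tau> x ^ n"
  by (induction n) (auto simp: field_hom_1 field_hom_mult subfield_power[OF F])

lemma field_hom_sum: "(\<And>i. i \<in> A \<Longrightarrow> f i \<in> F) \<Longrightarrow> \<tau> (sum f A) = (\<Sum>i\<in>A. \<tau> (f i))"
  by (induction A rule: infinite_finite_induct)
    (auto simp: field_hom_0 field_hom_add subfield_sum[OF F])

lemma field_hom_of_nat: "\<tau> (of_nat n) = of_nat n"
  by (induction n) (auto simp: field_hom_0 field_hom_1 field_hom_add subfield_of_nat[OF F] subfield_1[OF F])

lemma field_hom_of_int: "\<tau> (of_int n) = of_int n"
proof (cases n)
  case (nonneg k)
  then show ?thesis by (simp add: field_hom_of_nat)
next
  case (neg k)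
  then have "of_int n = - (of_nat (Suc k) :: complex)" by simp
  then show ?thesis
    by (simp only: field_hom_uminus subfield_of_nat[OF F] field_hom_of_nat)
qed

lemma field_hom_Rats: "x \<in> \<rat> \<Longrightarrow> \<tau> x = x"
  by (elim Rats_cases') (auto simp: field_hom_divide subfield_of_int[OF F] field_hom_of_int)

lemma field_hom_numeral: "\<tau> (numeral n) = numeral n"
  by (simp add: field_hom_Rats)

text \<open>One inclusion: the elements of \<open>F\<close> that land in the field generated by the
  image of \<open>S\<close> form a subfield containing \<open>S\<close>. The other: the image of a
  subfield is a subfield.\<close>

lemma field_hom_image_gen_field:
  assumes "S \<subseteq> F"
  shows "\<tau> ` gen_field S = gen_field (\<tau> ` S)"
proof
  have sub: "gen_field S \<subseteq> F" using gen_field_minimal[OF F assms] .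
  let ?H = "{x \<in> F. \<tau> x \<in> gen_field (\<tau> ` S)}"
  note gf = is_subfield_gen_field
  have "is_subfield ?H"
    unfolding is_subfield_def
    by (auto simp: field_hom_0 field_hom_1 field_hom_add field_hom_mult field_hom_uminus
        field_hom_inverse subfield_intros[OF F] subfield_intros[OF gf])
  moreover have "S \<subseteq> ?H" using assms gen_field_superset[of "\<tau> ` S"] by auto
  ultimately show "\<tau> ` gen_field S \<subseteq> gen_field (\<tau> ` S)"
    using gen_field_minimal[of ?H S] by auto
  have "is_subfield (\<tau> ` gen_field S)"
    unfolding is_subfield_def
  proof (intro conjI ballI impI)
    show "0 \<in> \<tau> ` gen_field S" "1 \<in> \<tau> ` gen_field S"
      using field_hom_0 field_hom_1 subfield_0[OF gf] subfield_1[OF gf] by (metis image_eqI)+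
    fix x assume "x \<in> \<tau> ` gen_field S"
    then obtain x' where x': "x' \<in> gen_field S" "x = \<tau> x'" "x' \<in> F" using sub by auto
    show "- x \<in> \<tau> ` gen_field S"
      using x' field_hom_uminus[of x'] subfield_uminus[OF gf x'(1)] by (intro image_eqI[of _ _ "- x'"]) auto
    show "inverse x \<in> \<tau> ` gen_field S"
      using x' field_hom_inverse[of x'] subfield_inverse[OF gf x'(1)]
      by (intro image_eqI[of _ _ "inverse x'"]) auto
    fix y assume "y \<in> \<tau> ` gen_field S"
    then obtain y' where y': "y' \<in> gen_field S" "y = \<tau> y'" "y' \<in> F" using sub by auto
    show "x + y \<in> \<tau> ` gen_field S"
      using x' y' field_hom_add[of x' y'] subfield_add[OF gf x'(1) y'(1)]
      by (intro image_eqI[of _ _ "x' + y'"]) auto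
    show "x * y \<in> \<tau> ` gen_field S"
      using x' y' field_hom_mult[of x' y'] subfield_mult[OF gf x'(1) y'(1)]
      by (intro image_eqI[of _ _ "x' * y'"]) auto
  qed
  then show "gen_field (\<tau> ` S) \<subseteq> \<tau> ` gen_field S"
    using gen_field_superset[of S] by (intro gen_field_minimal) auto
qed

end

text \<open>\<open>field_auts\<close> does not ask for \<open>\<tau> 1 = 1\<close>: injectivity
  gives \<open>\<tau> 1 \<noteq> 0\<close>, and an idempotent other than 0 is 1.\<close>

lemma field_auts_iff:
  assumes "is_subfield F"
  shows "\<tau> \<in> field_auts F \<longleftrightarrow> field_hom F \<tau> \<and> \<tau> ` F = F"
proof
  assume L: "\<tau> \<in> field_auts F"
  then have bij: "bij_betw \<tau> F F"
    and add: "\<And>x y. x \<in> F \<Longrightarrow> y \<in> F \<Longrightarrow> \<tau> (x + y) = \<tau> x + \<tau> y"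
    and mult: "\<And>x y. x \<in> F \<Longrightarrow> y \<in> F \<Longrightarrow> \<tau> (x * y) = \<tau> x * \<tau> y"
    by (auto simp: field_auts_def)
  have "\<tau> 0 = 0" using add[of 0 0] subfield_0[OF assms] by simp
  then have "\<tau> 1 \<noteq> 0"
    using bij_betw_imp_inj_on[OF bij] subfield_0[OF assms] subfield_1[OF assms]
    by (metis inj_on_def zero_neq_one)
  then have "\<tau> 1 = 1" using mult[of 1 1] subfield_1[OF assms] by simp
  then show "field_hom F \<tau> \<and> \<tau> ` F = F"
    using add mult bij by (auto simp: field_hom_def bij_betw_def)
next
  assume "field_hom F \<tau> \<and> \<tau> ` F = F"
  then show "\<tau> \<in> field_auts F"
    using field_hom_inj[OF assms, of \<tau>] by (auto simp: field_auts_def bij_betw_def field_hom_def)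
qed

lemma field_auts_gen_field:
  assumes "is_subfield F" "field_hom F \<tau>" "S \<subseteq> F" "\<tau> ` S = S"
  shows "\<tau> \<in> field_auts (gen_field S)"
  using field_hom_image_gen_field[OF assms(1-3)] assms
    field_hom_subset[OF assms(2) gen_field_minimal[OF assms(1,3)]]
  by (simp add: field_auts_iff is_subfield_gen_field)

section \<open>Polynomials over a subfield and the extension of embeddings\<close>

definition poly_over :: "complex set \<Rightarrow> complex poly \<Rightarrow> bool" where
  "poly_over F p \<longleftrightarrow> (\<forall>i. coeff p i \<in> F)"

context
  fixes F :: "complex set"
  assumes F: "is_subfield F"
begin

lemma poly_over_0: "poly_over F 0"
  and poly_over_add: "poly_over F p \<Longrightarrow> poly_over F q \<Longrightarrow> poly_over F (p + q)"
  and poly_over_diff: "poly_over F p \<Longrightarrow> poly_over F q \<Longrightarrow> poly_over F (p - q)"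
  and poly_over_uminus: "poly_over F p \<Longrightarrow> poly_over F (- p)"
  and poly_over_mult: "poly_over F p \<Longrightarrow> poly_over F q \<Longrightarrow> poly_over F (p * q)"
  and poly_over_monom: "c \<in> F \<Longrightarrow> poly_over F (monom c n)"
  and poly_over_pCons: "c \<in> F \<Longrightarrow> poly_over F p \<Longrightarrow> poly_over F (pCons c p)"
  by (auto simp: poly_over_def coeff_mult coeff_pCons
      intro!: subfield_intros[OF F] subfield_sum[OF F] split: nat.splits)

lemma poly_over_pderiv: "poly_over F p \<Longrightarrow> poly_over F (pderiv p)"
  by (auto simp: poly_over_def coeff_pderiv simp del: of_nat_Suc
      intro!: subfield_mult[OF F] subfield_of_nat[OF F])

text \<open>Long division by \<open>m\<close>, one leading term at a time, keeps the coefficients of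
  quotient and remainder in \<open>F\<close>.\<close>

lemma poly_over_division:
  assumes m: "poly_over F m" "m \<noteq> 0" and p: "poly_over F p"
  shows "\<exists>d r. poly_over F d \<and> poly_over F r \<and> p = m * d + r \<and> (r = 0 \<or> degree r < degree m)"
  using p
proof (induction "degree p" arbitrary: p rule: less_induct)
  case less
  show ?case
  proof (cases "p = 0 \<or> degree p < degree m")
    case True
    then show ?thesis
      using less.prems poly_over_0 by (intro exI[of _ 0] exI[of _ p]) auto
  next
    case False
    define h where "h = monom (lead_coeff p / lead_coeff m) (degree p - degree m)"
    have h: "poly_over F h"
      unfolding h_def using m less.prems
      by (intro poly_over_monom subfield_divide[OF F]) (auto simp: poly_over_def)
    have h0: "h \<noteq> 0" using False m by (auto simp: h_def)
    have degh: "degree h = degree p - degree m"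
      using False m by (simp add: h_def degree_monom_eq)
    have degmh: "degree (m * h) = degree p"
      using False m h0 by (simp add: degree_mult_eq degh)
    have lc: "coeff (m * h) (degree p) = lead_coeff p"
      using False m h0 lead_coeff_mult[of m h] degmh by (simp add: degh) (simp add: h_def)
    let ?q = "p - m * h"
    have q: "poly_over F ?q" using m h less.prems by (intro poly_over_diff poly_over_mult)
    show ?thesis
    proof (cases "?q = 0")
      case True
      then show ?thesis using h poly_over_0 by (intro exI[of _ h] exI[of _ 0]) auto
    next
      case nz: False
      have le: "degree ?q \<le> degree p" using degmh by (simp add: degree_diff_le)
      have "coeff ?q (degree p) = 0" using lc by simp
      with nz have "degree ?q \<noteq> degree p" by (metis leading_coeff_0_iff)
      with le have "degree ?q < degree p" by simp
      from less.hyps[OF this q] obtain d r where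
        dr: "poly_over F d" "poly_over F r" "?q = m * d + r" "r = 0 \<or> degree r < degree m" by blast
      show ?thesis
        using dr h by (intro exI[of _ "d + h"] exI[of _ r]) (auto simp: poly_over_add algebra_simps)
    qed
  qed
qed

end

text \<open>Least degree stands in for irreducibility; \<open>m\<close> is not made monic.\<close>

definition min_poly_over :: "complex set \<Rightarrow> complex \<Rightarrow> complex poly \<Rightarrow> bool" where
  "min_poly_over F a m \<longleftrightarrow> poly_over F m \<and> m \<noteq> 0 \<and> poly m a = 0 \<and>
     (\<forall>p. poly_over F p \<longrightarrow> poly p a = 0 \<longrightarrow> p \<noteq> 0 \<longrightarrow> degree m \<le> degree p)"

lemma min_poly_over_exists:
  assumes "is_subfield F" "algebraic a"
  shows "\<exists>m. min_poly_over F a m"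
proof -
  let ?P = "\<lambda>p. poly_over F p \<and> p \<noteq> 0 \<and> poly p a = 0"
  obtain p where "\<forall>i. coeff p i \<in> \<int>" "p \<noteq> 0" "poly p a = 0"
    using assms(2) by (auto simp: algebraic_def)
  moreover have "\<int> \<subseteq> F" using subfield_of_int[OF assms(1)] by (auto elim!: Ints_cases)
  ultimately have "?P p" by (auto simp: poly_over_def)
  from ex_has_least_nat[of ?P p degree, OF this] show ?thesis
    by (auto simp: min_poly_over_def)
qed

context
  fixes F :: "complex set" and a :: complex and m :: "complex poly"
  assumes F: "is_subfield F" and m: "min_poly_over F a m"
begin

lemma min_poly_over_dvd:
  assumes "poly_over F p" "poly p a = 0"
  shows "\<exists>d. poly_over F d \<and> p = m * d"
proof -
  obtain d r where dr: "poly_over F d" "poly_over F r" "p = m * d + r" "r = 0 \<or> degree r < degree m"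
    using poly_over_division[OF F _ _ assms(1), of m] m by (auto simp: min_poly_over_def)
  have "poly r a = 0" using dr(3) assms(2) m by (simp add: min_poly_over_def)
  then have "r = 0" using dr m by (fastforce simp: min_poly_over_def)
  then show ?thesis using dr by auto
qed

text \<open>Bezout: an element \<open>d\<close> of least degree in the ideal of \<open>p\<close> and
  \<open>m\<close> divides both. As \<open>d\<close> does not vanish at \<open>a\<close>, the
  cofactor of \<open>d\<close> in \<open>m\<close> does, so its degree is at least that of
  \<open>m\<close>, and \<open>d\<close> is a nonzero constant.\<close>

lemma simple_extension_inverse:
  assumes p: "poly_over F p" "poly p a \<noteq> 0"
  shows "\<exists>q. poly_over F q \<and> poly q a = inverse (poly p a)"
proof -
  let ?I = "{d. d \<noteq> 0 \<and> (\<exists>u w. poly_over F u \<and> poly_over F w \<and> d = p * u + m * w)}"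
  have one: "poly_over F 1"
    using poly_over_monom[OF F subfield_1[OF F], of 0] by (simp add: monom_0 one_pCons)
  have m': "poly_over F m" "m \<noteq> 0" "poly m a = 0" using m by (auto simp: min_poly_over_def)
  have "m = p * 0 + m * 1" by simp
  then have "m \<in> ?I" using m'(2) one poly_over_0[OF F] by blast
  from ex_has_least_nat[of "\<lambda>d. d \<in> ?I" m degree, OF this]
  obtain d where d: "d \<in> ?I" and least: "\<And>e. e \<in> ?I \<Longrightarrow> degree d \<le> degree e" by blast
  obtain u w where uw: "poly_over F u" "poly_over F w" "d = p * u + m * w" using d by blast
  have d': "poly_over F d" "d \<noteq> 0"
    using d uw p m' by (auto intro!: poly_over_add[OF F] poly_over_mult[OF F])
  have dvd: "\<exists>e. poly_over F e \<and> p * x + m * y = d * e"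
    if xy: "poly_over F x" "poly_over F y" for x y
  proof -
    have "poly_over F (p * x + m * y)"
      using xy p m' by (intro poly_over_add[OF F] poly_over_mult[OF F])
    then obtain e r where er: "poly_over F e" "poly_over F r" "p * x + m * y = d * e + r"
      "r = 0 \<or> degree r < degree d"
      using poly_over_division[OF F d'] by blast
    have "r = p * (x - u * e) + m * (y - w * e)"
      using er(3) by (simp add: uw(3) algebra_simps)
    moreover have "poly_over F (x - u * e)" "poly_over F (y - w * e)"
      using xy uw er by (auto intro!: poly_over_diff[OF F] poly_over_mult[OF F])
    ultimately have "r \<in> ?I" if "r \<noteq> 0" using that by blast
    then have "r = 0" using least[of r] er(4) by fastforce
    then show ?thesis using er by auto
  qed
  obtain e where e: "poly_over F e" "m = d * e"
    using dvd[of 0 1] one poly_over_0[OF F] by auto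
  obtain e' where e': "p = d * e'"
    using dvd[of 1 0] one poly_over_0[OF F] by auto
  have "poly d a \<noteq> 0" using e' p(2) by auto
  then have "poly e a = 0" using e(2) m' by auto
  moreover have "e \<noteq> 0" using e m' by auto
  ultimately have "degree m \<le> degree e" using m e(1) by (auto simp: min_poly_over_def)
  then have "degree d = 0" using e(2) d' \<open>e \<noteq> 0\<close> by (simp add: degree_mult_eq)
  then obtain c where c: "d = [:c:]" by (auto elim: degree_eq_zeroE)
  have "c \<in> F" using d' c by (auto simp: poly_over_def coeff_pCons dest: spec[of _ 0])
  have "poly p a * poly u a = c" using arg_cong[OF uw(3), of "\<lambda>q. poly q a"] m' c by simp
  moreover have "c \<noteq> 0" using d' c by auto
  ultimately have "poly (u * [:inverse c:]) a = inverse (poly p a)"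
    using p(2) by (simp add: field_simps)
  moreover have "poly_over F (u * [:inverse c:])"
    using uw \<open>c \<in> F\<close>
    by (intro poly_over_mult[OF F] poly_over_pCons[OF F] subfield_inverse[OF F] poly_over_0[OF F])
  ultimately show ?thesis by blast
qed

lemma is_subfield_simple_extension: "is_subfield {poly p a | p. poly_over F p}" (is "is_subfield ?R")
  unfolding is_subfield_def
proof (intro conjI ballI impI)
  have const: "c \<in> ?R" if "c \<in> F" for c
    using that poly_over_pCons[OF F that poly_over_0[OF F]]
    by (intro CollectI exI[of _ "[:c:]"]) auto
  show "0 \<in> ?R" "1 \<in> ?R" using const subfield_0[OF F] subfield_1[OF F] by blast+
  fix x assume "x \<in> ?R"
  then obtain p where p: "poly_over F p" "x = poly p a" by auto
  show "- x \<in> ?R"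
    using p poly_over_uminus[OF F p(1)] by (intro CollectI exI[of _ "- p"]) auto
  show "inverse x \<in> ?R" if "x \<noteq> 0" using simple_extension_inverse[OF p(1)] p that by force
  fix y assume "y \<in> ?R"
  then obtain q where q: "poly_over F q" "y = poly q a" by auto
  show "x + y \<in> ?R"
    using p q poly_over_add[OF F p(1) q(1)] by (intro CollectI exI[of _ "p + q"]) auto
  show "x * y \<in> ?R"
    using p q poly_over_mult[OF F p(1) q(1)] by (intro CollectI exI[of _ "p * q"]) auto
qed

text \<open>The value \<open>p(a)\<close> is sent to the value at \<open>b\<close> of the
  transformed \<open>p\<close>. If \<open>p(a) = q(a)\<close>, then \<open>m\<close> divides
  \<open>p - q\<close>, and the transformed \<open>m\<close> vanishes at \<open>b\<close>; so the
  result does not depend on the polynomial chosen.\<close>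

lemma field_hom_extend_simple:
  assumes \<tau>: "field_hom F \<tau>" and b: "poly (map_poly \<tau> m) b = 0"
  shows "\<exists>F' \<tau>'. is_subfield F' \<and> F \<subseteq> F' \<and> a \<in> F' \<and> field_hom F' \<tau>' \<and>
           (\<forall>x\<in>F. \<tau>' x = \<tau> x) \<and> \<tau>' a = b"
proof -
  let ?R = "{poly p a | p. poly_over F p}"
  note \<tau>0 = field_hom_0[OF F \<tau>]
  have coeff_map: "coeff (map_poly \<tau> p) i = \<tau> (coeff p i)" for p i
    by (simp add: coeff_map_poly \<tau>0)
  have map_add: "map_poly \<tau> (p + q) = map_poly \<tau> p + map_poly \<tau> q"
    if "poly_over F p" "poly_over F q" for p q
    using that by (intro poly_eqI) (auto simp: coeff_map field_hom_add[OF F \<tau>] poly_over_def)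
  have map_mult: "map_poly \<tau> (p * q) = map_poly \<tau> p * map_poly \<tau> q"
    if "poly_over F p" "poly_over F q" for p q
    using that
    by (intro poly_eqI) (auto simp: coeff_map coeff_mult field_hom_sum[OF F \<tau>] field_hom_mult[OF F \<tau>]
        poly_over_def subfield_mult[OF F])
  have map_diff: "map_poly \<tau> (p - q) = map_poly \<tau> p - map_poly \<tau> q"
    if "poly_over F p" "poly_over F q" for p q
    using that by (intro poly_eqI) (auto simp: coeff_map field_hom_diff[OF F \<tau>] poly_over_def)
  have well: "poly (map_poly \<tau> p) b = poly (map_poly \<tau> q) b"
    if pq: "poly_over F p" "poly_over F q" "poly p a = poly q a" for p q
  proof -
    have "poly (p - q) a = 0" using pq by simp
    then obtain d where d: "poly_over F d" "p - q = m * d"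
      using min_poly_over_dvd[of "p - q"] poly_over_diff[OF F pq(1,2)] by auto
    have "poly_over F m" using m by (simp add: min_poly_over_def)
    then have "map_poly \<tau> p - map_poly \<tau> q = map_poly \<tau> m * map_poly \<tau> d"
      using map_mult[OF _ d(1)] map_diff[OF pq(1,2)] d(2) by simp
    from arg_cong[OF this, of "\<lambda>r. poly r b"] show ?thesis using b by simp
  qed
  define \<tau>' where "\<tau>' x = poly (map_poly \<tau> (SOME p. poly_over F p \<and> x = poly p a)) b" for x
  have \<tau>'_eq: "\<tau>' (poly p a) = poly (map_poly \<tau> p) b" if "poly_over F p" for p
  proof -
    let ?q = "SOME q. poly_over F q \<and> poly p a = poly q a"
    have "poly_over F ?q \<and> poly p a = poly ?q a" by (rule someI[of _ p]) (use that in simp)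
    then show ?thesis unfolding \<tau>'_def by (intro well[OF that, symmetric]) blast+
  qed
  have const: "poly_over F [:c:]" if "c \<in> F" for c
    using poly_over_pCons[OF F that poly_over_0[OF F]] .
  have \<tau>'_const: "\<tau>' c = \<tau> c" if "c \<in> F" for c
    using \<tau>'_eq[OF const[OF that]] by (simp add: map_poly_pCons \<tau>0)
  have "F \<subseteq> ?R"
  proof
    fix c assume "c \<in> F"
    then show "c \<in> ?R" using const[of c] by (intro CollectI exI[of _ "[:c:]"]) auto
  qed
  moreover have X: "poly_over F [:0, 1:]"
    by (intro poly_over_pCons[OF F] poly_over_0[OF F] subfield_0[OF F] subfield_1[OF F])
  then have "a \<in> ?R" by (intro CollectI exI[of _ "[:0,1:]"]) auto
  moreover have "\<tau>' a = b"
    using \<tau>'_eq[OF X] by (simp add: map_poly_pCons \<tau>0 field_hom_1[OF F \<tau>])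
  moreover have "field_hom ?R \<tau>'"
    unfolding field_hom_def
  proof (intro conjI ballI)
    show "\<tau>' 1 = 1" using \<tau>'_const[OF subfield_1[OF F]] field_hom_1[OF F \<tau>] by simp
    fix x y assume "x \<in> ?R" "y \<in> ?R"
    then obtain p q where pq: "poly_over F p" "poly_over F q" "x = poly p a" "y = poly q a" by auto
    show "\<tau>' (x + y) = \<tau>' x + \<tau>' y"
      using \<tau>'_eq[OF poly_over_add[OF F pq(1,2)]] by (simp add: pq \<tau>'_eq map_add)
    show "\<tau>' (x * y) = \<tau>' x * \<tau>' y"
      using \<tau>'_eq[OF poly_over_mult[OF F pq(1,2)]] by (simp add: pq \<tau>'_eq map_mult)
  qed
  ultimately show ?thesis using is_subfield_simple_extension \<tau>'_const by blast
qed

end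

lemma min_poly_over_degree_pos:
  assumes "min_poly_over F a m"
  shows "degree m > 0"
proof (rule ccontr)
  assume "\<not> degree m > 0"
  then obtain c where "m = [:c:]" by (auto elim: degree_eq_zeroE)
  then show False using assms by (auto simp: min_poly_over_def)
qed

text \<open>The elements of \<open>S\<close> are adjoined one at a time. The image of a minimal
  polynomial keeps its degree because \<open>\<tau>1\<close> is injective on \<open>F1\<close>;
  being nonconstant it has a complex root, to which the new element is sent.\<close>

lemma field_hom_extend:
  assumes "finite S" "\<And>a. a \<in> S \<Longrightarrow> algebraic a" "is_subfield F" "field_hom F \<tau>"
  shows "\<exists>F' \<tau>'. is_subfield F' \<and> F \<union> S \<subseteq> F' \<and> field_hom F' \<tau>' \<and> (\<forall>x\<in>F. \<tau>' x = \<tau> x)"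
  using assms
proof (induction S rule: finite_induct)
  case empty
  then show ?case by auto
next
  case (insert a S)
  then obtain F1 \<tau>1 where 1: "is_subfield F1" "F \<union> S \<subseteq> F1" "field_hom F1 \<tau>1"
    "\<forall>x\<in>F. \<tau>1 x = \<tau> x" by auto
  obtain m where m: "min_poly_over F1 a m"
    using min_poly_over_exists[OF 1(1), of a] insert.prems by auto
  have "degree (map_poly \<tau>1 m) = degree m"
    using m field_hom_eq_0_iff[OF 1(1,3), of "lead_coeff m"]
    by (intro map_poly_degree_eq) (auto simp: min_poly_over_def poly_over_def)
  then have "\<not> constant (poly (map_poly \<tau>1 m))"
    using min_poly_over_degree_pos[OF m] by (simp add: constant_degree)
  then obtain b where "poly (map_poly \<tau>1 m) b = 0"
    using fundamental_theorem_of_algebra by blast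
  from field_hom_extend_simple[OF 1(1) m 1(3) this] obtain F' \<tau>' where
    "is_subfield F'" "F1 \<subseteq> F'" "a \<in> F'" "field_hom F' \<tau>'" "\<forall>x\<in>F1. \<tau>' x = \<tau>1 x" by auto
  then show ?case using 1 by (intro exI[of _ F'] exI[of _ \<tau>']) auto
qed

text \<open>If the minimal polynomial of \<open>z\<close> had no root besides \<open>z\<close>, its derivative would vanish
  at \<open>z\<close>, against minimality.\<close>
lemma field_hom_moving:
  assumes z: "algebraic z" "z \<notin> \<rat>"
  shows "\<exists>F \<tau>. is_subfield F \<and> z \<in> F \<and> field_hom F \<tau> \<and> \<tau> z \<noteq> z"
proof -
  note Q = is_subfield_Rats
  obtain m where m: "min_poly_over \<rat> z m" using min_poly_over_exists[OF Q z(1)] by auto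
  then have m': "poly_over \<rat> m" "m \<noteq> 0" "poly m z = 0" by (auto simp: min_poly_over_def)
  have "\<exists>b. poly m b = 0 \<and> b \<noteq> z"
  proof -
    obtain r where r: "m = [:- z, 1:] * r" using m'(3) by (auto simp: poly_eq_0_iff_dvd)
    \<comment> \<open>A constant cofactor would make \<open>m\<close> linear and \<open>z\<close>
      rational.\<close>
    have "degree r > 0"
    proof (rule ccontr)
      assume "\<not> degree r > 0"
      then obtain c where c: "r = [:c:]" by (auto elim: degree_eq_zeroE)
      then have "m = [:- (z * c), c:]" using r by simp
      with m' have "c \<noteq> 0" "c \<in> \<rat>" "- (z * c) \<in> \<rat>"
        by (auto simp: poly_over_def coeff_pCons split: nat.splits dest: spec[of _ 0] spec[of _ 1])
      then have "- (- (z * c) / c) \<in> \<rat>" by (intro Rats_minus_iff[THEN iffD2] Rats_divide) auto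
      then show False using z(2) \<open>c \<noteq> 0\<close> by simp
    qed
    then obtain b where b: "poly r b = 0"
      using fundamental_theorem_of_algebra[of r] by (auto simp: constant_degree)
    show ?thesis
    proof (cases "b = z")
      case False
      then show ?thesis using b r by auto
    next
      case True
      have "poly (pderiv m) z = 0" using b True unfolding r by (subst pderiv_mult) (simp add: pderiv_pCons)
      moreover have "pderiv m \<noteq> 0" using min_poly_over_degree_pos[OF m] by (simp add: pderiv_eq_0_iff)
      moreover have "degree (pderiv m) < degree m"
        using min_poly_over_degree_pos[OF m] by (simp add: degree_pderiv)
      ultimately show ?thesis
        using m poly_over_pderiv[OF Q m'(1)] by (fastforce simp: min_poly_over_def)
    qed
  qed
  then obtain b where b: "poly m b = 0" "b \<noteq> z" by blast
  have "field_hom \<rat> (\<lambda>x. x)" by (simp add: field_hom_def)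
  from field_hom_extend_simple[OF Q m this, of b] b show ?thesis by (auto simp: map_poly_id')
qed

section \<open>Automorphisms of splitting fields\<close>

text \<open>\<open>S\<close> is the set of roots of the rational polynomial \<open>f\<close>, so \<open>gen_field S\<close> is its splitting field.\<close>
context
  fixes f :: "complex poly" and S :: "complex set"
  assumes f: "f \<noteq> 0" "poly_over \<rat> f" and S: "S = {z. poly f z = 0}"
begin

text \<open>Normality: an embedding permutes the finitely many roots of a rational polynomial, so it
  maps the field they generate onto itself.\<close>

lemma splitting_field_aut:
  assumes "is_subfield F" "field_hom F \<tau>" "S \<subseteq> F"
  shows "\<tau> \<in> field_auts (gen_field S)"
proof -
  have root: "poly f (\<tau> z) = 0" if "z \<in> S" for z
  proof -
    have z: "z \<in> F" "poly f z = 0" using that S assms by auto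
    have Qc: "coeff f i \<in> F" "\<tau> (coeff f i) = coeff f i" for i
      using f subfield_Rats[OF assms(1)] field_hom_Rats[OF assms(1,2)] by (auto simp: poly_over_def)
    have "\<tau> (poly f z) = poly f (\<tau> z)"
      unfolding poly_altdef
      by (subst field_hom_sum[OF assms(1,2)])
        (auto simp: z Qc field_hom_mult[OF assms(1,2)] field_hom_power[OF assms(1,2)]
          subfield_mult[OF assms(1)] subfield_power[OF assms(1)])
    then show ?thesis using z field_hom_0[OF assms(1,2)] by simp
  qed
  have "finite S" using f(1) S poly_roots_finite by simp
  moreover have "\<tau> ` S \<subseteq> S" using root S by auto
  moreover have "inj_on \<tau> S" using field_hom_inj[OF assms(1,2)] assms(3) inj_on_subset by blast
  ultimately have "\<tau> ` S = S" by (simp add: endo_inj_surj)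
  then show ?thesis using field_auts_gen_field assms by blast
qed

lemma splitting_field_hom_extend:
  assumes "is_subfield F" "field_hom F \<tau>"
  shows "\<exists>\<tau>'\<in>field_auts (gen_field S). \<forall>x\<in>F \<inter> gen_field S. \<tau>' x = \<tau> x"
proof -
  have "finite S" using f(1) S poly_roots_finite by simp
  moreover have "algebraic a" if "a \<in> S" for a
    using that f S by (intro algebraicI'[of f]) (auto simp: poly_over_def)
  ultimately obtain F' \<tau>' where "is_subfield F'" "F \<union> S \<subseteq> F'" "field_hom F' \<tau>'"
    "\<forall>x\<in>F. \<tau>' x = \<tau> x"
    using field_hom_extend[OF _ _ assms, of S] by blast
  then show ?thesis using splitting_field_aut[of F' \<tau>'] by auto
qed

lemma splitting_field_aut_moving:
  assumes "algebraic z" "z \<in> gen_field S" "z \<notin> \<rat>"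
  shows "\<exists>\<tau>\<in>field_auts (gen_field S). \<tau> z \<noteq> z"
proof -
  obtain F \<tau> where F: "is_subfield F" "z \<in> F" "field_hom F \<tau>" "\<tau> z \<noteq> z"
    using field_hom_moving[OF assms(1,3)] by blast
  then show ?thesis using splitting_field_hom_extend[OF F(1,3)] assms(2) by (metis IntI)
qed

text \<open>Lifts automorphisms of \<open>Q3\<close> to the splitting field of the two
  cubics.\<close>

lemma splitting_field_aut_extend:
  assumes "is_subfield K" "K \<subseteq> gen_field S" "\<sigma> \<in> field_auts K"
  shows "\<exists>\<tau>\<in>field_auts (gen_field S). \<forall>x\<in>K. \<tau> x = \<sigma> x"
proof -
  have "field_hom K \<sigma>" using assms(1,3) by (simp add: field_auts_iff)
  then show ?thesis using splitting_field_hom_extend[OF assms(1)] assms(2) by (metis Int_absorb2)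
qed

end

section \<open>Homogeneous coordinates and the critical 2-cycle\<close>

text \<open>The point with homogeneous coordinates \<open>(x : z)\<close>; the junk value at \<open>(0, 0)\<close> is the point
  at infinity.\<close>
definition hp :: "complex \<Rightarrow> complex \<Rightarrow> p1" where
  "hp x z = (if z = 0 then None else Some (x / z))"

lemma hp_exists: "\<exists>x z. (x \<noteq> 0 \<or> z \<noteq> 0) \<and> P = hp x z"
proof (cases P)
  case None
  then show ?thesis by (intro exI[of _ 1] exI[of _ 0]) (simp add: hp_def)
next
  case (Some w)
  then show ?thesis by (intro exI[of _ w] exI[of _ 1]) (simp add: hp_def)
qed

lemma hp_eq_iff:
  "x \<noteq> 0 \<or> z \<noteq> 0 \<Longrightarrow> x' \<noteq> 0 \<or> z' \<noteq> 0 \<Longrightarrow> hp x z = hp x' z' \<longleftrightarrow> x * z' = x' * z"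
  by (auto simp: hp_def field_simps)

lemma hp_scale: "c \<noteq> 0 \<Longrightarrow> hp (c * x) (c * z) = hp x z"
  by (auto simp: hp_def)

lemma linear_nonzero:
  fixes a b c d x z :: "'a :: field"
  assumes "a * d - b * c \<noteq> 0" "x \<noteq> 0 \<or> z \<noteq> 0"
  shows "a * x + b * z \<noteq> 0 \<or> c * x + d * z \<noteq> 0"
proof (rule ccontr)
  assume "\<not> ?thesis"
  then have 0: "a * x + b * z = 0" "c * x + d * z = 0" by auto
  have "(a * d - b * c) * x = d * (a * x + b * z) - b * (c * x + d * z)"
    "(a * d - b * c) * z = a * (c * x + d * z) - c * (a * x + b * z)"
    by (simp_all add: algebra_simps)
  then show False using 0 assms by auto
qed

lemma mob_hp:
  assumes "a * d - b * c \<noteq> 0" "x \<noteq> 0 \<or> z \<noteq> 0"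
  shows "mob a b c d (hp x z) = hp (a * x + b * z) (c * x + d * z)"
proof (cases "z = 0")
  case True
  then show ?thesis using assms by (auto simp: mob_def hp_def)
next
  case False
  then have "c * (x / z) + d = 0 \<longleftrightarrow> c * x + d * z = 0" by (simp add: field_simps)
  moreover have "(a * (x / z) + b) / (c * (x / z) + d) = (a * x + b * z) / (c * x + d * z)"
    if "c * x + d * z \<noteq> 0"
    using False that by (simp add: divide_simps)
  ultimately show ?thesis using False by (auto simp: mob_def hp_def)
qed

lemma det_comp_nonzero:
  fixes a :: "'a :: field"
  assumes "a * d - b * c \<noteq> 0" "a' * d' - b' * c' \<noteq> 0"
  shows "(a * a' + b * c') * (c * b' + d * d') - (a * b' + b * d') * (c * a' + d * c') \<noteq> 0"
proof -
  have "(a * a' + b * c') * (c * b' + d * d') - (a * b' + b * d') * (c * a' + d * c') =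
    (a * d - b * c) * (a' * d' - b' * c')" by (simp add: algebra_simps)
  then show ?thesis using assms by simp
qed

lemma mob_comp:
  assumes "a * d - b * c \<noteq> 0" "a' * d' - b' * c' \<noteq> 0"
  shows "mob a b c d (mob a' b' c' d' P) =
    mob (a * a' + b * c') (a * b' + b * d') (c * a' + d * c') (c * b' + d * d') P"
proof -
  obtain x z where xz: "x \<noteq> 0 \<or> z \<noteq> 0" "P = hp x z" using hp_exists by blast
  show ?thesis
    using assms det_comp_nonzero[OF assms] xz linear_nonzero[OF assms(2) xz(1)]
    by (simp add: mob_hp algebra_simps)
qed

lemma mob_diag: "a \<noteq> 0 \<Longrightarrow> mob a 0 0 a P = P"
  by (cases P) (auto simp: mob_def)

lemma mob_inverse:
  assumes "a * d - b * c \<noteq> 0"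
  shows "mob a b c d (mob d (- b) (- c) a P) = P" "mob d (- b) (- c) a (mob a b c d P) = P"
proof -
  have det: "d * a - (- b) * (- c) \<noteq> 0" using assms by (simp add: algebra_simps)
  show "mob a b c d (mob d (- b) (- c) a P) = P"
    using assms mob_diag[of "a * d - b * c" P] by (subst mob_comp[OF assms det]) (simp add: algebra_simps)
  show "mob d (- b) (- c) a (mob a b c d P) = P"
    using assms mob_diag[of "a * d - b * c" P] by (subst mob_comp[OF det assms]) (simp add: algebra_simps)
qed

lemma mob_eq_iff: "a * d - b * c \<noteq> 0 \<Longrightarrow> mob a b c d P = mob a b c d Q \<longleftrightarrow> P = Q"
  by (metis mob_inverse(2))

lemma funpow_conj:
  assumes "\<And>P. M (f P) = g (M P)"
  shows "(g ^^ n) (M P) = M ((f ^^ n) P)"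
  by (induction n) (auto simp: assms)

lemma periodic_pt_conj:
  assumes "\<And>P. M (f P) = g (M P)" "inj M"
  shows "periodic_pt g n (M P) \<longleftrightarrow> periodic_pt f n P"
  using assms(2) by (simp add: periodic_pt_def funpow_conj[of M f g, OF assms(1)] inj_eq)

section \<open>Rational functions of degree 2 as pairs of quadratic forms\<close>

lemma coeff_cpoly: "coeff (cpoly p) i = of_rat (coeff p i)"
  by (simp add: cpoly_def coeff_map_poly)

lemma degree_cpoly: "degree (cpoly p) = degree p"
  by (simp add: cpoly_def degree_map_poly)

lemma cpoly_eq_0_iff: "cpoly p = 0 \<longleftrightarrow> p = 0"
  by (auto simp: poly_eq_iff coeff_cpoly)

lemma cpoly_add: "cpoly (p + q) = cpoly p + cpoly q"
  by (simp add: poly_eq_iff coeff_cpoly of_rat_add)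

lemma cpoly_mult: "cpoly (p * q) = cpoly p * cpoly q"
  by (simp add: poly_eq_iff coeff_cpoly coeff_mult of_rat_sum of_rat_mult)

lemma poly_over_Rats_iff: "poly_over \<rat> p \<longleftrightarrow> (\<exists>q. p = cpoly q)"
proof
  assume p: "poly_over \<rat> p"
  define q where "q = map_poly (\<lambda>x. SOME r. x = of_rat r) p"
  have *: "of_rat (SOME r. x = of_rat r) = x" if x: "x \<in> \<rat>" for x :: complex
  proof -
    obtain r where "x = of_rat r" using x by (auto elim: Rats_cases)
    then show ?thesis by (metis (mono_tags, lifting) someI)
  qed
  have "p = cpoly q"
  proof (rule poly_eqI)
    fix i
    show "coeff p i = coeff (cpoly q) i"
      using p *[of "coeff p i"] *[of 0] by (simp add: q_def coeff_cpoly coeff_map_poly poly_over_def)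
  qed
  then show "\<exists>q. p = cpoly q" ..
qed (auto simp: poly_over_def coeff_cpoly)

text \<open>Coprimality over the rationals has to be carried over to the complex numbers: a common
  complex root is algebraic, and its minimal polynomial over the rationals divides both
  \<open>p\<close> and \<open>q\<close>.\<close>

lemma cpoly_coprime_no_common_root:
  assumes "coprime p q"
  shows "poly (cpoly p) z \<noteq> 0 \<or> poly (cpoly q) z \<noteq> 0"
proof (rule ccontr)
  assume "\<not> ?thesis"
  then have z: "poly (cpoly p) z = 0" "poly (cpoly q) z = 0" by auto
  have over: "poly_over \<rat> (cpoly r)" for r using poly_over_Rats_iff by blast
  have "p \<noteq> 0 \<or> q \<noteq> 0" using assms by auto
  then have "algebraic z"
    using z algebraicI'[of "cpoly p" z] algebraicI'[of "cpoly q" z]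
    by (auto simp: coeff_cpoly cpoly_eq_0_iff)
  then obtain m where m: "min_poly_over \<rat> z m"
    using min_poly_over_exists[OF is_subfield_Rats] by blast
  then obtain m' where m': "m = cpoly m'" by (auto simp: min_poly_over_def poly_over_Rats_iff)
  have dvd: "m' dvd r" if r: "poly (cpoly r) z = 0" for r
  proof -
    obtain d where "poly_over \<rat> d" "cpoly r = m * d"
      using min_poly_over_dvd[OF is_subfield_Rats m over r] by blast
    then obtain d' where "cpoly r = cpoly (m' * d')" by (auto simp: poly_over_Rats_iff m' cpoly_mult)
    then have "r = m' * d'" by (simp add: poly_eq_iff coeff_cpoly)
    then show ?thesis by simp
  qed
  have "is_unit m'" using assms dvd[OF z(1)] dvd[OF z(2)] by (rule coprime_common_divisor)
  then have "degree m = 0" using m' is_unit_iff_degree[of m'] by (cases "m' = 0") (auto simp: degree_cpoly)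
  then show False using min_poly_over_degree_pos[OF m] by simp
qed

text \<open>The homogenisation of \<open>p\<close> in degree 2, which spares a separate treatment of
  the point at infinity.\<close>

definition qform :: "complex poly \<Rightarrow> complex \<Rightarrow> complex \<Rightarrow> complex" where
  "qform p x z = coeff p 2 * x\<^sup>2 + coeff p 1 * x * z + coeff p 0 * z\<^sup>2"

lemma poly_degree_le_2:
  fixes p :: "'a :: comm_ring_1 poly"
  assumes "degree p \<le> 2"
  shows "poly p x = coeff p 2 * x\<^sup>2 + coeff p 1 * x + coeff p 0"
proof -
  have "poly p x = (\<Sum>i\<le>2. coeff p i * x ^ i)"
    unfolding poly_altdef using assms
    by (intro sum.mono_neutral_left) (auto simp: not_le coeff_eq_0)
  then show ?thesis by (simp add: numeral_2_eq_2 algebra_simps)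
qed

lemma qform_eq_poly:
  assumes "degree p \<le> 2" "z \<noteq> 0"
  shows "qform p x z = z\<^sup>2 * poly p (x / z)"
  using assms by (simp add: poly_degree_le_2 qform_def field_simps power2_eq_square)

lemma qform_diff_smult: "qform (p - smult c q) x z = qform p x z - c * qform q x z"
  by (simp add: qform_def algebra_simps)

lemma rf_eval_hp:
  assumes deg: "rf_deg \<phi> = 2" and xz: "x \<noteq> 0 \<or> z \<noteq> 0"
  shows "rf_eval \<phi> (hp x z) = hp (qform (cpoly (fst \<phi>)) x z) (qform (cpoly (snd \<phi>)) x z)"
proof -
  let ?p = "cpoly (fst \<phi>)" and ?q = "cpoly (snd \<phi>)"
  have d: "degree ?p \<le> 2" "degree ?q \<le> 2" "degree ?p = 2 \<or> degree ?q = 2"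
    using deg by (auto simp: rf_deg_def degree_cpoly max_def split: if_splits)
  show ?thesis
  proof (cases "z = 0")
    case False
    then show ?thesis
      using d by (auto simp: hp_def rf_eval_def Let_def qform_eq_poly)
  next
    case True
    then have x: "x \<noteq> 0" using xz by simp
    have c2: "coeff ?q 2 = 0 \<longleftrightarrow> degree ?q < 2" "coeff ?p 2 = 0 \<longleftrightarrow> degree ?p < 2"
      using d leading_coeff_0_iff[of ?q] leading_coeff_0_iff[of ?p]
      by (auto simp: coeff_eq_0 le_less)
        (metis degree_0 leading_coeff_0_iff zero_neq_numeral)+
    have "rf_eval \<phi> None = hp (coeff ?p 2) (coeff ?q 2)"
      using d c2 by (auto simp: hp_def rf_eval_def Let_def)
    then show ?thesis using True x by (simp add: hp_def qform_def)
  qed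
qed

lemma qform_nonzero:
  assumes "rf_ok \<phi>" "rf_deg \<phi> = 2" "x \<noteq> 0 \<or> z \<noteq> 0"
  shows "qform (cpoly (fst \<phi>)) x z \<noteq> 0 \<or> qform (cpoly (snd \<phi>)) x z \<noteq> 0"
proof -
  let ?p = "cpoly (fst \<phi>)" and ?q = "cpoly (snd \<phi>)"
  have d: "degree ?p \<le> 2" "degree ?q \<le> 2" "degree ?p = 2 \<or> degree ?q = 2"
    using assms(2) by (auto simp: rf_deg_def degree_cpoly max_def split: if_splits)
  show ?thesis
  proof (cases "z = 0")
    case False
    then show ?thesis
      using d assms(1) cpoly_coprime_no_common_root[of "fst \<phi>" "snd \<phi>" "x / z"]
      by (simp add: qform_eq_poly rf_ok_def)
  next
    case True
    moreover have "coeff ?p 2 \<noteq> 0 \<or> coeff ?q 2 \<noteq> 0"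
      using d by (metis leading_coeff_0_iff degree_0 zero_neq_numeral)
    ultimately show ?thesis using assms(3) by (simp add: qform_def)
  qed
qed

lemma double_root_quadratic:
  fixes r :: "complex poly"
  assumes "degree r \<le> 2" "r = 0 \<or> order a r \<ge> 2"
  shows "\<exists>k. \<forall>x z. qform r x z = k * (x - a * z)\<^sup>2"
proof (cases "r = 0")
  case True
  then show ?thesis by (auto simp: qform_def intro: exI[of _ 0])
next
  case False
  then have "[:- a, 1:] ^ 2 dvd r" using assms by (simp add: order_divides)
  then obtain w where w: "r = [:- a, 1:] ^ 2 * w" by auto
  then have "w \<noteq> 0" using False by auto
  then have "degree r = 2 + degree w"
    unfolding w by (subst degree_mult_eq) (auto simp: degree_power_eq)
  then have "degree w = 0" using assms by simp
  then obtain k where "w = [:k:]" by (auto elim: degree_eq_zeroE)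
  then have "r = [:k * a\<^sup>2, - 2 * k * a, k:]" using w by (simp add: power2_eq_square algebra_simps)
  then show ?thesis
    by (intro exI[of _ k]) (auto simp: qform_def power2_eq_square algebra_simps numeral_2_eq_2)
qed

text \<open>The form \<open>c2 * p - c1 * q\<close> cuts out the fibre over the image of
  \<open>P\<close>. Ramification at \<open>P\<close> is a double zero there, so the form is a
  multiple of the square of the linear form vanishing at \<open>P\<close>. The four cases are those
  of \<open>rf_ram\<close>, with \<open>P\<close> or its image at infinity.\<close>

lemma critical_pt_form:
  assumes deg: "rf_deg \<phi> = 2" and crit: "critical_pt \<phi> P"
  shows "\<exists>a1 a2 c1 c2 k. (a1 \<noteq> 0 \<or> a2 \<noteq> 0) \<and> (c1 \<noteq> 0 \<or> c2 \<noteq> 0) \<and> P = hp a1 a2 \<and>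
    rf_eval \<phi> P = hp c1 c2 \<and>
    (\<forall>x z. c2 * qform (cpoly (fst \<phi>)) x z - c1 * qform (cpoly (snd \<phi>)) x z = k * (a2 * x - a1 * z)\<^sup>2)"
proof -
  let ?p = "cpoly (fst \<phi>)" and ?q = "cpoly (snd \<phi>)"
  have d: "degree ?p \<le> 2" "degree ?q \<le> 2"
    using deg by (auto simp: rf_deg_def degree_cpoly max_def split: if_splits)
  have dc: "degree (?p - smult c ?q) \<le> 2" for c
    using d by (intro degree_diff_le order.trans[OF degree_smult_le]) auto
  have const: "qform r x z = coeff r 0 * z\<^sup>2" if "degree r = 0" for r x z
    using that by (simp add: qform_def coeff_eq_0)
  note crit' = crit[unfolded critical_pt_def rf_ram_def Let_def deg]
  show ?thesis
  proof (cases P)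
    case P: (Some a)
    show ?thesis
    proof (cases "rf_eval \<phi> P")
      case (Some c)
      then have "order a (?p - smult c ?q) \<ge> 2" using crit' P by simp
      from double_root_quadratic[OF dc disjI2[OF this]]
      obtain k where "\<forall>x z. qform (?p - smult c ?q) x z = k * (x - a * z)\<^sup>2" by blast
      then show ?thesis
        using P Some by (intro exI[of _ a] exI[of _ 1] exI[of _ c] exI[of _ 1] exI[of _ k])
          (simp add: hp_def qform_diff_smult)
    next
      case None
      then have "order a ?q \<ge> 2" using crit' P by simp
      from double_root_quadratic[OF d(2) disjI2[OF this]]
      obtain k where "\<forall>x z. qform ?q x z = k * (x - a * z)\<^sup>2" by blast
      then show ?thesis
        using P None by (intro exI[of _ a] exI[of _ 1] exI[of _ 1] exI[of _ 0] exI[of _ "- k"])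
          (simp add: hp_def)
    qed
  next
    case P: None
    show ?thesis
    proof (cases "rf_eval \<phi> P")
      case (Some c)
      then have "degree (?p - smult c ?q) = 0" using crit' P by simp
      from const[OF this] show ?thesis
        using P Some by (intro exI[of _ 1] exI[of _ 0] exI[of _ c] exI[of _ 1]
            exI[of _ "coeff (?p - smult c ?q) 0"]) (simp add: hp_def qform_diff_smult)
    next
      case None
      then have "degree ?q = 0" using crit' P by simp
      from const[OF this] show ?thesis
        using P None by (intro exI[of _ 1] exI[of _ 0] exI[of _ 1] exI[of _ 0]
            exI[of _ "- coeff ?q 0"]) (simp add: hp_def)
    qed
  qed
qed

text \<open>In the coordinate in which the critical point is \<open>0\<close> and its image is \<open>\<infinity>\<close>, the map is
  \<open>y \<mapsto> (B y + A) / (k y\<^sup>2)\<close>.\<close>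
lemma critical_2_cycle_normal_form:
  assumes ok: "rf_ok \<phi>" and deg: "rf_deg \<phi> = 2"
    and crit: "critical_pt \<phi> P" and per: "periodic_pt (rf_eval \<phi>) 2 P"
  shows "\<exists>a b c d A B k. a * d - b * c \<noteq> 0 \<and> A \<noteq> 0 \<and> k \<noteq> 0 \<and>
    (\<forall>s t. s \<noteq> 0 \<or> t \<noteq> 0 \<longrightarrow>
      rf_eval \<phi> (mob a b c d (hp s t)) = mob a b c d (hp (B * s * t + A * t\<^sup>2) (k * s\<^sup>2)))"
proof -
  let ?p = "qform (cpoly (fst \<phi>))" and ?q = "qform (cpoly (snd \<phi>))"
  obtain a1 a2 c1 c2 \<alpha> where a: "a1 \<noteq> 0 \<or> a2 \<noteq> 0" "P = hp a1 a2"
    and c: "c1 \<noteq> 0 \<or> c2 \<noteq> 0" "rf_eval \<phi> P = hp c1 c2"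
    and \<alpha>: "\<And>x z. c2 * ?p x z - c1 * ?q x z = \<alpha> * (a2 * x - a1 * z)\<^sup>2"
    using critical_pt_form[OF deg crit] by blast
  have QP: "rf_eval \<phi> (hp c1 c2) = hp a1 a2" and neq: "hp c1 c2 \<noteq> hp a1 a2"
    using per c a unfolding periodic_pt_def by (auto simp: numeral_2_eq_2 dest: spec[of _ 1])
  \<comment> \<open>The vectors \<open>c\<close> of the image of \<open>P\<close> and
    \<open>a\<close> of \<open>P\<close> serve as a basis, with coordinates \<open>s\<close> and
    \<open>t\<close> and determinant \<open>D\<close> up to sign. Divided by \<open>D\<close>, the
    forms \<open>U\<close> below and the left-hand side of \<open>V\<close> are the coordinates of
    the image vector along \<open>c\<close> and along \<open>a\<close>.\<close>
  define D where "D = a1 * c2 - a2 * c1"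
  have D: "D \<noteq> 0" using neq hp_eq_iff[OF c(1) a(1)] by (auto simp: D_def mult.commute)
  define U where "U s t = a1 * ?q (s * c1 + t * a1) (s * c2 + t * a2) - a2 * ?p (s * c1 + t * a1) (s * c2 + t * a2)" for s t
  have U_form: "U s t = U 1 0 * s\<^sup>2 + (U 1 1 - U 1 0 - U 0 1) * s * t + U 0 1 * t\<^sup>2" for s t
    unfolding U_def qform_def by (simp add: power2_eq_square algebra_simps)
  \<comment> \<open>The map sends \<open>(c1 : c2)\<close> back to \<open>(a1 : a2)\<close>, so
    \<open>U\<close> has no term in \<open>s^2\<close>.\<close>
  have U10: "U 1 0 = 0"
    using QP hp_eq_iff[OF qform_nonzero[OF ok deg c(1)] a(1)] rf_eval_hp[OF deg c(1)]
    by (simp add: U_def algebra_simps)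
  \<comment> \<open>The double zero at \<open>P\<close>, where \<open>s = 0\<close>, leaves only a
    multiple of \<open>s^2\<close>.\<close>
  have V: "c2 * ?p (s * c1 + t * a1) (s * c2 + t * a2) - c1 * ?q (s * c1 + t * a1) (s * c2 + t * a2)
    = \<alpha> * D\<^sup>2 * s\<^sup>2" for s t
    unfolding \<alpha> D_def by (simp add: power2_eq_square algebra_simps)
  define B where "B = U 1 1 - U 0 1"
  define A where "A = U 0 1"
  define k where "k = \<alpha> * D\<^sup>2"
  have UBA: "U s t = B * s * t + A * t\<^sup>2" for s t
    using U_form[of s t] by (simp add: U10 B_def A_def)
  have det: "c1 * a2 - a1 * c2 \<noteq> 0" using D by (simp add: D_def algebra_simps)
  have key: "D * ?p (c1 * s + a1 * t) (c2 * s + a2 * t) = c1 * (B * s * t + A * t\<^sup>2) + a1 * (k * s\<^sup>2)"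
    "D * ?q (c1 * s + a1 * t) (c2 * s + a2 * t) = c2 * (B * s * t + A * t\<^sup>2) + a2 * (k * s\<^sup>2)" for s t
  proof -
    have xz: "s * c1 + t * a1 = c1 * s + a1 * t" "s * c2 + t * a2 = c2 * s + a2 * t"
      by (simp_all add: algebra_simps)
    have K: "k * s\<^sup>2 = c2 * ?p (c1 * s + a1 * t) (c2 * s + a2 * t) - c1 * ?q (c1 * s + a1 * t) (c2 * s + a2 * t)"
      using V[of s t] by (simp add: k_def xz)
    have BA: "B * s * t + A * t\<^sup>2 =
      a1 * ?q (c1 * s + a1 * t) (c2 * s + a2 * t) - a2 * ?p (c1 * s + a1 * t) (c2 * s + a2 * t)"
      using UBA[of s t] by (simp add: U_def xz)
    show "D * ?p (c1 * s + a1 * t) (c2 * s + a2 * t) = c1 * (B * s * t + A * t\<^sup>2) + a1 * (k * s\<^sup>2)"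
      "D * ?q (c1 * s + a1 * t) (c2 * s + a2 * t) = c2 * (B * s * t + A * t\<^sup>2) + a2 * (k * s\<^sup>2)"
      unfolding K BA by (simp_all add: D_def algebra_simps)
  qed
  have nz: "B * s * t + A * t\<^sup>2 \<noteq> 0 \<or> k * s\<^sup>2 \<noteq> 0" if st: "s \<noteq> 0 \<or> t \<noteq> 0" for s t
  proof (rule ccontr)
    assume "\<not> ?thesis"
    then have "D * ?p (c1 * s + a1 * t) (c2 * s + a2 * t) = 0"
      "D * ?q (c1 * s + a1 * t) (c2 * s + a2 * t) = 0" unfolding key by auto
    then show False
      using D qform_nonzero[OF ok deg linear_nonzero[OF det st]] by auto
  qed
  have "A \<noteq> 0" using nz[of 0 1] by simp
  moreover have "k \<noteq> 0" using nz[of 1 0] by simp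
  moreover have "rf_eval \<phi> (mob c1 a1 c2 a2 (hp s t)) =
    mob c1 a1 c2 a2 (hp (B * s * t + A * t\<^sup>2) (k * s\<^sup>2))" if st: "s \<noteq> 0 \<or> t \<noteq> 0" for s t
  proof -
    have "rf_eval \<phi> (mob c1 a1 c2 a2 (hp s t)) =
      hp (?p (c1 * s + a1 * t) (c2 * s + a2 * t)) (?q (c1 * s + a1 * t) (c2 * s + a2 * t))"
      by (simp only: mob_hp[OF det st] rf_eval_hp[OF deg linear_nonzero[OF det st]])
    also have "\<dots> = hp (D * ?p (c1 * s + a1 * t) (c2 * s + a2 * t)) (D * ?q (c1 * s + a1 * t) (c2 * s + a2 * t))"
      using hp_scale[OF D] by simp
    also have "\<dots> = mob c1 a1 c2 a2 (hp (B * s * t + A * t\<^sup>2) (k * s\<^sup>2))"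
      by (simp only: key mob_hp[OF det nz[OF st]])
    finally show ?thesis .
  qed
  ultimately show ?thesis using det by blast
qed

lemma mob_fix_0_inf_imp_id:
  assumes det: "a * d - b * c \<noteq> 0"
    and fix0: "mob a b c d (hp 0 1) = hp 0 1" and fixinf: "mob a b c d (hp 1 0) = hp 1 0"
    and fixw: "mob a b c d (hp x z) = hp x z" and xz: "x \<noteq> 0" "z \<noteq> 0"
  shows "mob a b c d P = P"
proof -
  have "b = 0" using fix0 mob_hp[OF det, of 0 1] linear_nonzero[OF det, of 0 1]
    by (simp add: hp_eq_iff)
  moreover have "c = 0" using fixinf mob_hp[OF det, of 1 0] linear_nonzero[OF det, of 1 0]
    by (simp add: hp_eq_iff)
  moreover have "a = d" using fixw mob_hp[OF det, of x z] linear_nonzero[OF det, of x z] calculation xz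
    by (simp add: hp_eq_iff)
  ultimately show ?thesis using det mob_diag[of a P] by simp
qed

text \<open>The map \<open>f\<close> has the single 2-cycle \<open>{0, \<infinity>}\<close>, so an automorphism preserves it. If
  \<open>B \<noteq> 0\<close> then \<open>0\<close> has the second preimage \<open>-A/B\<close> besides \<open>\<infinity>\<close> while \<open>\<infinity>\<close> has only the
  preimage \<open>0\<close>; so the automorphism fixes \<open>0\<close>, \<open>\<infinity>\<close> and \<open>-A/B\<close>.\<close>
lemma normal_form_aut_trivial:
  assumes f: "\<And>s t. s \<noteq> 0 \<or> t \<noteq> 0 \<Longrightarrow> f (hp s t) = hp (B * s * t + A * t\<^sup>2) (k * s\<^sup>2)"
    and ABk: "A \<noteq> 0" "B \<noteq> 0" "k \<noteq> 0"
    and det: "a * d - b * c \<noteq> 0" and comm: "\<And>P. mob a b c d (f P) = f (mob a b c d P)"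
  shows "mob a b c d P = P"
proof -
  let ?T = "mob a b c d" and ?O = "hp 0 1" and ?I = "hp 1 0" and ?w = "hp (- A) B"
  have nz: "B * s * t + A * t\<^sup>2 \<noteq> 0 \<or> k * s\<^sup>2 \<noteq> 0" if "s \<noteq> 0 \<or> t \<noteq> 0" for s t
    using that ABk by auto
  have fO: "f ?O = ?I" and fI: "f ?I = ?O" using f[of 0 1] f[of 1 0] ABk by (auto simp: hp_def)
  have fw: "f ?w = ?O" using f[of "- A" B] ABk by (auto simp: hp_def power2_eq_square)
  have pre_O: "P = ?I \<or> P = ?w" if "f P = ?O" for P
  proof -
    obtain s t where st: "s \<noteq> 0 \<or> t \<noteq> 0" "P = hp s t" using hp_exists by blast
    then have "t * (B * s + A * t) = 0"
      using that f[OF st(1)] hp_eq_iff[OF nz[OF st(1)], of 0 1]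
      by (simp add: algebra_simps power2_eq_square)
    then consider "t = 0" | "B * s + A * t = 0" by auto
    then show ?thesis
    proof cases
      case 1
      then show ?thesis using st hp_eq_iff[OF st(1), of 1 0] by auto
    next
      case 2
      then have "s * B = - A * t" by (simp add: algebra_simps eq_neg_iff_add_eq_0)
      then show ?thesis using st hp_eq_iff[OF st(1), of "- A" B] ABk by auto
    qed
  qed
  have pre_I: "P = ?O" if "f P = ?I" for P
  proof -
    obtain s t where st: "s \<noteq> 0 \<or> t \<noteq> 0" "P = hp s t" using hp_exists by blast
    then have "s = 0" using that f[OF st(1)] hp_eq_iff[OF nz[OF st(1)], of 1 0] ABk by simp
    then show ?thesis using st hp_eq_iff[OF st(1), of 0 1] by auto
  qed
  have cycle: "P = ?O \<or> P = ?I" if "f (f P) = P" "f P \<noteq> P" for P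
  proof (rule ccontr)
    assume ne: "\<not> ?thesis"
    obtain s t where st: "s \<noteq> 0 \<or> t \<noteq> 0" "P = hp s t" using hp_exists by blast
    obtain s' t' where st': "s' \<noteq> 0 \<or> t' \<noteq> 0" "f P = hp s' t'" using hp_exists by blast
    have s: "s \<noteq> 0" using ne st by (auto simp: hp_def)
    have t: "t \<noteq> 0" using ne st by (auto simp: hp_def)
    have "f P \<noteq> ?O" "f P \<noteq> ?I" using that ne fO fI by metis+
    then have s': "s' \<noteq> 0" and t': "t' \<noteq> 0" using st' by (auto simp: hp_def)
    define x y where "x = s / t" and "y = s' / t'"
    have x: "P = hp x 1" "x \<noteq> 0" and y: "f P = hp y 1" "y \<noteq> 0"
      using st st' s t s' t' by (auto simp: x_def y_def hp_def)
    have 1: "B * x + A = y * (k * x\<^sup>2)"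
      using f[of x 1] x y nz[of x 1] hp_eq_iff[of "B * x + A" "k * x\<^sup>2" y 1] by simp
    have 2: "B * y + A = x * (k * y\<^sup>2)"
      using f[of y 1] x y that nz[of y 1] hp_eq_iff[of "B * y + A" "k * y\<^sup>2" x 1] by simp
    have "x \<noteq> y" using that x y by auto
    \<comment> \<open>Subtracting the two equations of a 2-cycle and cancelling \<open>x - y\<close>
      gives \<open>k * x * y = B\<close>; the first equation then forces
      \<open>A = 0\<close>.\<close>
    have "(x - y) * (k * x * y - B) = (y * (k * x\<^sup>2) - (B * x + A)) - (x * (k * y\<^sup>2) - (B * y + A))"
      by (simp add: algebra_simps power2_eq_square)
    then have "k * x * y = B" using 1 2 \<open>x \<noteq> y\<close> by simp
    moreover have "A = (k * x * y - B) * x" using 1 by (simp add: algebra_simps power2_eq_square)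
    ultimately show False using ABk by simp
  qed
  have inj: "?T P = ?T Q \<longleftrightarrow> P = Q" for P Q using mob_eq_iff[OF det] .
  have OI: "?O \<noteq> ?I" by (simp add: hp_def)
  have TO: "?T ?O = ?O \<or> ?T ?O = ?I"
    using cycle[of "?T ?O"] comm[symmetric] fO fI OI inj by metis
  have TI: "?T ?I = ?O \<or> ?T ?I = ?I"
    using cycle[of "?T ?I"] comm[symmetric] fO fI OI inj by metis
  have wI: "?w \<noteq> ?I" using ABk by (simp add: hp_def)
  show ?thesis
  proof (cases "?T ?O = ?O")
    case True
    then have I: "?T ?I = ?I" using TI inj OI by metis
    have "f (?T ?w) = ?O" using comm[of ?w] fw True by simp
    then have "?T ?w = ?w" using pre_O I inj wI by metis
    then show ?thesis using mob_fix_0_inf_imp_id[OF det True I] ABk by simp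
  next
    case False
    then have I: "?T ?O = ?I" "?T ?I = ?O" using TO TI inj OI by metis+
    have "f (?T ?w) = ?I" using comm[of ?w] fw I by simp
    then have "?T ?w = ?T ?I" using pre_I I by simp
    then show ?thesis using inj wI by simp
  qed
qed

lemma complex_cube_root_exists: "\<exists>w::complex. w ^ 3 = c"
proof -
  have "\<not> constant (poly [:- c, 0, 0, 1:])" by (simp add: constant_degree)
  then obtain w where "poly [:- c, 0, 0, 1:] w = 0" using fundamental_theorem_of_algebra by blast
  then show ?thesis by (intro exI[of _ w]) (simp add: power3_eq_cube algebra_simps)
qed

text \<open>The nontrivial automorphism, carried over to the coordinate of the normal form, forces
  \<open>B = 0\<close>; what remains is a rescaling.\<close>

lemma conj_inverse_square:
  assumes ok: "rf_ok \<phi>" and deg: "rf_deg \<phi> = 2"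
    and crit: "critical_pt \<phi> P" and per: "periodic_pt (rf_eval \<phi>) 2 P" and aut: "aut_nontrivial \<phi>"
  shows "\<exists>a b c d. a * d - b * c \<noteq> 0 \<and>
    (\<forall>s t. s \<noteq> 0 \<or> t \<noteq> 0 \<longrightarrow> rf_eval \<phi> (mob a b c d (hp s t)) = mob a b c d (hp (t\<^sup>2) (s\<^sup>2)))"
proof -
  obtain a b c d A B k where det: "a * d - b * c \<noteq> 0" and Ak: "A \<noteq> 0" "k \<noteq> 0"
    and nf: "\<And>s t. s \<noteq> 0 \<or> t \<noteq> 0 \<Longrightarrow>
      rf_eval \<phi> (mob a b c d (hp s t)) = mob a b c d (hp (B * s * t + A * t\<^sup>2) (k * s\<^sup>2))"
    using critical_2_cycle_normal_form[OF ok deg crit per] by blast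
  let ?N = "mob a b c d" and ?N' = "mob d (- b) (- c) a"
  have det': "d * a - (- b) * (- c) \<noteq> 0" using det by (simp add: algebra_simps)
  have "B = 0"
  proof (rule ccontr)
    assume B: "B \<noteq> 0"
    obtain p q r u where T: "p * u - q * r \<noteq> 0" "\<exists>P. mob p q r u P \<noteq> P"
      "\<And>P. mob p q r u (rf_eval \<phi> P) = rf_eval \<phi> (mob p q r u P)"
      using aut unfolding aut_nontrivial_def by blast
    define f where "f P = ?N' (rf_eval \<phi> (?N P))" for P
    have f: "f (hp s t) = hp (B * s * t + A * t\<^sup>2) (k * s\<^sup>2)" if "s \<noteq> 0 \<or> t \<noteq> 0" for s t
      using nf[OF that] mob_inverse(2)[OF det] by (simp add: f_def)
    note d1 = det_comp_nonzero[OF T(1) det] and d2 = det_comp_nonzero[OF det' det_comp_nonzero[OF T(1) det]]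
    define T' where "T' P = ?N' (mob p q r u (?N P))" for P
    note T'_eq = T'_def[unfolded mob_comp[OF T(1) det] mob_comp[OF det' d1]]
    have comm: "T' (f P) = f (T' P)" for P
      by (simp add: T'_def f_def mob_inverse[OF det] T(3))
    have "T' P = P" for P
      unfolding T'_eq
      by (rule normal_form_aut_trivial[OF f Ak(1) B Ak(2) d2]) (use comm in \<open>simp_all add: T'_eq\<close>)
    then have "mob p q r u (?N P) = ?N P" for P
      using mob_inverse(1)[OF det] by (metis T'_def)
    then show False using T(2) mob_inverse(1)[OF det] by metis
  qed
  \<comment> \<open>Rescaling \<open>y\<close> by \<open>w\<close> turns \<open>A / (k y^2)\<close>
    into \<open>1 / y^2\<close> exactly when \<open>w^3 = A / k\<close>.\<close>
  obtain w where w: "w ^ 3 = A / k" using complex_cube_root_exists by blast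
  have w0: "w \<noteq> 0" using w Ak by auto
  have dw: "w * 1 - 0 * 0 \<noteq> 0" using w0 by simp
  have "rf_eval \<phi> (?N (mob w 0 0 1 (hp s t))) = ?N (mob w 0 0 1 (hp (t\<^sup>2) (s\<^sup>2)))"
    if st: "s \<noteq> 0 \<or> t \<noteq> 0" for s t
  proof -
    have "A = k * w ^ 3" using w Ak by (simp add: field_simps)
    then have "hp (A * t\<^sup>2) (k * (w * s)\<^sup>2) = hp (k * w\<^sup>2 * (w * t\<^sup>2)) (k * w\<^sup>2 * s\<^sup>2)"
      by (simp add: power2_eq_square power3_eq_cube algebra_simps)
    also have "\<dots> = hp (w * t\<^sup>2) (s\<^sup>2)" using hp_scale[of "k * w\<^sup>2"] w0 Ak by simp
    finally show ?thesis
      using nf[of "w * s" t] st w0 mob_hp[OF dw, of s t] mob_hp[OF dw, of "t\<^sup>2" "s\<^sup>2"] \<open>B = 0\<close>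
      by auto
  qed
  then show ?thesis
    using det_comp_nonzero[OF det dw] unfolding mob_comp[OF det dw] by blast
qed

section \<open>Rational conjugation to the normal form\<close>

definition rat_pt :: "p1 \<Rightarrow> bool" where
  "rat_pt P \<longleftrightarrow> (\<exists>x z :: rat. (x \<noteq> 0 \<or> z \<noteq> 0) \<and> P = hp (of_rat x) (of_rat z))"

lemma rat_pt_Some_iff: "rat_pt (Some w) \<longleftrightarrow> w \<in> \<rat>"
proof
  assume "rat_pt (Some w)"
  then show "w \<in> \<rat>" by (auto simp: rat_pt_def hp_def split: if_splits)
next
  assume "w \<in> \<rat>"
  then obtain x where "w = of_rat x" by (auto elim: Rats_cases)
  then show "rat_pt (Some w)"
    unfolding rat_pt_def by (intro exI[of _ x] exI[of _ 1]) (simp add: hp_def)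
qed

lemma of_rat_det:
  "of_rat a * of_rat d - of_rat b * of_rat c \<noteq> (0 :: complex) \<longleftrightarrow> a * d - b * c \<noteq> 0"
  by (simp flip: of_rat_mult of_rat_diff)

lemma rat_pt_mob:
  assumes det: "a * d - b * c \<noteq> 0" and P: "rat_pt P"
  shows "rat_pt (mob (of_rat a) (of_rat b) (of_rat c) (of_rat d) P)"
proof -
  obtain x z where xz: "x \<noteq> 0 \<or> z \<noteq> 0" "P = hp (of_rat x) (of_rat z)"
    using P by (auto simp: rat_pt_def)
  have det': "of_rat a * of_rat d - of_rat b * of_rat c \<noteq> (0 :: complex)"
    using det of_rat_det by blast
  have "mob (of_rat a) (of_rat b) (of_rat c) (of_rat d) P =
      hp (of_rat (a * x + b * z)) (of_rat (c * x + d * z))"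
    using xz mob_hp[OF det', of "of_rat x" "of_rat z"] by (simp add: of_rat_add of_rat_mult)
  then show ?thesis
    unfolding rat_pt_def using linear_nonzero[OF det xz(1)] by blast
qed

lemma rat_pt_rf_eval:
  assumes ok: "rf_ok \<phi>" "rf_deg \<phi> = 2" and P: "rat_pt P"
  shows "rat_pt (rf_eval \<phi> P)"
proof -
  obtain x z where xz: "x \<noteq> 0 \<or> z \<noteq> 0" "P = hp (of_rat x) (of_rat z)"
    using P by (auto simp: rat_pt_def)
  then have nz: "of_rat x \<noteq> (0::complex) \<or> of_rat z \<noteq> (0::complex)" by simp
  let ?f = "\<lambda>p. coeff p 2 * x\<^sup>2 + coeff p 1 * x * z + coeff p 0 * z\<^sup>2"
  have f: "qform (cpoly p) (of_rat x) (of_rat z) = of_rat (?f p)" for p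
    by (simp add: qform_def coeff_cpoly of_rat_add of_rat_mult of_rat_power)
  have "rf_eval \<phi> P = hp (of_rat (?f (fst \<phi>))) (of_rat (?f (snd \<phi>)))"
    unfolding xz(2) rf_eval_hp[OF ok(2) nz] f ..
  moreover have "?f (fst \<phi>) \<noteq> 0 \<or> ?f (snd \<phi>) \<noteq> 0"
    using qform_nonzero[OF ok nz] unfolding f by (simp only: of_rat_eq_0_iff)
  ultimately show ?thesis unfolding rat_pt_def by blast
qed

lemma rat_mob_through_three_points:
  assumes "rat_pt P" "rat_pt Q" "rat_pt R" "P \<noteq> Q" "P \<noteq> R" "Q \<noteq> R"
  shows "\<exists>a b c d. a * d - b * c \<noteq> 0 \<and>
    mob (of_rat a) (of_rat b) (of_rat c) (of_rat d) (hp 1 0) = P \<and>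
    mob (of_rat a) (of_rat b) (of_rat c) (of_rat d) (hp 0 1) = Q \<and>
    mob (of_rat a) (of_rat b) (of_rat c) (of_rat d) (hp 1 1) = R"
proof -
  obtain p1 p2 where p: "p1 \<noteq> 0 \<or> p2 \<noteq> 0" "P = hp (of_rat p1) (of_rat p2)"
    using assms by (auto simp: rat_pt_def)
  obtain q1 q2 where q: "q1 \<noteq> 0 \<or> q2 \<noteq> 0" "Q = hp (of_rat q1) (of_rat q2)"
    using assms by (auto simp: rat_pt_def)
  obtain r1 r2 where r: "r1 \<noteq> 0 \<or> r2 \<noteq> 0" "R = hp (of_rat r1) (of_rat r2)"
    using assms by (auto simp: rat_pt_def)
  have ne: "x * z' - x' * z \<noteq> 0"
    if "hp (of_rat x) (of_rat z) \<noteq> hp (of_rat x') (of_rat z')" "x \<noteq> 0 \<or> z \<noteq> 0" "x' \<noteq> 0 \<or> z' \<noteq> 0"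
    for x z x' z'
    using that hp_eq_iff[of "of_rat x" "of_rat z" "of_rat x'" "of_rat z'"]
    by (simp flip: of_rat_mult)
  \<comment> \<open>Cramer's rule for \<open>\<alpha> p + \<beta> q = \<delta> r\<close>: scaling
    the columns \<open>p\<close> and \<open>q\<close> by \<open>\<alpha>\<close> and
    \<open>\<beta>\<close> sends \<open>(1 : 1)\<close> to \<open>R\<close>.\<close>
  define \<alpha> where "\<alpha> = r1 * q2 - q1 * r2"
  define \<beta> where "\<beta> = p1 * r2 - r1 * p2"
  define \<delta> where "\<delta> = p1 * q2 - q1 * p2"
  have \<alpha>: "\<alpha> \<noteq> 0" using ne[of r1 r2 q1 q2] assms q r by (auto simp: \<alpha>_def)
  have \<beta>: "\<beta> \<noteq> 0" using ne[of p1 p2 r1 r2] assms p r by (auto simp: \<beta>_def)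
  have \<delta>: "\<delta> \<noteq> 0" using ne[of p1 p2 q1 q2] assms p q by (auto simp: \<delta>_def)
  have "(\<alpha> * p1) * (\<beta> * q2) - (\<beta> * q1) * (\<alpha> * p2) = \<alpha> * \<beta> * \<delta>"
    by (simp add: \<delta>_def algebra_simps)
  then have det: "(\<alpha> * p1) * (\<beta> * q2) - (\<beta> * q1) * (\<alpha> * p2) \<noteq> 0" using \<alpha> \<beta> \<delta> by simp
  have comb: "\<alpha> * p1 + \<beta> * q1 = \<delta> * r1" "\<alpha> * p2 + \<beta> * q2 = \<delta> * r2"
    by (simp_all add: \<alpha>_def \<beta>_def \<delta>_def algebra_simps)
  have scale: "hp (of_rat (c * x)) (of_rat (c * z)) = hp (of_rat x) (of_rat z)" if "c \<noteq> 0" for c x z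
    using that hp_scale[of "of_rat c"] by (simp add: of_rat_mult)
  have det': "of_rat (\<alpha> * p1) * of_rat (\<beta> * q2) - of_rat (\<beta> * q1) * of_rat (\<alpha> * p2) \<noteq> (0 :: complex)"
    using det of_rat_det by blast
  let ?T = "mob (of_rat (\<alpha> * p1)) (of_rat (\<beta> * q1)) (of_rat (\<alpha> * p2)) (of_rat (\<beta> * q2))"
  have "?T (hp 1 0) = P" using scale[OF \<alpha>] p(2) mob_hp[OF det', of 1 0] by simp
  moreover have "?T (hp 0 1) = Q" using scale[OF \<beta>] q(2) mob_hp[OF det', of 0 1] by simp
  moreover have "?T (hp 1 1) = R"
  proof -
    have "?T (hp 1 1) = hp (of_rat (\<alpha> * p1 + \<beta> * q1)) (of_rat (\<alpha> * p2 + \<beta> * q2))"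
      using mob_hp[OF det', of 1 1] by (simp add: of_rat_add)
    then show ?thesis unfolding comb using scale[OF \<delta>] r(2) by simp
  qed
  ultimately show ?thesis using det by blast
qed

lemma infinite_Rats_complex: "infinite (\<rat> :: complex set)"
proof -
  have "infinite (range (of_nat :: nat \<Rightarrow> complex))"
    using infinite_UNIV_nat inj_of_nat by (simp add: range_inj_infinite)
  moreover have "range (of_nat :: nat \<Rightarrow> complex) \<subseteq> \<rat>" by auto
  ultimately show ?thesis using infinite_super by blast
qed

lemma psi_deg: "v \<noteq> 0 \<Longrightarrow> rf_deg (psi v) = 2"
  by (simp add: rf_deg_def psi_def)

lemma psi_hp:
  assumes "v \<noteq> 0" "x \<noteq> 0 \<or> z \<noteq> 0"
  shows "rf_eval (psi v) (hp x z) = hp (2 * x * z - z\<^sup>2) (of_rat v * x\<^sup>2 - z\<^sup>2)"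
  using rf_eval_hp[OF psi_deg[OF assms(1)] assms(2)]
  by (simp add: psi_def qform_def coeff_cpoly numeral_2_eq_2)

text \<open>If \<open>y = s\<close>, its image and its second image under \<open>y \<mapsto> 1/y\<^sup>2\<close> are moved to \<open>\<infinity>, 0, 1\<close>, the map
  becomes \<open>\<psi>\<^sub>v\<close> with \<open>v = (1 + s\<^sup>3)\<^sup>2 / s\<^sup>3\<close>.\<close>
lemma inverse_square_normalised:
  assumes det: "a * d - b * c \<noteq> 0"
    and s: "s \<noteq> 0" "s ^ 3 \<noteq> 1" "s ^ 3 \<noteq> - 1"
    and inf: "mob a b c d (hp s 1) = hp 1 0"
    and zero: "mob a b c d (hp 1 (s\<^sup>2)) = hp 0 1"
    and one: "mob a b c d (hp (s ^ 4) 1) = hp 1 1"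
    and v: "v * s ^ 3 = (1 + s ^ 3)\<^sup>2"
    and yt: "y \<noteq> 0 \<or> t \<noteq> 0"
  defines "x \<equiv> a * y + b * t" and "z \<equiv> c * y + d * t"
  shows "hp (2 * x * z - z\<^sup>2) (v * x\<^sup>2 - z\<^sup>2) = mob a b c d (hp (t\<^sup>2) (y\<^sup>2))"
proof -
  have "c * s + d = 0"
    using inf mob_hp[OF det, of s 1] linear_nonzero[OF det, of s 1] by (simp add: hp_eq_iff)
  then have 1: "d = - (c * s)" by (simp add: add_eq_0_iff)
  have "b * s\<^sup>2 + a = 0"
    using zero mob_hp[OF det, of 1 "s\<^sup>2"] linear_nonzero[OF det, of 1 "s\<^sup>2"]
    by (simp add: hp_eq_iff add.commute)
  then have 2: "a = - (b * s\<^sup>2)" by (simp add: add_eq_0_iff)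
  have 3: "a * s ^ 4 + b = c * s ^ 4 + d"
    using one mob_hp[OF det, of "s ^ 4" 1] linear_nonzero[OF det, of "s ^ 4" 1]
    by (simp add: hp_eq_iff)
  \<comment> \<open>The factor \<open>1 - s^3\<close> can be cancelled because \<open>s\<close> is
    not a fixed point of \<open>1/y^2\<close>.\<close>
  have "(1 - s ^ 3) * (c * s + b * (1 + s ^ 3)) = (a * s ^ 4 + b) - (c * s ^ 4 + d)"
    unfolding 1 2 by (simp add: algebra_simps eval_nat_numeral)
  then have "c * s + b * (1 + s ^ 3) = 0" using 3 s by simp
  then have 4: "b * (1 + s ^ 3) = - (c * s)" by (simp add: add_eq_0_iff)
  \<comment> \<open>Up to the scalar \<open>k\<close> the matrix has the rows \<open>s^3, -s\<close>
    and \<open>1 + s^3, -s (1 + s^3)\<close>.\<close>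
  define k where "k = c / (1 + s ^ 3)"
  have s3: "1 + s ^ 3 \<noteq> 0" using s(3) by (simp add: add_eq_0_iff)
  have c: "c = k * (1 + s ^ 3)" using s3 by (simp add: k_def)
  have b: "b = - k * s" 
  proof -
    have "b * (1 + s ^ 3) = (- k * s) * (1 + s ^ 3)" unfolding 4 by (subst c) simp
    then show ?thesis using mult_right_cancel[OF s3] by blast
  qed
  have a: "a = k * s ^ 3" unfolding 2 b by (simp add: power2_eq_square power3_eq_cube)
  have d: "d = - (k * s * (1 + s ^ 3))" unfolding 1 c by simp
  have k: "k \<noteq> 0" using det unfolding a b c d by auto
  define w where "w = 1 + s ^ 3"
  have x: "x = k * s * (s\<^sup>2 * y - t)" unfolding x_def a b by (simp add: algebra_simps power2_eq_square power3_eq_cube)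
  have z: "z = k * w * (y - s * t)" unfolding z_def c d w_def by (simp add: algebra_simps)
  have "v * x\<^sup>2 = (v * s ^ 3) * (k\<^sup>2 * (s\<^sup>2 * y - t)\<^sup>2) / s"
    unfolding x using s by (simp add: field_simps power2_eq_square power3_eq_cube)
  then have vx: "s * (v * x\<^sup>2) = w\<^sup>2 * k\<^sup>2 * (s\<^sup>2 * y - t)\<^sup>2" using s unfolding v w_def by simp
  \<comment> \<open>Both coordinates pick up the same factor \<open>k w (1 - s^3) / s\<close>, which
    cancels projectively.\<close>
  have id1: "s * (2 * x * z - z\<^sup>2) = (k * w * (1 - s ^ 3)) * (a * t\<^sup>2 + b * y\<^sup>2) "
    unfolding x z a b w_def by (simp add: algebra_simps power2_eq_square power3_eq_cube)
  have id2: "s * (v * x\<^sup>2 - z\<^sup>2) = (k * w * (1 - s ^ 3)) * (c * t\<^sup>2 + d * y\<^sup>2)"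
    unfolding right_diff_distrib vx
    unfolding z c d w_def by (simp add: algebra_simps power2_eq_square power3_eq_cube)
  have nz: "t\<^sup>2 \<noteq> 0 \<or> y\<^sup>2 \<noteq> 0" using yt by auto
  have f: "k * w * (1 - s ^ 3) \<noteq> 0" using k s s3 by (simp add: w_def)
  show ?thesis
    unfolding mob_hp[OF det nz]
    using hp_scale[OF s(1), of "2 * x * z - z\<^sup>2" "v * x\<^sup>2 - z\<^sup>2"]
      hp_scale[OF f, of "a * t\<^sup>2 + b * y\<^sup>2" "c * t\<^sup>2 + d * y\<^sup>2"]
    unfolding id1 id2 by simp
qed

lemma exists_rat_avoiding_finite:
  assumes "finite X" "inj M"
  shows "\<exists>w\<in>\<rat>. M (Some w :: p1) \<notin> X"
proof (rule ccontr)
  assume "\<not> ?thesis"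
  then have "(\<lambda>w. M (Some w)) ` \<rat> \<subseteq> X" by auto
  then have "finite ((\<lambda>w. M (Some w)) ` \<rat>)" using assms(1) finite_subset by blast
  moreover have "inj_on (\<lambda>w. M (Some w)) \<rat>" using assms(2) by (auto simp: inj_on_def)
  ultimately show False using infinite_Rats_complex finite_image_iff by blast
qed

lemma finite_complex_roots_of_unity: "n > 0 \<Longrightarrow> finite {y :: complex. y ^ n = 1}"
proof -
  assume n: "n > 0"
  have "monom 1 n - 1 \<noteq> (0 :: complex poly)"
  proof
    assume "monom 1 n - 1 = (0 :: complex poly)"
    then have "degree (monom (1 :: complex) n) = degree (1 :: complex poly)" by simp
    then show False using n by (simp add: degree_monom_eq)
  qed
  then have "finite {y :: complex. poly (monom 1 n - 1) y = 0}" by (rule poly_roots_finite)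
  then show ?thesis by (simp add: poly_monom)
qed

text \<open>The orbit of a rational point is rational. Its first four points become infinity, 0, 1
  and \<open>1/(v - 1)\<close>, the image of 1 under \<open>psi v\<close>; this is why
  \<open>v\<close> is rational although \<open>s\<close> need not be.\<close>

lemma lin_conj_psi_exists:
  assumes ok: "rf_ok \<phi>" and deg: "rf_deg \<phi> = 2"
    and crit: "critical_pt \<phi> P" and per: "periodic_pt (rf_eval \<phi>) 2 P" and aut: "aut_nontrivial \<phi>"
  shows "\<exists>v. v \<notin> {0, 4} \<and> lin_conj_Q \<phi> (psi v)"
proof -
  obtain a b c d where det: "a * d - b * c \<noteq> 0"
    and M: "\<And>s t. s \<noteq> 0 \<or> t \<noteq> 0 \<Longrightarrow> rf_eval \<phi> (mob a b c d (hp s t)) = mob a b c d (hp (t\<^sup>2) (s\<^sup>2))"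
    using conj_inverse_square[OF assms] by blast
  let ?M = "mob a b c d" and ?M' = "mob d (- b) (- c) a"
  \<comment> \<open>The critical 2-cycle, and the \<open>s\<close> for which the point, its image
    and its second image are not distinct: these satisfy \<open>s^3 = 1\<close> or
    \<open>s^6 = 1\<close>.\<close>
  let ?bad = "{None, Some 0} \<union> Some ` {y :: complex. y ^ 6 = 1}"
  have "finite ?bad" using finite_complex_roots_of_unity[of 6] by simp
  moreover have "inj ?M'" using mob_inverse(1)[OF det] by (metis injI)
  ultimately obtain w where w: "w \<in> \<rat>" "?M' (Some w) \<notin> ?bad"
    using exists_rat_avoiding_finite by meson
  then obtain s where s: "?M' (Some w) = Some s" by (cases "?M' (Some w)") auto
  then have s0: "s \<noteq> 0" and s6: "s ^ 6 \<noteq> 1" using w by auto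
  have "s ^ 6 = s ^ 3 * s ^ 3" by (simp flip: power_add)
  then have s3: "s ^ 3 \<noteq> 1" "s ^ 3 \<noteq> - 1" using s6 by (metis mult_1, metis minus_mult_minus mult_1)
  define r where "r = Some w"
  have r: "?M (hp s 1) = r" using mob_inverse(1)[OF det, of r] s by (simp add: r_def hp_def)
  have r1: "rf_eval \<phi> r = ?M (hp 1 (s\<^sup>2))" using M[of s 1] r by simp
  have r2: "rf_eval \<phi> (rf_eval \<phi> r) = ?M (hp (s ^ 4) 1)"
    unfolding r1 using M[of 1 "s\<^sup>2"] by (simp flip: power_mult)
  have r3: "rf_eval \<phi> (rf_eval \<phi> (rf_eval \<phi> r)) = ?M (hp 1 (s ^ 8))"
    unfolding r2 using M[of "s ^ 4" 1] by (simp flip: power_mult)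
  have rat: "rat_pt r" using w by (simp add: r_def rat_pt_Some_iff)
  note rat1 = rat_pt_rf_eval[OF ok deg rat]
  note rat2 = rat_pt_rf_eval[OF ok deg rat1]
  note rat3 = rat_pt_rf_eval[OF ok deg rat2]
  have ne: "r \<noteq> rf_eval \<phi> r" "r \<noteq> rf_eval \<phi> (rf_eval \<phi> r)" "rf_eval \<phi> r \<noteq> rf_eval \<phi> (rf_eval \<phi> r)"
  proof -
    have "s * s\<^sup>2 = s ^ 3" "s ^ 4 * s\<^sup>2 = s ^ 6" "s ^ 4 = s * s ^ 3" by (simp_all add: eval_nat_numeral)
    then have "hp s 1 \<noteq> hp 1 (s\<^sup>2)" "hp s 1 \<noteq> hp (s ^ 4) 1" "hp 1 (s\<^sup>2) \<noteq> hp (s ^ 4) 1"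
      using s0 s3 s6 by (simp_all add: hp_eq_iff)
    then show "r \<noteq> rf_eval \<phi> r" "r \<noteq> rf_eval \<phi> (rf_eval \<phi> r)" "rf_eval \<phi> r \<noteq> rf_eval \<phi> (rf_eval \<phi> r)"
      unfolding r2 unfolding r1 unfolding r[symmetric] mob_eq_iff[OF det] by blast+
  qed
  obtain p q u x where det\<sigma>: "p * x - q * u \<noteq> 0"
    and \<sigma>inf: "mob (of_rat p) (of_rat q) (of_rat u) (of_rat x) (hp 1 0) = r"
    and \<sigma>0: "mob (of_rat p) (of_rat q) (of_rat u) (of_rat x) (hp 0 1) = rf_eval \<phi> r"
    and \<sigma>1: "mob (of_rat p) (of_rat q) (of_rat u) (of_rat x) (hp 1 1) = rf_eval \<phi> (rf_eval \<phi> r)"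
    using rat_mob_through_three_points[OF rat rat1 rat2 ne] by blast
  let ?S = "mob (of_rat p) (of_rat q) (of_rat u) (of_rat x)"
  let ?S' = "mob (of_rat x) (- of_rat q) (- of_rat u) (of_rat p)"
  have detS: "of_rat p * of_rat x - of_rat q * of_rat u \<noteq> (0 :: complex)"
    using det\<sigma> of_rat_det by blast
  then have detS': "of_rat x * of_rat p - (- of_rat q) * (- of_rat u) \<noteq> (0 :: complex)"
    by (simp add: algebra_simps)
  define n1 where "n1 = of_rat x * a + (- of_rat q) * c"
  define n2 where "n2 = of_rat x * b + (- of_rat q) * d"
  define n3 where "n3 = (- of_rat u) * a + of_rat p * c"
  define n4 where "n4 = (- of_rat u) * b + of_rat p * d"
  have N: "mob n1 n2 n3 n4 P = ?S' (?M P)" for P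
    unfolding mob_comp[OF detS' det] n1_def n2_def n3_def n4_def ..
  have detN: "n1 * n4 - n2 * n3 \<noteq> 0"
    unfolding n1_def n2_def n3_def n4_def by (rule det_comp_nonzero[OF detS' det])
  have S'S: "?S' (?S P) = P" "?S (?S' P) = P" for P using mob_inverse[OF detS] by auto
  have Ninf: "mob n1 n2 n3 n4 (hp s 1) = hp 1 0"
    using S'S(1)[of "hp 1 0"] by (simp add: N r \<sigma>inf)
  have N0: "mob n1 n2 n3 n4 (hp 1 (s\<^sup>2)) = hp 0 1"
    using S'S(1)[of "hp 0 1"] by (simp add: N \<sigma>0 flip: r1)
  have N1: "mob n1 n2 n3 n4 (hp (s ^ 4) 1) = hp 1 1"
    using S'S(1)[of "hp 1 1"] by (simp add: N \<sigma>1 flip: r2)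
  define v where "v = (1 + s ^ 3)\<^sup>2 / s ^ 3"
  have v: "v * s ^ 3 = (1 + s ^ 3)\<^sup>2" using s0 by (simp add: v_def)
  note F = inverse_square_normalised[OF detN s0 s3 Ninf N0 N1 v]
  have "v \<in> \<rat>"
  proof -
    define X where "X = n1 * s ^ 4 + n2 * 1"
    define Z where "Z = n3 * s ^ 4 + n4 * 1"
    have nz: "s ^ 4 \<noteq> 0 \<or> (1::complex) \<noteq> 0" by simp
    have XZ: "X = Z" "X \<noteq> 0"
      using N1 mob_hp[OF detN nz] linear_nonzero[OF detN nz] hp_eq_iff[of X Z 1 1]
      by (auto simp: X_def Z_def)
    have "hp (2 * X * Z - Z\<^sup>2) (v * X\<^sup>2 - Z\<^sup>2) = ?S' (?M (hp 1 (s ^ 8)))"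
      using F[OF nz] by (simp add: X_def Z_def N flip: power_mult)
    also have "hp (2 * X * Z - Z\<^sup>2) (v * X\<^sup>2 - Z\<^sup>2) = hp (X\<^sup>2 * 1) (X\<^sup>2 * (v - 1))"
      using XZ by (simp add: algebra_simps power2_eq_square)
    also have "\<dots> = hp 1 (v - 1)" using XZ by (intro hp_scale) simp
    finally have "hp 1 (v - 1) = ?S' (rf_eval \<phi> (rf_eval \<phi> (rf_eval \<phi> r)))" unfolding r3 .
    moreover have "rat_pt (?S' (rf_eval \<phi> (rf_eval \<phi> (rf_eval \<phi> r))))"
    proof -
      have "x * p - (- q) * (- u) \<noteq> 0" using det\<sigma> by (simp add: algebra_simps)
      from rat_pt_mob[OF this rat3] show ?thesis by (simp add: of_rat_minus)
    qed
    ultimately have R: "rat_pt (hp 1 (v - 1))" by simp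
    show ?thesis
    proof (cases "v = 1")
      case False
      then have "1 / (v - 1) \<in> \<rat>" using R by (simp add: hp_def rat_pt_Some_iff)
      from Rats_add[OF Rats_inverse[OF this] Rats_1] show ?thesis using False by simp
    qed simp
  qed
  then obtain v' where v': "v = of_rat v'" by (auto elim: Rats_cases)
  have "v \<noteq> 0" using v s3 by (auto simp: add_eq_0_iff)
  then have v'0: "v' \<noteq> 0" using v' by auto
  have "v \<noteq> 4"
  proof
    assume "v = 4"
    then have "(1 - s ^ 3)\<^sup>2 = 0" using v by (simp add: power2_eq_square algebra_simps)
    then show False using s3 by simp
  qed
  then have v'4: "v' \<noteq> 4" using v' by auto
  have "?S (rf_eval (psi v') P) = rf_eval \<phi> (?S P)" for P
  proof -
    obtain y t where yt: "y \<noteq> 0 \<or> t \<noteq> 0" "?M' (?S P) = hp y t" using hp_exists by blast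
    have SP: "?S P = ?M (hp y t)" using yt(2) mob_inverse(1)[OF det, of "?S P"] by simp
    then have "P = mob n1 n2 n3 n4 (hp y t)" using S'S(1)[of P] by (simp add: N)
    then have P: "P = hp (n1 * y + n2 * t) (n3 * y + n4 * t)" using mob_hp[OF detN yt(1)] by simp
    have "rf_eval (psi v') P = mob n1 n2 n3 n4 (hp (t\<^sup>2) (y\<^sup>2))"
      unfolding P psi_hp[OF v'0 linear_nonzero[OF detN yt(1)]] v'[symmetric] by (rule F[OF yt(1)])
    then show ?thesis using S'S(2) M[OF yt(1)] by (simp add: N SP)
  qed
  then have "lin_conj_Q \<phi> (psi v')" unfolding lin_conj_Q_def using det\<sigma> by blast
  then show ?thesis using v'0 v'4 by blast
qed

section \<open>The 3-periodic points\<close>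

text \<open>The form of \<open>y \<mapsto> 1/y\<^sup>2\<close> with fixed points \<open>0, 1, \<infinity>\<close>: its automorphisms, the substitutions permuting
  \<open>0, 1, \<infinity>\<close>, are defined over \<open>\<rat>\<close>.\<close>
definition gfun :: ratfun where
  "gfun = ([:0, - 2, 1:], [:1, - 2:])"

lemma gfun_hp:
  assumes "s \<noteq> 0 \<or> t \<noteq> 0"
  shows "rf_eval gfun (hp s t) = hp (s\<^sup>2 - 2 * s * t) (t\<^sup>2 - 2 * s * t)"
proof -
  have "rf_deg gfun = 2" by (simp add: rf_deg_def gfun_def)
  from rf_eval_hp[OF this assms] show ?thesis
    by (simp add: gfun_def qform_def coeff_cpoly numeral_2_eq_2 algebra_simps of_rat_minus)
qed

lemma gfun_nonzero:
  fixes s t :: complex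
  assumes "s \<noteq> 0 \<or> t \<noteq> 0"
  shows "s\<^sup>2 - 2 * s * t \<noteq> 0 \<or> t\<^sup>2 - 2 * s * t \<noteq> 0"
proof (rule ccontr)
  assume "\<not> ?thesis"
  then have 0: "s * (s - 2 * t) = 0" "t * (t - 2 * s) = 0" by (auto simp: power2_eq_square algebra_simps)
  then show False using assms by auto
qed

text \<open>The third iterate has nine fixed points: infinity, which lowers the degree of
  \<open>X3 - a * Z3\<close> to 8, the fixed points 0 and 1 of \<open>gfun\<close>, and two
  3-cycles, one for each cubic factor.\<close>

lemma gfun_cube_identity:
  fixes a :: complex
  defines "X1 \<equiv> a\<^sup>2 - 2 * a" and "Z1 \<equiv> 1 - 2 * a"
  defines "X2 \<equiv> X1\<^sup>2 - 2 * X1 * Z1" and "Z2 \<equiv> Z1\<^sup>2 - 2 * X1 * Z1"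
  defines "X3 \<equiv> X2\<^sup>2 - 2 * X2 * Z2" and "Z3 \<equiv> Z2\<^sup>2 - 2 * X2 * Z2"
  shows "X3 - a * Z3 = 9 * (a * (a - 1) * ((a ^ 3 - 3 * a + 1) * (a ^ 3 - 3 * a\<^sup>2 + 1)))"
  unfolding X3_def Z3_def X2_def Z2_def X1_def Z1_def by algebra

lemma gfun_None: "rf_eval gfun None = None"
  by (simp add: rf_eval_def gfun_def Let_def degree_cpoly)

lemma gfun_cube_fixed_iff:
  "(rf_eval gfun ^^ 3) P = P \<longleftrightarrow>
    P \<in> {None, Some 0, Some 1} \<or> (\<exists>a. P = Some a \<and> (a ^ 3 - 3 * a + 1 = 0 \<or> a ^ 3 - 3 * a\<^sup>2 + 1 = 0))"
proof (cases P)
  case None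
  then show ?thesis by (simp add: numeral_3_eq_3 gfun_None)
next
  case (Some a)
  define X1 where "X1 = a\<^sup>2 - 2 * a"
  define Z1 where "Z1 = 1 - 2 * a"
  define X2 where "X2 = X1\<^sup>2 - 2 * X1 * Z1"
  define Z2 where "Z2 = Z1\<^sup>2 - 2 * X1 * Z1"
  define X3 where "X3 = X2\<^sup>2 - 2 * X2 * Z2"
  define Z3 where "Z3 = Z2\<^sup>2 - 2 * X2 * Z2"
  have nz0: "a \<noteq> 0 \<or> (1::complex) \<noteq> 0" by simp
  have nz1: "X1 \<noteq> 0 \<or> Z1 \<noteq> 0" using gfun_nonzero[OF nz0] by (simp add: X1_def Z1_def)
  have nz2: "X2 \<noteq> 0 \<or> Z2 \<noteq> 0" unfolding X2_def Z2_def by (rule gfun_nonzero[OF nz1])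
  have nz3: "X3 \<noteq> 0 \<or> Z3 \<noteq> 0" unfolding X3_def Z3_def by (rule gfun_nonzero[OF nz2])
  have P: "P = hp a 1" using Some by (simp add: hp_def)
  have "rf_eval gfun P = hp X1 Z1" using gfun_hp[OF nz0] by (simp add: P X1_def Z1_def)
  then have "rf_eval gfun (rf_eval gfun P) = hp X2 Z2"
    using gfun_hp[OF nz1] by (simp add: X2_def Z2_def)
  then have "rf_eval gfun (rf_eval gfun (rf_eval gfun P)) = hp X3 Z3"
    using gfun_hp[OF nz2] by (simp add: X3_def Z3_def)
  then have "(rf_eval gfun ^^ 3) P = P \<longleftrightarrow> X3 - a * Z3 = 0"
    unfolding P using hp_eq_iff[OF nz3 nz0] by (simp add: numeral_3_eq_3)
  also have "X3 - a * Z3 = 9 * (a * (a - 1) * ((a ^ 3 - 3 * a + 1) * (a ^ 3 - 3 * a\<^sup>2 + 1)))"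
    unfolding X3_def Z3_def X2_def Z2_def X1_def Z1_def by (rule gfun_cube_identity)
  finally show ?thesis using Some by auto
qed

lemma gfun_fixed_iff: "rf_eval gfun (Some a) = Some a \<longleftrightarrow> a = 0 \<or> a = 1"
proof -
  have nz: "a \<noteq> 0 \<or> (1::complex) \<noteq> 0" by simp
  have S: "Some a = hp a 1" by (simp add: hp_def)
  have "rf_eval gfun (Some a) = Some a \<longleftrightarrow> a\<^sup>2 - 2 * a * 1 = a * (1\<^sup>2 - 2 * a * 1)"
    unfolding S gfun_hp[OF nz] hp_eq_iff[OF gfun_nonzero[OF nz] nz] by simp
  also have "\<dots> \<longleftrightarrow> 3 * (a * (a - 1)) = 0" by (auto simp: algebra_simps power2_eq_square)
  finally show ?thesis by auto
qed

lemma periodic_pt_3_iff: "periodic_pt f 3 P \<longleftrightarrow> (f ^^ 3) P = P \<and> f P \<noteq> P"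
proof
  assume "periodic_pt f 3 P"
  then show "(f ^^ 3) P = P \<and> f P \<noteq> P" unfolding periodic_pt_def by (auto dest: spec[of _ 1])
next
  assume *: "(f ^^ 3) P = P \<and> f P \<noteq> P"
  have "(f ^^ m) P \<noteq> P" if m: "0 < m" "m < 3" for m
  proof -
    have "m = 1 \<or> m = 2" using m by auto
    then show ?thesis using * by (auto simp: numeral_2_eq_2 numeral_3_eq_3)
  qed
  then show "periodic_pt f 3 P" using * by (auto simp: periodic_pt_def)
qed

lemma gfun_periodic_3_iff:
  "periodic_pt (rf_eval gfun) 3 P \<longleftrightarrow>
    (\<exists>a. P = Some a \<and> (a ^ 3 - 3 * a + 1 = 0 \<or> a ^ 3 - 3 * a\<^sup>2 + 1 = 0))"
  unfolding periodic_pt_3_iff gfun_cube_fixed_iff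
  by (cases P) (auto simp: gfun_fixed_iff gfun_None)

text \<open>\<open>M\<close> sends 0, infinity and 1 to \<open>1/t0\<close>, \<open>1/t1\<close> and
  \<open>1/t2\<close>. Both sides are pairs of quadratic forms in \<open>s\<close> and
  \<open>t\<close>, compared coefficient by coefficient after multiplication by 3.\<close>

lemma gfun_conj_psi:
  assumes e1: "t0 + t1 + t2 = 3" and e2: "t0 * t1 + t1 * t2 + t2 * t0 = 0"
    and e3: "t0 * t1 * t2 = - of_rat v" and v: "v \<noteq> 0"
    and det: "(t2 - t0) * (- (t0 * (t2 - t1))) - (- (t2 - t1)) * (t1 * (t2 - t0)) \<noteq> 0"
  defines "M \<equiv> mob (t2 - t0) (- (t2 - t1)) (t1 * (t2 - t0)) (- (t0 * (t2 - t1)))"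
  shows "M (rf_eval gfun P) = rf_eval (psi v) (M P)"
proof -
  obtain s t where st: "s \<noteq> 0 \<or> t \<noteq> 0" "P = hp s t" using hp_exists by blast
  define x where "x = (t2 - t0) * s + (- (t2 - t1)) * t"
  define z where "z = t1 * (t2 - t0) * s + (- (t0 * (t2 - t1))) * t"
  define k where "k = (t1 - t0) * (t2 - t0) * (t2 - t1)"
  have k: "k \<noteq> 0" using det by (auto simp: k_def algebra_simps)
  have v': "of_rat v = - (t0 * t1 * t2)" using e3 by simp
  have t2: "t2 = 3 - t0 - t1" using e1 by (simp add: algebra_simps)
  \<comment> \<open>The six coefficient identities \<open>r1\<close> to \<open>r6\<close> hold
    modulo \<open>t0 * t1 + t1 * t2 + t2 * t0\<close>; the cofactor is written out on the right-hand
    side each time.\<close>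
  have "3 * (t1 * (2 - t1)) - (t1 - t0) * (t2 - t1) = 1 * (t0 * t1 + t1 * t2 + t2 * t0)"
    unfolding t2 by (simp add: algebra_simps power2_eq_square)
  then have r1: "3 * (t1 * (2 - t1)) = (t1 - t0) * (t2 - t1)" unfolding e2 by simp
  have "3 * (t0 * (2 - t0)) - (t0 - t1) * (t2 - t0) = 1 * (t0 * t1 + t1 * t2 + t2 * t0)"
    unfolding t2 by (simp add: algebra_simps power2_eq_square)
  then have r2: "3 * (t0 * (2 - t0)) = (t0 - t1) * (t2 - t0)" unfolding e2 by simp
  have "3 * (t1 * (2 - t0) + t0 * (2 - t1)) - 2 * (t1 - t0)\<^sup>2 = 2 * (t0 * t1 + t1 * t2 + t2 * t0)"
    unfolding t2 by (simp add: algebra_simps power2_eq_square)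
  then have r3: "3 * (t1 * (2 - t0) + t0 * (2 - t1)) = 2 * (t1 - t0)\<^sup>2" unfolding e2 by simp
  have "3 * (of_rat v - t1\<^sup>2) - t1 * (t1 - t0) * (t2 - t1) = (- 2 * t1) * (t0 * t1 + t1 * t2 + t2 * t0)"
    unfolding v' t2 by (simp add: algebra_simps power2_eq_square)
  then have r4: "3 * (of_rat v - t1\<^sup>2) = t1 * (t1 - t0) * (t2 - t1)" unfolding e2 by simp
  have "3 * (of_rat v - t0\<^sup>2) - t0 * (t0 - t1) * (t2 - t0) = (- 2 * t0) * (t0 * t1 + t1 * t2 + t2 * t0)"
    unfolding v' t2 by (simp add: algebra_simps power2_eq_square)
  then have r5: "3 * (of_rat v - t0\<^sup>2) = t0 * (t0 - t1) * (t2 - t0)" unfolding e2 by simp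
  have "3 * (of_rat v - t0 * t1) - t2 * (t1 - t0)\<^sup>2 = (- (t0 + t1)) * (t0 * t1 + t1 * t2 + t2 * t0)"
    unfolding v' t2 by (simp add: algebra_simps power2_eq_square)
  then have r6: "3 * (of_rat v - t0 * t1) = t2 * (t1 - t0)\<^sup>2" unfolding e2 by simp
  note r = r1 r2 r3 r4 r5 r6
  have "3 * (2 * x * z - z\<^sup>2) = 3 * (t1 * (2 - t1)) * (t2 - t0)\<^sup>2 * s\<^sup>2 +
    3 * (t0 * (2 - t0)) * (t2 - t1)\<^sup>2 * t\<^sup>2 -
    3 * (t1 * (2 - t0) + t0 * (2 - t1)) * (t2 - t0) * (t2 - t1) * s * t"
    unfolding x_def z_def by algebra
  then have id1: "3 * (2 * x * z - z\<^sup>2) =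
      k * ((t2 - t0) * (s\<^sup>2 - 2 * s * t) + (- (t2 - t1)) * (t\<^sup>2 - 2 * s * t))"
    unfolding r k_def by algebra
  have "3 * (of_rat v * x\<^sup>2 - z\<^sup>2) = 3 * (of_rat v - t1\<^sup>2) * (t2 - t0)\<^sup>2 * s\<^sup>2 +
    3 * (of_rat v - t0\<^sup>2) * (t2 - t1)\<^sup>2 * t\<^sup>2 -
    2 * (3 * (of_rat v - t0 * t1)) * (t2 - t0) * (t2 - t1) * s * t"
    unfolding x_def z_def by algebra
  then have id2: "3 * (of_rat v * x\<^sup>2 - z\<^sup>2) =
      k * (t1 * (t2 - t0) * (s\<^sup>2 - 2 * s * t) + (- (t0 * (t2 - t1))) * (t\<^sup>2 - 2 * s * t))"
    unfolding r k_def by algebra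
  have "rf_eval (psi v) (M P) = hp (2 * x * z - z\<^sup>2) (of_rat v * x\<^sup>2 - z\<^sup>2)"
    unfolding M_def st(2) mob_hp[OF det st(1)] psi_hp[OF v linear_nonzero[OF det st(1)]]
    unfolding x_def z_def ..
  also have "\<dots> = hp (3 * (2 * x * z - z\<^sup>2)) (3 * (of_rat v * x\<^sup>2 - z\<^sup>2))"
    by (rule hp_scale[symmetric]) simp
  also have "\<dots> = M (rf_eval gfun P)"
    unfolding id1 id2 hp_scale[OF k] M_def st(2) gfun_hp[OF st(1)] mob_hp[OF det gfun_nonzero[OF st(1)]] ..
  finally show ?thesis ..
qed

lemma iterate_rat_poly:
  assumes ok: "rf_ok \<phi>" "rf_deg \<phi> = 2"
  shows "\<exists>X Z. \<forall>w. (poly (cpoly X) w \<noteq> 0 \<or> poly (cpoly Z) w \<noteq> 0) \<and>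
    (rf_eval \<phi> ^^ n) (Some w) = hp (poly (cpoly X) w) (poly (cpoly Z) w)"
proof (induction n)
  case 0
  have "cpoly [:0, 1:] = [:0, 1:]" "cpoly 1 = 1"
    by (simp_all add: cpoly_def map_poly_pCons)
  then show ?case by (intro exI[of _ "[:0, 1:]"] exI[of _ 1]) (simp add: hp_def)
next
  case (Suc n)
  then obtain X Z where XZ: "\<And>w. poly (cpoly X) w \<noteq> 0 \<or> poly (cpoly Z) w \<noteq> 0"
    "\<And>w. (rf_eval \<phi> ^^ n) (Some w) = hp (poly (cpoly X) w) (poly (cpoly Z) w)" by blast
  define F where "F p = [:coeff p 2:] * X\<^sup>2 + [:coeff p 1:] * X * Z + [:coeff p 0:] * Z\<^sup>2" for p
  have "poly (cpoly (F p)) w = qform (cpoly p) (poly (cpoly X) w) (poly (cpoly Z) w)" for p w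
    unfolding F_def power2_eq_square cpoly_add cpoly_mult
    by (simp add: cpoly_def map_poly_pCons qform_def coeff_map_poly power2_eq_square)
  then show ?case
    using rf_eval_hp[OF ok(2) XZ(1)] qform_nonzero[OF ok XZ(1)] XZ(2)
    by (intro exI[of _ "F (fst \<phi>)"] exI[of _ "F (snd \<phi>)"]) simp
qed

text \<open>The fixed points of the iterate are the roots of a rational polynomial, which is not
  zero because \<open>w0\<close> is not among them.\<close>

lemma periodic_algebraic:
  assumes ok: "rf_ok \<phi>" "rf_deg \<phi> = 2" and w0: "(rf_eval \<phi> ^^ n) (Some w0) \<noteq> Some w0"
    and w: "(rf_eval \<phi> ^^ n) (Some w) = Some w"
  shows "algebraic w"
proof -
  obtain X Z where XZ: "\<And>w. poly (cpoly X) w \<noteq> 0 \<or> poly (cpoly Z) w \<noteq> 0"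
    "\<And>w. (rf_eval \<phi> ^^ n) (Some w) = hp (poly (cpoly X) w) (poly (cpoly Z) w)"
    using iterate_rat_poly[OF ok] by blast
  define R where "R = X + [:0, - 1:] * Z"
  have R: "poly (cpoly R) y = 0 \<longleftrightarrow> (rf_eval \<phi> ^^ n) (Some y) = Some y" for y
  proof -
    have "poly (cpoly R) y = poly (cpoly X) y - y * poly (cpoly Z) y"
      unfolding R_def cpoly_add cpoly_mult by (simp add: cpoly_def map_poly_pCons of_rat_minus)
    moreover have "hp y 1 = Some y" by (simp add: hp_def)
    ultimately show ?thesis using hp_eq_iff[OF XZ(1)[of y], of y 1] XZ(2)[of y] by simp
  qed
  have "cpoly R \<noteq> 0" using R[of w0] w0 by auto
  then show ?thesis
    using R[of w] w by (intro algebraicI'[of "cpoly R"]) (auto simp: coeff_cpoly)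
qed

text \<open>The order of \<open>t0\<close>, \<open>t1\<close>, \<open>t2\<close> is part of the
  data, so that a rational root can be given the place of \<open>t1\<close>.\<close>

locale per3_data =
  fixes \<phi> :: ratfun and v A B C D :: rat and t0 t1 t2 g :: complex
  assumes ok: "rf_ok \<phi>" and deg: "rf_deg \<phi> = 2" and v0: "v \<noteq> 0" and v4: "v \<noteq> 4"
    and detQ: "A * D - B * C \<noteq> 0"
    and conjQ: "\<And>P. mob (of_rat A) (of_rat B) (of_rat C) (of_rat D) (rf_eval (psi v) P) =
      rf_eval \<phi> (mob (of_rat A) (of_rat B) (of_rat C) (of_rat D) P)"
    and e1: "t0 + t1 + t2 = 3" and e2: "t0 * t1 + t1 * t2 + t2 * t0 = 0"
    and e3: "t0 * t1 * t2 = - of_rat v"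
    and g_root: "g ^ 3 - 3 * g + 1 = 0"
begin

text \<open>If \<open>x = y\<close>, the first two relations give \<open>x (x - 2) = 0\<close>, and
  the third \<open>v = 0\<close> or \<open>v = 4\<close>.\<close>

lemma t_distinct: "t0 \<noteq> t1" "t1 \<noteq> t2" "t2 \<noteq> t0"
proof -
  have *: "x \<noteq> y" if xyz: "x + y + z = 3" "x * y + y * z + z * x = 0" "x * y * z = - of_rat v" for x y z :: complex
  proof
    assume "x = y"
    with xyz have z: "z = 3 - 2 * x" and x: "x * x + x * z + z * x = 0"
      by (simp_all add: algebra_simps)
    have "3 * (x * (x - 2)) = - (x * x + x * z + z * x)" unfolding z by (simp add: algebra_simps)
    then have "x = 0 \<or> x = 2" unfolding x by auto
    then have "of_rat v = (0::complex) \<or> of_rat v = (4::complex)" using xyz(3) \<open>x = y\<close> z by auto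
    then show False using v0 v4 of_rat_eq_iff[of v 4, where 'a = complex] by auto
  qed
  show "t0 \<noteq> t1" using *[of t0 t1 t2] e1 e2 e3 by simp
  show "t1 \<noteq> t2" using *[of t1 t2 t0] e1 e2 e3 by (simp add: algebra_simps)
  show "t2 \<noteq> t0" using *[of t2 t0 t1] e1 e2 e3 by (simp add: algebra_simps)
qed

text \<open>The substitution \<open>1 - 1/x\<close> has order 3 and permutes the roots of
  \<open>x^3 - 3x + 1\<close>, which makes the Galois group of this cubic cyclic. Indices are read
  modulo 3, so that a shift is plain addition.\<close>

definition gm :: "nat \<Rightarrow> complex" where
  "gm n = (if n mod 3 = 0 then g else if n mod 3 = 1 then (g - 1) / g else 1 / (1 - g))"

lemma g_neq: "g \<noteq> 0" "g \<noteq> 1"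
  using g_root by auto

lemma gm_mod: "gm (n mod 3) = gm n"
  by (simp add: gm_def)

lemma gm_0: "gm 0 = g"
  by (simp add: gm_def)

lemma gm_Suc: "gm (Suc n) = 1 - 1 / gm n"
proof -
  consider "n mod 3 = 0" | "n mod 3 = 1" | "n mod 3 = 2" by linarith
  then show ?thesis
    by cases (use g_neq in \<open>auto simp: gm_def mod_Suc field_simps\<close>)
qed

lemma gm_root: "gm n ^ 3 - 3 * gm n + 1 = 0" and gm_neq: "gm n \<noteq> 0" "gm n \<noteq> 1"
proof -
  show root: "gm n ^ 3 - 3 * gm n + 1 = 0"
  proof (induction n)
    case 0
    then show ?case using g_root by (simp add: gm_0)
  next
    case (Suc n)
    then have nz: "gm n \<noteq> 0" by auto
    have "gm n ^ 3 * (gm (Suc n) ^ 3 - 3 * gm (Suc n) + 1) = - (gm n ^ 3 - 3 * gm n + 1)"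
      unfolding gm_Suc using nz by (simp add: field_simps power3_eq_cube)
    then show ?case using Suc nz by simp
  qed
  then show "gm n \<noteq> 0" "gm n \<noteq> 1" by auto
qed

lemma gm_Suc_neq: "gm (Suc n) \<noteq> gm n"
proof
  assume "gm (Suc n) = gm n"
  then have "gm n * gm n - gm n + 1 = 0" unfolding gm_Suc using gm_neq[of n] by (simp add: field_simps)
  \<comment> \<open>From \<open>x^2 - x + 1 = 0\<close> follows \<open>x^3 = -1\<close>, and the
    cubic becomes \<open>-3x\<close>.\<close>
  then have "3 * gm n = 0" using gm_root[of n] by algebra
  then show False using gm_neq by simp
qed

lemma gm_distinct: "gm 0 \<noteq> gm 1" "gm 1 \<noteq> gm 2" "gm 2 \<noteq> gm 0"
  using gm_Suc_neq[of 0] gm_Suc_neq[of 1] gm_Suc_neq[of 2] gm_mod[of 3]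
  by (simp_all add: numeral_2_eq_2 numeral_3_eq_3)

lemma gm_roots: "a ^ 3 - 3 * a + 1 = 0 \<longleftrightarrow> (\<exists>i<3. a = gm i)"
proof -
  \<comment> \<open>Multiplication by \<open>g * (1 - g)\<close> clears the denominators of
    \<open>gm 1\<close> and \<open>gm 2\<close>; the result vanishes modulo the cubic of
    \<open>g\<close>.\<close>
  have "g * (1 - g) * (a ^ 3 - 3 * a + 1 - (a - gm 0) * (a - gm 1) * (a - gm 2)) =
    (g ^ 3 - 3 * g + 1) * (a\<^sup>2 - a * 0 - a\<^sup>2) + g * (1 - g) * (a ^ 3 - 3 * a + 1) -
    (a - g) * (a * g - (g - 1)) * (a * (1 - g) - 1)"
    using g_neq by (simp add: gm_def field_simps)
  also have "\<dots> = 0" using g_root by algebra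
  finally have "a ^ 3 - 3 * a + 1 = (a - gm 0) * (a - gm 1) * (a - gm 2)" using g_neq by simp
  then have "a ^ 3 - 3 * a + 1 = 0 \<longleftrightarrow> a = gm 0 \<or> a = gm 1 \<or> a = gm 2" by simp
  also have "\<dots> \<longleftrightarrow> (\<exists>i<3. a = gm i)"
    by (auto simp: numeral_3_eq_3 less_Suc_eq numeral_2_eq_2)
  finally show ?thesis .
qed

text \<open>\<open>gfun\<close> commutes with \<open>1/x\<close>, so the reciprocals form the second
  3-cycle. The numbering follows the two cycles of \<open>pi6\<close>.\<close>

definition pt :: "nat \<Rightarrow> complex" where
  "pt i = (if i < 3 then gm i else 1 / gm i)"

lemma gm_inverse_root: "(1 / gm n) ^ 3 - 3 * (1 / gm n)\<^sup>2 + 1 = 0"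
proof -
  have "gm n ^ 3 * ((1 / gm n) ^ 3 - 3 * (1 / gm n)\<^sup>2 + 1) = gm n ^ 3 - 3 * gm n + 1"
    using gm_neq[of n] by (simp add: field_simps power2_eq_square power3_eq_cube)
  then show ?thesis using gm_root[of n] gm_neq[of n] by simp
qed

lemma gm_inverse_neq: "gm m \<noteq> 1 / gm n"
proof
  define x where "x = gm m"
  assume "gm m = 1 / gm n"
  then have "x ^ 3 - 3 * x\<^sup>2 + 1 = 0" using gm_inverse_root[of n] by (simp add: x_def)
  moreover have "x ^ 3 - 3 * x + 1 = 0" using gm_root by (simp add: x_def)
  \<comment> \<open>The two cubics differ by \<open>3x (x - 1)\<close>.\<close>
  ultimately have "3 * (x * (x - 1)) = 0" by algebra
  then show False using gm_neq[of m] by (simp add: x_def)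
qed

lemma all_less_3: "(\<forall>i<3::nat. P i) \<longleftrightarrow> P 0 \<and> P 1 \<and> P 2"
  by (auto simp: numeral_3_eq_3 less_Suc_eq numeral_2_eq_2)

lemma gm_inj: "gm m = gm n \<longleftrightarrow> m mod 3 = n mod 3"
proof
  assume "gm m = gm n"
  then have *: "gm (m mod 3) = gm (n mod 3)" by (simp add: gm_mod)
  have "\<forall>i<3. \<forall>j<3. gm i = gm j \<longrightarrow> i = j"
    using gm_distinct unfolding all_less_3 by auto
  then show "m mod 3 = n mod 3" using * by simp
qed (metis gm_mod)

lemma pt_inj: "inj_on pt {0..<6}"
proof (rule inj_onI)
  fix i j assume ij: "i \<in> {0..<6}" "j \<in> {0..<6}" "pt i = pt j"
  then have "i < 3 \<longleftrightarrow> j < 3"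
    using gm_inverse_neq[of i j] gm_inverse_neq[of j i] by (auto simp: pt_def split: if_splits)
  moreover from this have "gm i = gm j" using ij gm_neq by (auto simp: pt_def split: if_splits)
  then have "i mod 3 = j mod 3" by (simp add: gm_inj)
  ultimately show "i = j"
    using ij by (cases "i < 3") (auto simp: le_mod_geq not_less)
qed

lemma pt_range: "pt ` {0..<6} = {a. a ^ 3 - 3 * a + 1 = 0 \<or> a ^ 3 - 3 * a\<^sup>2 + 1 = 0}"
proof (intro equalityI subsetI)
  fix a assume "a \<in> pt ` {0..<6}"
  then show "a \<in> {a. a ^ 3 - 3 * a + 1 = 0 \<or> a ^ 3 - 3 * a\<^sup>2 + 1 = 0}"
    using gm_root gm_inverse_root by (auto simp: pt_def)
next
  fix a :: complex assume "a \<in> {a. a ^ 3 - 3 * a + 1 = 0 \<or> a ^ 3 - 3 * a\<^sup>2 + 1 = 0}"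
  then consider "a ^ 3 - 3 * a + 1 = 0" | "a ^ 3 - 3 * a\<^sup>2 + 1 = 0" by auto
  then show "a \<in> pt ` {0..<6}"
  proof cases
    case 1
    then obtain i where "i < 3" "a = gm i" using gm_roots by blast
    then show ?thesis by (intro image_eqI[of _ _ i]) (auto simp: pt_def)
  next
    case 2
    then have a: "a \<noteq> 0" by auto
    have "a ^ 3 * ((1 / a) ^ 3 - 3 * (1 / a) + 1) = a ^ 3 - 3 * a\<^sup>2 + 1"
      using a by (simp add: field_simps power2_eq_square power3_eq_cube)
    then have "(1 / a) ^ 3 - 3 * (1 / a) + 1 = 0" using 2 a by simp
    then obtain i where i: "i < 3" "1 / a = gm i" using gm_roots by blast
    then have "a = 1 / gm i" using a by (metis divide_divide_eq_right mult_1 div_by_1)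
    moreover have "gm (i + 3) = gm i" using gm_mod[of "i + 3"] gm_mod[of i] by simp
    ultimately show ?thesis using i by (intro image_eqI[of _ _ "i + 3"]) (auto simp: pt_def)
  qed
qed

text \<open>Modulo \<open>x^3 - 3x + 1\<close> the map \<open>gfun\<close> agrees with
  \<open>1 - 1/x\<close>. The same identity, with numerator and denominator exchanged, serves for
  the reciprocals.\<close>

lemma gfun_gm: "rf_eval gfun (Some (gm n)) = Some (gm (Suc n))"
  and gfun_gm_inverse: "rf_eval gfun (Some (1 / gm n)) = Some (1 / gm (Suc n))"
proof -
  let ?a = "gm n"
  have id: "(?a\<^sup>2 - 2 * ?a) * ?a = (?a - 1) * (1 - 2 * ?a)"
    using gm_root[of n] by algebra
  have S: "gm (Suc n) = (?a - 1) / ?a" using gm_neq[of n] by (simp add: gm_Suc field_simps)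
  have nz: "?a \<noteq> 0 \<or> (1::complex) \<noteq> 0" "(1::complex) \<noteq> 0 \<or> ?a \<noteq> 0" by simp_all
  have ne: "?a - 1 \<noteq> 0 \<or> ?a \<noteq> 0" "?a \<noteq> 0 \<or> ?a - 1 \<noteq> 0" using gm_neq[of n] by auto
  have "rf_eval gfun (hp ?a 1) = hp (?a - 1) ?a"
    unfolding gfun_hp[OF nz(1)]
    using hp_eq_iff[OF gfun_nonzero[OF nz(1)] ne(1)] id by simp
  then show "rf_eval gfun (Some ?a) = Some (gm (Suc n))"
    unfolding S using gm_neq[of n] by (simp add: hp_def)
  have "rf_eval gfun (hp 1 ?a) = hp ?a (?a - 1)"
    unfolding gfun_hp[OF nz(2)]
    using hp_eq_iff[OF gfun_nonzero[OF nz(2)] ne(2)] id by (simp add: mult.commute)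
  then show "rf_eval gfun (Some (1 / ?a)) = Some (1 / gm (Suc n))"
    unfolding S using gm_neq[of n] by (simp add: hp_def)
qed

lemma gfun_pt:
  assumes "i < 6"
  shows "rf_eval gfun (Some (pt i)) = Some (pt (pi6 i))"
proof -
  have "i = 0 \<or> i = 1 \<or> i = 2 \<or> i = 3 \<or> i = 4 \<or> i = 5" using assms by linarith
  moreover have "gm 3 = gm 0" "gm 4 = gm 1" "gm 5 = gm 2" "gm 6 = gm 0" by (simp_all add: gm_def)
  ultimately show ?thesis
    using gfun_gm[of i] gfun_gm_inverse[of i]
    by (elim disjE) (simp_all add: pt_def pi6_def perm_of_list_def numeral_eq_Suc)
qed

text \<open>The map carrying \<open>0, \<infinity>, 1\<close> to the fixed points \<open>1/t0, 1/t1, 1/t2\<close> of \<open>\<psi>\<^sub>v\<close>.\<close>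
definition "m1 = t2 - t0"
definition "m2 = - (t2 - t1)"
definition "m3 = t1 * (t2 - t0)"
definition "m4 = - (t0 * (t2 - t1))"

lemma detM: "m1 * m4 - m2 * m3 \<noteq> 0"
proof -
  have "m1 * m4 - m2 * m3 = (t1 - t0) * (t2 - t0) * (t2 - t1)"
    by (simp add: m1_def m2_def m3_def m4_def algebra_simps)
  then show ?thesis using t_distinct by simp
qed

abbreviation "S \<equiv> mob (of_rat A) (of_rat B) (of_rat C) (of_rat D)"

lemma detS: "of_rat A * of_rat D - of_rat B * of_rat C \<noteq> (0 :: complex)"
  using detQ of_rat_det by blast

definition lab :: "nat \<Rightarrow> p1" where
  "lab i = S (mob m1 m2 m3 m4 (Some (pt i)))"

lemma conj_gfun: "S (mob m1 m2 m3 m4 (rf_eval gfun P)) = rf_eval \<phi> (S (mob m1 m2 m3 m4 P))"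
  using gfun_conj_psi[OF e1 e2 e3 v0, of P] detM conjQ
  by (simp add: m1_def m2_def m3_def m4_def)

lemma SM_inj: "inj (\<lambda>P. S (mob m1 m2 m3 m4 P))"
  by (auto intro!: injI simp: mob_eq_iff[OF detS] mob_eq_iff[OF detM])

lemma SM_surj: "\<exists>Q. P = S (mob m1 m2 m3 m4 Q)"
  using mob_inverse(1)[OF detS, of P] mob_inverse(1)[OF detM] by metis

text \<open>\<open>per3\<close> admits only algebraic points. The third iterate has finitely many
  fixed points, so it moves some rational number, and \<open>periodic_algebraic\<close>
  applies.\<close>

lemma periodic_alg_pt:
  assumes "(rf_eval \<phi> ^^ 3) P = P"
  shows "alg_pt P"
proof -
  let ?T = "\<lambda>P. S (mob m1 m2 m3 m4 P)"
  let ?X = "{P. (rf_eval \<phi> ^^ 3) P = P}"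
  have "?X \<subseteq> ?T ` ({None, Some 0, Some 1} \<union> Some ` pt ` {0..<6})"
  proof
    fix P assume P: "P \<in> ?X"
    obtain Q where Q: "P = ?T Q" using SM_surj by blast
    have "?T ((rf_eval gfun ^^ 3) Q) = ?T Q"
      using P Q funpow_conj[of ?T "rf_eval gfun" "rf_eval \<phi>" 3 Q] conj_gfun by simp
    then have "(rf_eval gfun ^^ 3) Q = Q" using SM_inj by (simp add: inj_def)
    then have "Q \<in> {None, Some 0, Some 1} \<union> Some ` pt ` {0..<6}"
      unfolding gfun_cube_fixed_iff pt_range by auto
    then show "P \<in> ?T ` ({None, Some 0, Some 1} \<union> Some ` pt ` {0..<6})" using Q by blast
  qed
  then have "finite ?X" by (rule finite_subset) simp
  from exists_rat_avoiding_finite[OF this inj_on_id2] obtain w0 where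
    "(rf_eval \<phi> ^^ 3) (Some w0) \<noteq> Some w0" by auto
  then show ?thesis
    unfolding alg_pt_def using periodic_algebraic[OF ok deg] assms by blast
qed

lemma per3_eq: "per3 \<phi> = lab ` {0..<6}"
proof -
  let ?T = "\<lambda>P. S (mob m1 m2 m3 m4 P)"
  have per: "periodic_pt (rf_eval \<phi>) 3 (?T Q) \<longleftrightarrow> Q \<in> Some ` pt ` {0..<6}" for Q
    using periodic_pt_conj[of ?T "rf_eval gfun" "rf_eval \<phi>", OF conj_gfun SM_inj, of 3 Q]
    unfolding gfun_periodic_3_iff pt_range by auto
  show ?thesis
  proof (intro equalityI subsetI)
    fix P assume P: "P \<in> per3 \<phi>"
    obtain Q where Q: "P = ?T Q" using SM_surj by blast
    then have "Q \<in> Some ` pt ` {0..<6}" using P per by (simp add: per3_def)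
    then show "P \<in> lab ` {0..<6}" using Q by (auto simp: lab_def)
  next
    fix P assume "P \<in> lab ` {0..<6}"
    then obtain i where i: "i \<in> {0..<6}" "P = ?T (Some (pt i))" by (auto simp: lab_def)
    then have "periodic_pt (rf_eval \<phi>) 3 P" unfolding i(2) per by blast
    then show "P \<in> per3 \<phi>" using periodic_alg_pt by (simp add: per3_def periodic_pt_3_iff)
  qed
qed

lemma lab_bij: "bij_betw lab {0..<6} (per3 \<phi>)"
  unfolding per3_eq bij_betw_def
  using SM_inj pt_inj by (auto simp: lab_def inj_on_def)

lemma lab_phi: "i < 6 \<Longrightarrow> rf_eval \<phi> (lab i) = lab (pi6 i)"
  using conj_gfun[of "Some (pt i)"] gfun_pt[of i] by (simp add: lab_def)

end

section \<open>The Galois action on the 3-periodic points\<close>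

lemma map_option_mob:
  assumes E: "is_subfield E" and \<tau>: "field_hom E \<tau>" and abcd: "a \<in> E" "b \<in> E" "c \<in> E" "d \<in> E"
    and P: "set_option P \<subseteq> E"
  shows "map_option \<tau> (mob a b c d P) = mob (\<tau> a) (\<tau> b) (\<tau> c) (\<tau> d) (map_option \<tau> P)"
    and "set_option (mob a b c d P) \<subseteq> E"
proof -
  note hom = field_hom_add[OF E \<tau>] field_hom_mult[OF E \<tau>] field_hom_divide[OF E \<tau>]
    field_hom_eq_0_iff[OF E \<tau>]
  note sub = subfield_add[OF E] subfield_mult[OF E] subfield_divide[OF E]
  have "c * z + d = 0 \<longleftrightarrow> \<tau> c * \<tau> z + \<tau> d = 0" if "z \<in> E" for z
    using that abcd hom(4)[of "c * z + d"] by (simp add: hom(1,2) sub)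
  then show "map_option \<tau> (mob a b c d P) = mob (\<tau> a) (\<tau> b) (\<tau> c) (\<tau> d) (map_option \<tau> P)"
    using abcd P by (cases P) (auto simp: mob_def hom sub)
  show "set_option (mob a b c d P) \<subseteq> E"
    using abcd P by (cases P) (auto simp: mob_def sub)
qed

text \<open>The permutation \<open>pi6\<^sup>a \<rho>\<^sup>b s\<^sup>e\<close> of the labels, with \<open>\<rho>\<close> rotating the two cycles in opposite
  directions and \<open>s\<close> exchanging them; \<open>2 * b\<close> stands for \<open>- b\<close> modulo 3.\<close>
definition wel :: "nat \<Rightarrow> nat \<Rightarrow> bool \<Rightarrow> nat \<Rightarrow> nat" where
  "wel a b e i = (if i \<ge> 6 then i
     else if (i < 3) = e then 3 + (i + a + 2 * b) mod 3 else (i + a + b) mod 3)"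

lemma wel_less_6: "i < 6 \<Longrightarrow> wel a b e i < 6"
  unfolding wel_def by (auto simp: less_Suc_eq_le intro: order.strict_trans1[OF _ pos_mod_bound])

text \<open>The six substitutions permuting \<open>0, 1, \<infinity>\<close>: \<open>x \<mapsto> 1 - 1/x\<close> iterated \<open>b\<close> times, after
  \<open>x \<mapsto> 1/x\<close> if \<open>e\<close>.\<close>
definition anharmonic :: "nat \<Rightarrow> bool \<Rightarrow> complex \<Rightarrow> complex" where
  "anharmonic b e x = (if e then if b = 0 then 1 / x else if b = 1 then 1 - x else x / (x - 1)
     else if b = 0 then x else if b = 1 then (x - 1) / x else 1 / (1 - x))"

text \<open>Clearing denominators gives \<open>x\<^sup>3 - 3xy\<^sup>2 + y\<^sup>3 = 0\<close> with \<open>x, y\<close> coprime, but that number is odd.\<close>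
lemma no_rat_root:
  fixes r :: rat
  shows "r ^ 3 - 3 * r + 1 \<noteq> 0"
proof
  assume r: "r ^ 3 - 3 * r + 1 = 0"
  obtain x y where xy: "quotient_of r = (x, y)" by (cases "quotient_of r")
  then have y: "y > 0" and cop: "coprime x y" and rxy: "r = of_int x / of_int y"
    by (simp_all add: quotient_of_denom_pos quotient_of_coprime quotient_of_div)
  have "of_int (x ^ 3 - 3 * x * y\<^sup>2 + y ^ 3) = (of_int y :: rat) ^ 3 * (r ^ 3 - 3 * r + 1)"
    using y unfolding rxy by (simp add: field_simps power2_eq_square power3_eq_cube)
  then have "x ^ 3 - 3 * x * y\<^sup>2 + y ^ 3 = 0" unfolding r by (simp only: mult_zero_right of_int_eq_0_iff)
  moreover have "odd x \<or> odd y" using cop by (metis coprime_common_divisor odd_one)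
  then have "odd (x ^ 3 - 3 * x * y\<^sup>2 + y ^ 3)" by auto
  ultimately show False by simp
qed

context per3_data
begin

definition tt :: "nat \<Rightarrow> complex" where
  "tt n = (if n mod 3 = 0 then t0 else if n mod 3 = 1 then t1 else t2)"

lemma tt_simps: "tt 0 = t0" "tt 1 = t1" "tt (Suc 0) = t1" "tt 2 = t2"
  by (simp_all add: tt_def)

lemma gm_cong: "m mod 3 = n mod 3 \<Longrightarrow> gm m = gm n"
  and tt_cong: "m mod 3 = n mod 3 \<Longrightarrow> tt m = tt n"
  by (simp_all add: gm_def tt_def)

lemma tt_inj: "tt m = tt n \<longleftrightarrow> m mod 3 = n mod 3"
proof
  assume *: "tt m = tt n"
  have "m mod 3 < 3" "n mod 3 < 3" by simp_all
  then show "m mod 3 = n mod 3"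
    using * t_distinct unfolding tt_def by (auto split: if_splits)
qed (rule tt_cong)

definition roots :: "complex set" where
  "roots = {gm 0, gm 1, gm 2, t0, t1, t2}"

text \<open>The first cubic is irreducible, the second need not be. Their product makes
  \<open>E\<close> the splitting field of a single rational polynomial.\<close>

definition minpolys :: "complex poly" where
  "minpolys = [:1, - 3, 0, 1:] * [:of_rat v, 0, - 3, 1:]"

abbreviation "E \<equiv> gen_field roots"

lemma t_roots: "z ^ 3 - 3 * z\<^sup>2 + of_rat v = (z - t0) * (z - t1) * (z - t2)"
proof -
  have "(z - t0) * (z - t1) * (z - t2) =
    z ^ 3 - (t0 + t1 + t2) * z\<^sup>2 + (t0 * t1 + t1 * t2 + t2 * t0) * z - t0 * t1 * t2"
    by (simp add: algebra_simps power2_eq_square power3_eq_cube)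
  then show ?thesis unfolding e1 e2 e3 by simp
qed

lemma roots_eq: "roots = {z. poly minpolys z = 0}"
proof -
  have "poly minpolys z = (z ^ 3 - 3 * z + 1) * (z ^ 3 - 3 * z\<^sup>2 + of_rat v)" for z
    by (simp add: minpolys_def algebra_simps power2_eq_square power3_eq_cube)
  moreover have "(\<exists>i<3. z = gm i) \<longleftrightarrow> z \<in> {gm 0, gm 1, gm 2}" for z
    by (auto simp: numeral_3_eq_3 less_Suc_eq numeral_2_eq_2)
  ultimately show ?thesis unfolding roots_def t_roots by (auto simp: gm_roots)
qed

lemma minpolys: "minpolys \<noteq> 0" "poly_over \<rat> minpolys"
proof -
  show "minpolys \<noteq> 0" by (simp add: minpolys_def)
  note Q = is_subfield_Rats
  show "poly_over \<rat> minpolys"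
    unfolding minpolys_def
    by (intro poly_over_mult[OF Q] poly_over_pCons[OF Q] poly_over_0[OF Q]) auto
qed

lemma E: "is_subfield E"
  by (rule is_subfield_gen_field)

lemma gm_in_E: "gm n \<in> E" and tt_in_E: "tt n \<in> E"
proof -
  have "gm n = gm 0 \<or> gm n = gm 1 \<or> gm n = gm 2" by (auto simp: gm_def)
  then show "gm n \<in> E" using gen_field_superset[of roots] by (auto simp: roots_def)
  show "tt n \<in> E" using gen_field_superset[of roots] by (auto simp: roots_def tt_def)
qed

lemma t_in_E: "t0 \<in> E" "t1 \<in> E" "t2 \<in> E"
  using gen_field_superset[of roots] by (auto simp: roots_def)

lemma m_in_E: "m1 \<in> E" "m2 \<in> E" "m3 \<in> E" "m4 \<in> E"
  unfolding m1_def m2_def m3_def m4_def using t_in_E by (auto intro!: subfield_intros[OF E])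

text \<open>With \<open>e\<close> the indices of the \<open>t\<close> undergo the reflection sending
  \<open>n\<close> to \<open>b + 1 - n\<close>, where \<open>2 * n\<close> stands for
  \<open>- n\<close> modulo 3. The offset 1 makes \<open>b = 0\<close> exchange \<open>t0\<close>
  and \<open>t1\<close>, as \<open>1/x\<close> exchanges 0 and infinity.\<close>

definition acts :: "(complex \<Rightarrow> complex) \<Rightarrow> nat \<Rightarrow> nat \<Rightarrow> bool \<Rightarrow> bool" where
  "acts \<tau> a b e \<longleftrightarrow> (\<forall>n. \<tau> (gm n) = gm (n + a)) \<and>
     (\<forall>n. \<tau> (tt n) = tt (if e then b + 1 + 2 * n else b + n))"

lemma aut_acts:
  assumes "\<tau> \<in> field_auts E"
  shows "\<exists>a<3. \<exists>b<3. \<exists>e. acts \<tau> a b e"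
proof -
  have \<tau>: "field_hom E \<tau>" using assms by (simp add: field_auts_iff[OF E])
  note hom = field_hom_0[OF E \<tau>] field_hom_1[OF E \<tau>] field_hom_add[OF E \<tau>] field_hom_mult[OF E \<tau>]
    field_hom_diff[OF E \<tau>] field_hom_divide[OF E \<tau>] field_hom_power[OF E \<tau>] field_hom_numeral[OF E \<tau>]
  have "\<tau> (gm 0 ^ 3 - 3 * gm 0 + 1) = \<tau> (gm 0) ^ 3 - 3 * \<tau> (gm 0) + 1"
    using gm_in_E[of 0] by (simp add: hom subfield_intros[OF E])
  then have "\<tau> (gm 0) ^ 3 - 3 * \<tau> (gm 0) + 1 = 0" unfolding gm_root by (simp add: hom)
  then obtain a where a: "a < 3" "\<tau> (gm 0) = gm a" unfolding gm_roots by blast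
  \<comment> \<open>\<open>\<tau>\<close> commutes with \<open>1 - 1/x\<close>, so the image of
    \<open>gm 0\<close> determines the shift.\<close>
  have gm: "\<tau> (gm n) = gm (n + a)" for n
  proof (induction n)
    case (Suc n)
    then show ?case using gm_in_E[of n] by (simp add: gm_Suc hom subfield_intros[OF E])
  qed (simp add: a)
  have t_img: "\<tau> z \<in> {t0, t1, t2}" if "z \<in> {t0, t1, t2}" for z
  proof -
    have z: "z \<in> E" "z ^ 3 - 3 * z\<^sup>2 + of_rat v = 0" using that t_in_E t_roots[of z] by auto
    have v: "of_rat v \<in> E" "\<tau> (of_rat v) = of_rat v"
      using subfield_Rats[OF E] field_hom_Rats[OF E \<tau>] by auto
    have "\<tau> (z ^ 3 - 3 * z\<^sup>2 + of_rat v) = \<tau> z ^ 3 - 3 * (\<tau> z)\<^sup>2 + of_rat v"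
      using z(1) v by (simp add: hom subfield_intros[OF E])
    then have "\<tau> z ^ 3 - 3 * (\<tau> z)\<^sup>2 + of_rat v = 0" unfolding z by (simp add: hom)
    then show ?thesis unfolding t_roots by auto
  qed
  have ne: "\<tau> t0 \<noteq> \<tau> t1" "\<tau> t1 \<noteq> \<tau> t2" "\<tau> t2 \<noteq> \<tau> t0"
    using field_hom_inj[OF E \<tau>] t_in_E t_distinct by (auto dest: inj_onD)
  have "\<exists>b<3. \<exists>e. \<tau> t0 = tt (if e then b + 1 else b) \<and> \<tau> t1 = tt (if e then b else b + 1) \<and> \<tau> t2 = tt (b + 2)"
  proof -
    have T: "tt 0 = t0" "tt 1 = t1" "tt 2 = t2" "tt 3 = t0" "tt 4 = t1" by (simp_all add: tt_def)
    have "\<tau> t0 = t0 \<or> \<tau> t0 = t1 \<or> \<tau> t0 = t2" "\<tau> t1 = t0 \<or> \<tau> t1 = t1 \<or> \<tau> t1 = t2"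
      "\<tau> t2 = t0 \<or> \<tau> t2 = t1 \<or> \<tau> t2 = t2" using t_img by auto
    \<comment> \<open>The six permutations of the \<open>t\<close>: three rotations, then three
      reflections.\<close>
    then consider
      "\<tau> t0 = t0" "\<tau> t1 = t1" "\<tau> t2 = t2" | "\<tau> t0 = t1" "\<tau> t1 = t2" "\<tau> t2 = t0" |
      "\<tau> t0 = t2" "\<tau> t1 = t0" "\<tau> t2 = t1" | "\<tau> t0 = t1" "\<tau> t1 = t0" "\<tau> t2 = t2" |
      "\<tau> t0 = t2" "\<tau> t1 = t1" "\<tau> t2 = t0" | "\<tau> t0 = t0" "\<tau> t1 = t2" "\<tau> t2 = t1"
      using ne by metis
    then show ?thesis
    proof cases
      case 1 then show ?thesis by (intro exI[of _ 0] conjI exI[of _ False]) (simp_all add: tt_def)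
    next
      case 2 then show ?thesis by (intro exI[of _ 1] conjI exI[of _ False]) (simp_all add: tt_def)
    next
      case 3 then show ?thesis by (intro exI[of _ 2] conjI exI[of _ False]) (simp_all add: tt_def)
    next
      case 4 then show ?thesis by (intro exI[of _ 0] conjI exI[of _ True]) (simp_all add: tt_def)
    next
      case 5 then show ?thesis by (intro exI[of _ 1] conjI exI[of _ True]) (simp_all add: tt_def)
    next
      case 6 then show ?thesis by (intro exI[of _ 2] conjI exI[of _ True]) (simp_all add: tt_def)
    qed
  qed
  then obtain b e where b: "b < 3" and be: "\<tau> t0 = tt (if e then b + 1 else b)"
    "\<tau> t1 = tt (if e then b else b + 1)" "\<tau> t2 = tt (b + 2)" by blast
  have "\<tau> (tt n) = tt (if e then b + 1 + 2 * n else b + n)" for n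
  proof -
    consider "n mod 3 = 0" | "n mod 3 = 1" | "n mod 3 = 2" by linarith
    then show ?thesis
    proof cases
      case 1
      then have "tt n = t0" by (simp add: tt_def)
      moreover have "(b + 1 + 2 * n) mod 3 = (b + 1) mod 3" "(b + n) mod 3 = b mod 3" using 1 by presburger+
      ultimately show ?thesis using be(1) tt_cong by (metis (full_types))
    next
      case 2
      then have "tt n = t1" by (simp add: tt_def)
      moreover have "(b + 1 + 2 * n) mod 3 = b mod 3" "(b + n) mod 3 = (b + 1) mod 3" using 2 by presburger+
      ultimately show ?thesis using be(2) tt_cong by (metis (full_types))
    next
      case 3
      then have "tt n = t2" by (simp add: tt_def)
      moreover have "(b + 1 + 2 * n) mod 3 = (b + 2) mod 3" "(b + n) mod 3 = (b + 2) mod 3" using 3 by presburger+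
      ultimately show ?thesis using be(3) tt_cong by (metis (full_types))
    qed
  qed
  then show ?thesis using gm a b unfolding acts_def by blast
qed

lemma gm_add_1: "gm (n + 1) = (gm n - 1) / gm n"
  and gm_add_2: "gm (n + 2) = 1 / (1 - gm n)"
proof -
  have nz: "gm n \<noteq> 0" "gm n - 1 \<noteq> 0" "1 - gm n \<noteq> 0" using gm_neq[of n] by auto
  show 1: "gm (n + 1) = (gm n - 1) / gm n" using nz by (simp add: gm_Suc diff_divide_distrib)
  have "gm (n + 2) = 1 - 1 / gm (n + 1)" by (simp add: gm_Suc)
  also have "\<dots> = 1 / (1 - gm n)" unfolding 1 using nz by (simp add: divide_simps)
  finally show "gm (n + 2) = 1 / (1 - gm n)" .
qed

text \<open>\<open>1 - 1/x\<close> advances the roots by one step and their reciprocals by two, that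
  is, backwards by one: it rotates the two cycles in opposite directions, and \<open>1/x\<close>
  exchanges them.\<close>

lemma anharmonic_gm:
  assumes "b < 3"
  shows "anharmonic b e (gm n) = (if e then 1 / gm (n + 2 * b) else gm (n + b))"
    and "anharmonic b e (1 / gm n) = (if e then gm (n + b) else 1 / gm (n + 2 * b))"
proof -
  have 4: "gm (n + 4) = (gm n - 1) / gm n"
    unfolding gm_add_1[of n, symmetric] by (rule gm_cong) presburger
  have b: "b = 0 \<or> b = 1 \<or> b = 2" using assms by linarith
  have nz: "gm n \<noteq> 0" "1 - gm n \<noteq> 0" "gm n - 1 \<noteq> 0" "1 / gm n - 1 \<noteq> 0" using gm_neq[of n] by auto
  have eqs: "gm (Suc n) = (gm n - 1) / gm n" "gm (Suc (Suc n)) = 1 / (1 - gm n)"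
    using gm_add_1[of n] gm_add_2[of n] by simp_all
  show "anharmonic b e (gm n) = (if e then 1 / gm (n + 2 * b) else gm (n + b))"
    using b by (elim disjE) (use nz in \<open>simp_all add: anharmonic_def 4 gm_add_2 eqs divide_simps\<close>)
  show "anharmonic b e (1 / gm n) = (if e then gm (n + b) else 1 / gm (n + 2 * b))"
    using b by (elim disjE) (use nz in \<open>simp_all add: anharmonic_def 4 gm_add_2 eqs divide_simps\<close>)
qed

text \<open>With \<open>\<tau>\<close> applied to its coefficients, the map sends 0, infinity and 1
  to the inverses of \<open>\<tau> t0\<close>, \<open>\<tau> t1\<close> and
  \<open>\<tau> t2\<close>. It is therefore the old map preceded by the substitution that permutes
  0, infinity and 1 as \<open>\<tau>\<close> permutes the \<open>t\<close>.\<close>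

lemma mob_anharmonic:
  assumes "acts \<tau> a b e" "b < 3" "\<tau> \<in> field_auts E" "x \<noteq> 0" "x \<noteq> 1"
  shows "mob (\<tau> m1) (\<tau> m2) (\<tau> m3) (\<tau> m4) (Some x) = mob m1 m2 m3 m4 (Some (anharmonic b e x))"
proof -
  have \<tau>: "field_hom E \<tau>" using assms by (simp add: field_auts_iff[OF E])
  note hom = field_hom_mult[OF E \<tau>] field_hom_diff[OF E \<tau>] field_hom_uminus[OF E \<tau>]
  have m: "\<tau> m1 = \<tau> t2 - \<tau> t0" "\<tau> m2 = - (\<tau> t2 - \<tau> t1)" "\<tau> m3 = \<tau> t1 * (\<tau> t2 - \<tau> t0)"
    "\<tau> m4 = - (\<tau> t0 * (\<tau> t2 - \<tau> t1))"
    unfolding m1_def m2_def m3_def m4_def using t_in_E by (simp_all add: hom subfield_intros[OF E])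
  have det: "\<tau> m1 * \<tau> m4 - \<tau> m2 * \<tau> m3 \<noteq> 0"
    using field_hom_eq_0_iff[OF E \<tau>, of "m1 * m4 - m2 * m3"] detM m_in_E
    by (simp add: hom subfield_intros[OF E])
  have T: "\<tau> (tt n) = tt (if e then b + 1 + 2 * n else b + n)" for n
    using assms(1) by (simp add: acts_def)
  note \<tau>t = T[of 0, unfolded tt_simps] T[of 1, unfolded tt_simps] T[of 2, unfolded tt_simps]
  \<comment> \<open>It suffices to name homogeneous coordinates \<open>p\<close>, \<open>q\<close>
    of the substituted point and the scalar \<open>c\<close> between the two vectors, which is 1 or
    -1 in every case.\<close>
  have fin: ?thesis
    if c: "c \<noteq> 0" and pq: "p \<noteq> 0 \<or> q \<noteq> 0" and hp: "Some (anharmonic b e x) = hp p q"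
      and 1: "(\<tau> t2 - \<tau> t0) * x + - (\<tau> t2 - \<tau> t1) = c * ((t2 - t0) * p + - (t2 - t1) * q)"
      and 2: "\<tau> t1 * (\<tau> t2 - \<tau> t0) * x + - (\<tau> t0 * (\<tau> t2 - \<tau> t1)) =
        c * (t1 * (t2 - t0) * p + - (t0 * (t2 - t1)) * q)"
    for c p q
  proof -
    have 1: "\<tau> m1 * x + \<tau> m2 = c * (m1 * p + m2 * q)"
      unfolding m unfolding m1_def m2_def by (rule 1)
    have 2: "\<tau> m3 * x + \<tau> m4 = c * (m3 * p + m4 * q)"
      unfolding m unfolding m3_def m4_def by (rule 2)
    have "mob (\<tau> m1) (\<tau> m2) (\<tau> m3) (\<tau> m4) (Some x) = hp (\<tau> m1 * x + \<tau> m2) (\<tau> m3 * x + \<tau> m4)"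
      using mob_hp[OF det, of x 1] by (simp add: hp_def)
    also have "\<dots> = mob m1 m2 m3 m4 (Some (anharmonic b e x))"
      unfolding 1 2 hp_scale[OF c] hp mob_hp[OF detM pq] ..
    finally show ?thesis .
  qed
  have x: "x - 1 \<noteq> 0" "1 - x \<noteq> 0" using assms by auto
  have "b = 0 \<or> b = 1 \<or> b = 2" using assms by linarith
  then consider "b = 0" "\<not> e" | "b = 1" "\<not> e" | "b = 2" "\<not> e" | "b = 0" e | "b = 1" e | "b = 2" e by blast
  then show ?thesis
  proof cases
    case 1
    show ?thesis
      by (rule fin[of 1 x 1]) (use 1 \<tau>t in \<open>simp_all add: tt_def hp_def anharmonic_def algebra_simps\<close>)
  next
    case 2
    show ?thesis
      by (rule fin[of "- 1" "x - 1" x])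
        (use 2 \<tau>t x assms(4) in \<open>simp_all add: tt_def hp_def anharmonic_def algebra_simps\<close>)
  next
    case 3
    show ?thesis
      by (rule fin[of "- 1" 1 "1 - x"])
        (use 3 \<tau>t x assms(4) in \<open>simp_all add: tt_def hp_def anharmonic_def algebra_simps\<close>)
  next
    case 4
    show ?thesis
      by (rule fin[of "- 1" 1 x])
        (use 4 \<tau>t x assms(4) in \<open>simp_all add: tt_def hp_def anharmonic_def algebra_simps\<close>)
  next
    case 5
    show ?thesis
      by (rule fin[of 1 "1 - x" 1])
        (use 5 \<tau>t x assms(4) in \<open>simp_all add: tt_def hp_def anharmonic_def algebra_simps\<close>)
  next
    case 6
    show ?thesis
      by (rule fin[of 1 x "x - 1"])
        (use 6 \<tau>t x assms(4) in \<open>simp_all add: tt_def hp_def anharmonic_def algebra_simps\<close>)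
  qed
qed

lemma lab_in_E: "set_option (lab i) \<subseteq> E"
proof -
  have id: "field_hom E (\<lambda>x. x)" by (simp add: field_hom_def)
  have q: "of_rat r \<in> E" for r using subfield_Rats[OF E] by simp
  have "pt i \<in> E" using gm_in_E[of i] subfield_1[OF E] by (auto simp: pt_def intro: subfield_divide[OF E])
  then show ?thesis unfolding lab_def by (intro map_option_mob(2)[OF E id] q m_in_E) auto
qed

text \<open>\<open>\<tau>\<close> fixes the rational map \<open>S\<close>, shifts
  \<open>pt i\<close> by \<open>a\<close> within its cycle, and changes the map with coefficients
  \<open>m1\<close> to \<open>m4\<close> by the substitution of \<open>b\<close> and
  \<open>e\<close>; these effects compose to \<open>wel\<close>.\<close>

lemma acts_lab:
  assumes \<tau>: "\<tau> \<in> field_auts E" and acts: "acts \<tau> a b e" "b < 3" and i: "i < 6"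
  shows "map_option \<tau> (lab i) = lab (wel a b e i)"
proof -
  have hom: "field_hom E \<tau>" using \<tau> by (simp add: field_auts_iff[OF E])
  have q: "of_rat r \<in> E" "\<tau> (of_rat r) = of_rat r" for r
    using subfield_Rats[OF E] field_hom_Rats[OF E hom] by auto
  have pt: "pt i \<in> E" using gm_in_E[of i] subfield_1[OF E] by (auto simp: pt_def intro: subfield_divide[OF E])
  have "map_option \<tau> (lab i) = S (mob (\<tau> m1) (\<tau> m2) (\<tau> m3) (\<tau> m4) (Some (\<tau> (pt i))))"
    unfolding lab_def
    using map_option_mob[OF E hom m_in_E, of "Some (pt i)"] pt
      map_option_mob(1)[OF E hom q(1) q(1) q(1) q(1), of "mob m1 m2 m3 m4 (Some (pt i))" A B C D]
    by (simp add: q)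
  moreover have \<tau>pt: "\<tau> (pt i) = (if i < 3 then gm (i + a) else 1 / gm (i + a))"
    using acts gm_in_E[of i] subfield_1[OF E]
    by (auto simp: pt_def acts_def field_hom_divide[OF E hom] field_hom_1[OF E hom])
  moreover have "\<tau> (pt i) \<noteq> 0" "\<tau> (pt i) \<noteq> 1" unfolding \<tau>pt using gm_neq[of "i + a"] by auto
  moreover have "anharmonic b e (\<tau> (pt i)) = pt (wel a b e i)"
  proof -
    have 3: "gm (3 + n mod 3) = gm n" "gm (n mod 3) = gm n" for n by (rule gm_cong, simp)+
    have "\<not> 3 + n mod 3 < (3::nat)" "n mod 3 < (3::nat)" for n by simp_all
    then show ?thesis
      using i unfolding \<tau>pt by (simp add: anharmonic_gm[OF acts(2)] wel_def pt_def 3)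
  qed
  ultimately show ?thesis
    using mob_anharmonic[OF acts \<tau>] by (simp add: lab_def)
qed

text \<open>The Galois group of \<open>E\<close> in coordinates of \<open>C3 x S3\<close>, as
  triples with normalised residues.\<close>

definition G :: "(nat \<times> nat \<times> bool) set" where
  "G = {(a, b, e). a < 3 \<and> b < 3 \<and> (\<exists>\<tau>\<in>field_auts E. acts \<tau> a b e)}"

text \<open>\<open>G3_is\<close> allows any labelling compatible with \<open>pi6\<close>, and
  \<open>w\<close> changes the labelling: by the identity in general, by the exchange of the cycles
  for \<open>GK'\<close>. Extension from \<open>Q3\<close> to \<open>E\<close> and restriction from
  \<open>E\<close> to \<open>Q3\<close> show that both fields induce the same permutations.\<close>

lemma G3_is_conj:
  assumes w: "\<And>i. i < 6 \<Longrightarrow> w i < 6" "\<And>i. i < 6 \<Longrightarrow> w (w i) = i" "\<And>i. i < 6 \<Longrightarrow> w (pi6 i) = pi6 (w i)"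
  shows "G3_is \<phi> ((\<lambda>(a, b, e) i. if i < 6 then w (wel a b e (w i)) else i) ` G)" (is "G3_is \<phi> (?h ` G)")
proof -
  let ?K = "Q3 \<phi>" and ?l = "\<lambda>i. lab (w i)"
  define Z where "Z = {z. Some z \<in> per3 \<phi>}"
  have K: "?K = gen_field Z" by (simp add: Q3_def Z_def)
  have subK: "is_subfield ?K" unfolding K by (rule is_subfield_gen_field)
  have ZE: "Z \<subseteq> E" using lab_in_E unfolding Z_def per3_eq by (fastforce simp: image_iff)
  then have KE: "?K \<subseteq> E" unfolding K by (rule gen_field_minimal[OF E])
  have labK: "set_option (lab i) \<subseteq> ?K" if "i < 6" for i
  proof
    fix z assume "z \<in> set_option (lab i)"
    then have "Some z = lab i" by (cases "lab i") auto
    then have "z \<in> Z" using that unfolding Z_def per3_eq by auto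
    then show "z \<in> ?K" unfolding K using gen_field_superset by blast
  qed
  have w_bij: "bij_betw w {0..<6} {0..<6}"
    by (rule bij_betw_byWitness[of _ w]) (use w in auto)
  have l_bij: "bij_betw ?l {0..<6} (per3 \<phi>)"
    using bij_betw_trans[OF w_bij lab_bij] by (simp add: comp_def)
  have perm: "(\<lambda>i. if i < 6 then the_inv_into {0..<6} ?l (map_option \<tau> (?l i)) else i) =
    (\<lambda>i. if i < 6 then w (wel a b e (w i)) else i)"
    if \<tau>: "\<And>i. i < 6 \<Longrightarrow> map_option \<tau> (lab i) = lab (wel a b e i)" for \<tau> a b e
  proof
    fix i
    have "the_inv_into {0..<6} ?l (map_option \<tau> (?l i)) = w (wel a b e (w i))" if i: "i < 6"
    proof (rule the_inv_into_f_eq)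
      show "inj_on ?l {0..<6}" using l_bij by (rule bij_betw_imp_inj_on)
      have less: "wel a b e (w i) < 6" using wel_less_6 w(1) i by blast
      then show "?l (w (wel a b e (w i))) = map_option \<tau> (?l i)" using \<tau>[OF w(1)[OF i]] w(2) by simp
      show "w (wel a b e (w i)) \<in> {0..<6}" using w(1) less by simp
    qed
    then show "(if i < 6 then the_inv_into {0..<6} ?l (map_option \<tau> (?l i)) else i) =
      (if i < 6 then w (wel a b e (w i)) else i)" by simp
  qed
  have "(\<lambda>\<sigma> i. if i < 6 then the_inv_into {0..<6} ?l (map_option \<sigma> (?l i)) else i) ` field_auts ?K = ?h ` G"
    (is "?f ` _ = _")
  proof (intro equalityI subsetI)
    fix h assume "h \<in> ?f ` field_auts ?K"
    then obtain \<sigma> where \<sigma>: "\<sigma> \<in> field_auts ?K" "h = ?f \<sigma>" by blast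
    obtain \<tau> where \<tau>: "\<tau> \<in> field_auts E" "\<forall>x\<in>?K. \<tau> x = \<sigma> x"
      using splitting_field_aut_extend[OF minpolys roots_eq subK KE \<sigma>(1)] by blast
    obtain a b e where abe: "a < 3" "b < 3" "acts \<tau> a b e" using aut_acts[OF \<tau>(1)] by blast
    have "map_option \<sigma> (lab i) = lab (wel a b e i)" if "i < 6" for i
    proof -
      have "map_option \<sigma> (lab i) = map_option \<tau> (lab i)"
        using labK[OF that] \<tau>(2) by (intro option.map_cong) auto
      then show ?thesis using acts_lab[OF \<tau>(1) abe(3,2) that] by simp
    qed
    then have "h = ?h (a, b, e)" unfolding \<sigma>(2) using perm by simp
    moreover have "(a, b, e) \<in> G" using abe \<tau> by (auto simp: G_def)
    ultimately show "h \<in> ?h ` G" by blast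
  next
    fix h assume "h \<in> ?h ` G"
    then obtain a b e \<tau> where \<tau>: "\<tau> \<in> field_auts E" "acts \<tau> a b e" "b < 3" "h = ?h (a, b, e)"
      by (auto simp: G_def)
    have hom: "field_hom E \<tau>" using \<tau> by (simp add: field_auts_iff[OF E])
    have "\<tau> ` Z \<subseteq> Z"
    proof
      fix y assume "y \<in> \<tau> ` Z"
      then obtain z i where z: "y = \<tau> z" "i < 6" "Some z = lab i" unfolding Z_def per3_eq by auto
      then have "Some y = lab (wel a b e i)" using acts_lab[OF \<tau>(1-3) z(2)] by (metis option.simps(9))
      then show "y \<in> Z" using wel_less_6[OF z(2)] unfolding Z_def per3_eq by auto
    qed
    moreover have "finite Z"
    proof -
      have "finite (Some ` Z)" by (rule finite_subset[of _ "per3 \<phi>"]) (auto simp: Z_def per3_eq)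
      then show ?thesis by (simp add: finite_image_iff)
    qed
    moreover have "inj_on \<tau> Z" using field_hom_inj[OF E hom] ZE inj_on_subset by blast
    ultimately have "\<tau> ` Z = Z" by (intro endo_inj_surj)
    then have "\<tau> \<in> field_auts ?K" unfolding K by (rule field_auts_gen_field[OF E hom ZE])
    moreover have "?f \<tau> = h" unfolding \<tau>(4) using perm acts_lab[OF \<tau>(1-3)] by simp
    ultimately show "h \<in> ?f ` field_auts ?K" by blast
  qed
  moreover have "\<forall>i<6. rf_eval \<phi> (?l i) = ?l (pi6 i)" using lab_phi w by simp
  ultimately show ?thesis unfolding G3_is_def using l_bij by (intro exI[of _ ?l]) blast
qed

lemma G3_is_G: "G3_is \<phi> ((\<lambda>(a, b, e). wel a b e) ` G)"
proof -
  have "(\<lambda>(a, b, e) i. if i < 6 then wel a b e i else i) = (\<lambda>(a, b, e). wel a b e)"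
    by (auto simp: fun_eq_iff wel_def)
  then show ?thesis using G3_is_conj[of "\<lambda>i. i"] by simp
qed

text \<open>The product of \<open>C3 x S3\<close>: a reflection negates the rotation of the factor
  after it, and \<open>2 * b'\<close> is that negative modulo 3.\<close>

lemma G_mult:
  assumes "(a, b, e) \<in> G" "(a', b', e') \<in> G"
  shows "((a + a') mod 3, (b + (if e then 2 * b' else b')) mod 3, e \<noteq> e') \<in> G"
proof -
  obtain \<tau> \<tau>' where \<tau>: "\<tau> \<in> field_auts E" "acts \<tau> a b e" and \<tau>': "\<tau>' \<in> field_auts E" "acts \<tau>' a' b' e'"
    using assms by (auto simp: G_def)
  let ?b = "(b + (if e then 2 * b' else b')) mod 3"
  have "\<tau> \<circ> \<tau>' \<in> field_auts E"
  proof -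
    have hom: "field_hom E \<tau>" "field_hom E \<tau>'" and img: "\<tau> ` E = E" "\<tau>' ` E = E"
      using \<tau>(1) \<tau>'(1) by (simp_all add: field_auts_iff[OF E])
    have "\<tau>' x \<in> E" if "x \<in> E" for x using img(2) that by blast
    then have "field_hom E (\<tau> \<circ> \<tau>')"
      using hom unfolding field_hom_def comp_def by presburger
    moreover have "(\<tau> \<circ> \<tau>') ` E = E" using img by (metis image_comp)
    ultimately show ?thesis by (simp add: field_auts_iff[OF E])
  qed
  moreover have "acts (\<tau> \<circ> \<tau>') ((a + a') mod 3) ?b (e \<noteq> e')"
    unfolding acts_def
  proof (intro conjI allI)
    fix n
    show "(\<tau> \<circ> \<tau>') (gm n) = gm (n + (a + a') mod 3)"
      using \<tau>(2) \<tau>'(2) by (auto simp: acts_def mod_simps intro!: gm_cong) presburger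
    have "(\<tau> \<circ> \<tau>') (tt n) = tt (if e then b + 1 + 2 * (if e' then b' + 1 + 2 * n else b' + n)
      else b + (if e' then b' + 1 + 2 * n else b' + n))"
      using \<tau>(2) \<tau>'(2) by (simp add: acts_def)
    also have "\<dots> = tt (if e \<noteq> e' then ?b + 1 + 2 * n else ?b + n)"
    proof (rule tt_cong)
      have left: "(x mod 3 + y) mod 3 = (x + y) mod 3" "(x mod 3 + 1 + y) mod 3 = (x + 1 + y) mod 3"
        for x y :: nat
        by (rule mod_add_left_eq, unfold add.assoc, rule mod_add_left_eq)
      have "(b + 1 + 2 * (b' + 1 + 2 * n)) mod 3 = (b + 2 * b' + n) mod 3"
        "(b + 1 + 2 * (b' + n)) mod 3 = (b + 2 * b' + 1 + 2 * n) mod 3" by presburger+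
      then show "(if e then b + 1 + 2 * (if e' then b' + 1 + 2 * n else b' + n)
          else b + (if e' then b' + 1 + 2 * n else b' + n)) mod 3 =
        (if e \<noteq> e' then ?b + 1 + 2 * n else ?b + n) mod 3"
        by (cases e; cases e') (simp_all only: left if_True if_False simp_thms, simp_all add: add.assoc)
    qed
    finally show "(\<tau> \<circ> \<tau>') (tt n) = tt (if e \<noteq> e' then ?b + 1 + 2 * n else ?b + n)" .
  qed
  ultimately show ?thesis unfolding G_def by auto
qed

lemma gm_0_irrational: "gm 0 \<notin> \<rat>"
proof
  assume "gm 0 \<in> \<rat>"
  then obtain r :: rat where r: "gm 0 = of_rat r" by (auto elim: Rats_cases)
  have "of_rat (r ^ 3 - 3 * r + 1) = (0 :: complex)"
    using gm_root[of 0] unfolding r by (simp add: of_rat_add of_rat_diff of_rat_mult of_rat_power)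
  then have "r ^ 3 - 3 * r + 1 = 0" by (simp only: of_rat_eq_0_iff)
  then show False using no_rat_root by blast
qed

end

section \<open>Subgroups of W\<close>

lemma less_3_cases: "(n::nat) < 3 \<Longrightarrow> n = 0 \<or> n = 1 \<or> n = 2"
  by linarith

lemma less_6_cases: "(n::nat) < 6 \<Longrightarrow> n = 0 \<or> n = 1 \<or> n = 2 \<or> n = 3 \<or> n = 4 \<or> n = 5"
  by linarith

lemma perm_of_list_eqI:
  assumes "length xs = 6" "\<And>i. i \<ge> 6 \<Longrightarrow> f i = i"
    "f 0 = xs ! 0" "f 1 = xs ! 1" "f 2 = xs ! 2" "f 3 = xs ! 3" "f 4 = xs ! 4" "f 5 = xs ! 5"
  shows "f = perm_of_list xs"
proof
  fix i
  show "f i = perm_of_list xs i"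
  proof (cases "i < 6")
    case True
    then show ?thesis
      using less_6_cases[OF True] assms by (elim disjE) (simp_all add: perm_of_list_def)
  next
    case False
    then show ?thesis using assms by (simp add: perm_of_list_def)
  qed
qed

lemma wel_eq_perm_of_list:
  "wel a b e = perm_of_list (if e
     then [3 + (a + 2 * b) mod 3, 3 + (1 + a + 2 * b) mod 3, 3 + (2 + a + 2 * b) mod 3,
       (a + b) mod 3, (1 + a + b) mod 3, (2 + a + b) mod 3]
     else [(a + b) mod 3, (1 + a + b) mod 3, (2 + a + b) mod 3,
       3 + (a + 2 * b) mod 3, 3 + (1 + a + 2 * b) mod 3, 3 + (2 + a + 2 * b) mod 3])"
proof (rule perm_of_list_eqI)
  have "(3 + n) mod 3 = n mod 3" "(4 + n) mod 3 = (1 + n) mod 3" "(5 + n) mod 3 = (2 + n) mod 3" for n :: nat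
    by presburger+
  note m = this[of "a + b"] this[of "a + 2 * b"]
  show "wel a b e 3 = (if e
     then [3 + (a + 2 * b) mod 3, 3 + (1 + a + 2 * b) mod 3, 3 + (2 + a + 2 * b) mod 3,
       (a + b) mod 3, (1 + a + b) mod 3, (2 + a + b) mod 3]
     else [(a + b) mod 3, (1 + a + b) mod 3, (2 + a + b) mod 3,
       3 + (a + 2 * b) mod 3, 3 + (1 + a + 2 * b) mod 3, 3 + (2 + a + 2 * b) mod 3]) ! 3"
    using m by (simp add: wel_def add.assoc)
  show "wel a b e 4 = (if e
     then [3 + (a + 2 * b) mod 3, 3 + (1 + a + 2 * b) mod 3, 3 + (2 + a + 2 * b) mod 3,
       (a + b) mod 3, (1 + a + b) mod 3, (2 + a + b) mod 3]
     else [(a + b) mod 3, (1 + a + b) mod 3, (2 + a + b) mod 3,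
       3 + (a + 2 * b) mod 3, 3 + (1 + a + 2 * b) mod 3, 3 + (2 + a + 2 * b) mod 3]) ! 4"
    using m by (simp add: wel_def add.assoc)
  show "wel a b e 5 = (if e
     then [3 + (a + 2 * b) mod 3, 3 + (1 + a + 2 * b) mod 3, 3 + (2 + a + 2 * b) mod 3,
       (a + b) mod 3, (1 + a + b) mod 3, (2 + a + b) mod 3]
     else [(a + b) mod 3, (1 + a + b) mod 3, (2 + a + b) mod 3,
       3 + (a + 2 * b) mod 3, 3 + (1 + a + 2 * b) mod 3, 3 + (2 + a + 2 * b) mod 3]) ! 5"
    using m by (simp add: wel_def add.assoc)
qed (simp_all add: wel_def)

section \<open>The named subgroups in terms of triples\<close>

abbreviation wel3 :: "nat \<times> nat \<times> bool \<Rightarrow> nat \<Rightarrow> nat" where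
  "wel3 \<equiv> \<lambda>(a, b, e). wel a b e"

definition GW :: "(nat \<times> nat \<times> bool) set" where "GW = {(a, b, e). a < 3 \<and> b < 3}"
definition GA :: "(nat \<times> nat \<times> bool) set" where "GA = {(a, b, e). a < 3 \<and> b < 3 \<and> \<not> e}"
text \<open>The stabiliser of \<open>t1\<close>: the reflection with \<open>b = 1\<close> fixes the
  index 1.\<close>

definition GB :: "(nat \<times> nat \<times> bool) set" where
  "GB = {(0, 0, False), (1, 0, False), (2, 0, False), (0, 1, True), (1, 1, True), (2, 1, True)}"
definition GM :: "(nat \<times> nat \<times> bool) set" where
  "GM = {(0, 0, False), (1, 0, False), (2, 0, False)}"
text \<open>Here \<open>a + 2 * b\<close> vanishes modulo 3, so the labels 3, 4, 5 are fixed; in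
  \<open>GK'\<close> it is \<open>a + b\<close> that vanishes, and 0, 1, 2 are fixed.\<close>

definition GK :: "(nat \<times> nat \<times> bool) set" where
  "GK = {(0, 0, False), (1, 1, False), (2, 2, False)}"
definition GK' :: "(nat \<times> nat \<times> bool) set" where
  "GK' = {(0, 0, False), (1, 2, False), (2, 1, False)}"

lemma wel_GM: "wel3 ` GM = M6"
  by (simp add: GM_def M6_def wel_eq_perm_of_list insert_commute flip: numeral_2_eq_2)

lemma wel_GK: "wel3 ` GK = K6"
  by (simp add: GK_def K6_def wel_eq_perm_of_list insert_commute flip: numeral_2_eq_2)

lemma wel_GB: "wel3 ` GB = B6"
  by (simp add: GB_def B6_def wel_eq_perm_of_list insert_commute flip: numeral_2_eq_2)

lemma wel_GA: "wel3 ` GA = A6"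
proof (intro equalityI subsetI)
  fix f assume "f \<in> wel3 ` GA"
  then obtain a b where ab: "a < 3" "b < 3" "f = wel a b False" by (auto simp: GA_def)
  let ?i = "(a + b) mod 3" and ?j = "(a + 2 * b) mod 3"
  have "f = perm_of_list [?i, (?i + 1) mod 3, (?i + 2) mod 3, 3 + ?j, 3 + (?j + 1) mod 3, 3 + (?j + 2) mod 3]"
    unfolding ab(3) wel_eq_perm_of_list by (simp add: mod_simps add.commute add.assoc)
  then show "f \<in> A6" unfolding A6_def by (intro CollectI exI[of _ ?i] exI[of _ ?j]) simp
next
  fix f assume "f \<in> A6"
  then obtain i j where ij: "i < 3" "j < 3"
    "f = perm_of_list [i, (i+1) mod 3, (i+2) mod 3, 3 + j, 3 + (j+1) mod 3, 3 + (j+2) mod 3]"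
    by (auto simp: A6_def)
  \<comment> \<open>The solution of \<open>a + b = i\<close> and \<open>a + 2b = j\<close> modulo
    3.\<close>
  have "f = wel ((2 * i + 2 * j) mod 3) ((2 * i + j) mod 3) False"
    unfolding ij(3) wel_eq_perm_of_list using less_3_cases[OF ij(1)] less_3_cases[OF ij(2)]
    by (elim disjE) (simp_all flip: numeral_2_eq_2)
  moreover have "((2 * i + 2 * j) mod 3, (2 * i + j) mod 3, False) \<in> GA" by (simp add: GA_def)
  ultimately show "f \<in> wel3 ` GA"
    by (intro image_eqI[of _ _ "((2 * i + 2 * j) mod 3, (2 * i + j) mod 3, False)"]) (simp_all only: case_prod_conv)
qed

lemma pi6_simps: "pi6 0 = 1" "pi6 1 = 2" "pi6 2 = 0" "pi6 3 = 4" "pi6 4 = 5" "pi6 5 = 3" "pi6 (Suc 0) = 2" "pi6 (Suc (Suc 0)) = 0"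
  by (simp_all add: pi6_def perm_of_list_def)

lemma pi6_ge: "i \<ge> 6 \<Longrightarrow> pi6 i = i"
  by (simp add: pi6_def perm_of_list_def)

text \<open>A permutation commuting with \<open>pi6\<close> is determined by its values at 0 and 3,
  and injectivity puts these into different cycles.\<close>

lemma wel_GW: "wel3 ` GW = W6"
proof (intro equalityI subsetI)
  fix f assume "f \<in> wel3 ` GW"
  then obtain a b e where abe: "a < 3" "b < 3" "f = wel a b e" by (auto simp: GW_def)
  have vals: "f (pi6 i) = pi6 (f i)" if "i < 6" for i
  proof -
    have "\<forall>a\<in>{0,1,2}. \<forall>b\<in>{0,1,2}. \<forall>i\<in>{0,1,2,3,4,5}. wel a b e (pi6 i) = pi6 (wel a b e i)"
      by (cases e) (simp_all add: pi6_simps wel_def)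
    then show ?thesis
      unfolding abe(3) using less_3_cases[OF abe(1)] less_3_cases[OF abe(2)] less_6_cases[OF that] by blast
  qed
  have inj: "inj_on f {0..<6}"
  proof -
    have "\<forall>a\<in>{0,1,2}. \<forall>b\<in>{0,1,2}. inj_on (wel a b e) {0,1,2,3,4,5}"
      by (cases e) (simp_all add: wel_def)
    moreover have "{0..<6::nat} = {0, 1, 2, 3, 4, 5}" by auto
    ultimately show ?thesis
      unfolding abe(3) using less_3_cases[OF abe(1)] less_3_cases[OF abe(2)] by auto
  qed
  have ge: "f i = i" if "i \<ge> 6" for i using that by (simp add: abe wel_def)
  have "f ` {0..<6} \<subseteq> {0..<6}" using wel_less_6 by (auto simp: abe)
  then have "bij_betw f {0..<6} {0..<6}"
    using inj by (simp add: bij_betw_def endo_inj_surj)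
  moreover have "f \<circ> pi6 = pi6 \<circ> f"
  proof
    fix i
    show "(f \<circ> pi6) i = (pi6 \<circ> f) i"
      using vals[of i] ge[of i] pi6_ge[of i] by (cases "i < 6") auto
  qed
  ultimately show "f \<in> W6" using ge by (simp add: W6_def)
next
  fix f assume "f \<in> W6"
  then have bij: "bij_betw f {0..<6} {0..<6}" and ge: "\<And>i. i \<ge> 6 \<Longrightarrow> f i = i"
    and comm: "f \<circ> pi6 = pi6 \<circ> f" by (auto simp: W6_def)
  have c: "f (pi6 i) = pi6 (f i)" for i using fun_cong[OF comm, of i] by simp
  have f: "f 1 = pi6 (f 0)" "f 2 = pi6 (pi6 (f 0))" "f 4 = pi6 (f 3)" "f 5 = pi6 (pi6 (f 3))"
    using c[of 0] c[of 1] c[of 3] c[of 4] by (simp_all add: pi6_simps)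
  have x: "f 0 < 6" and y: "f 3 < 6" using bij_betwE[OF bij] by auto
  have ne: "f 3 \<noteq> f 0" "f 3 \<noteq> f 1" "f 3 \<noteq> f 2"
    using bij_betw_imp_inj_on[OF bij] by (auto dest: inj_onD)
  have fin: "f \<in> wel3 ` GW" if ab: "a < 3" "b < 3" and eq: "wel a b e 0 = f 0" "wel a b e 1 = f 1" "wel a b e 2 = f 2"
    "wel a b e 3 = f 3" "wel a b e 4 = f 4" "wel a b e 5 = f 5" for a b e
  proof -
    have "f i = wel a b e i" for i
    proof (cases "i < 6")
      case True
      then show ?thesis using less_6_cases[OF True] eq by (elim disjE) simp_all
    qed (use ge in \<open>simp add: wel_def\<close>)
    then have "f = wel a b e" by blast
    then show ?thesis using ab unfolding GW_def by (intro image_eqI[of _ _ "(a, b, e)"]) simp_all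
  qed
  have "f 0 < 3 \<or> 3 \<le> f 0" "f 3 < 3 \<or> 3 \<le> f 3" by auto
  then consider "f 0 < 3" "f 3 \<ge> 3" | "f 0 \<ge> 3" "f 3 < 3"
    using ne f x y less_6_cases[OF x] less_6_cases[OF y] by (auto simp: pi6_simps)
  then show "f \<in> wel3 ` GW"
  proof cases
    case 1
    then have "f 0 = 0 \<or> f 0 = 1 \<or> f 0 = 2" "f 3 = 3 \<or> f 3 = 4 \<or> f 3 = 5" using y by linarith+
    then show ?thesis
      \<comment> \<open>As for \<open>GA\<close>, the values prescribe \<open>a + b\<close> and
        \<open>a + 2b\<close> modulo 3.\<close>
      by (intro fin[of "(2 * f 0 + 2 * f 3) mod 3" "(2 * f 0 + f 3) mod 3" False])
        (auto simp: f f[unfolded One_nat_def] pi6_simps wel_def)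
  next
    case 2
    then have "f 3 = 0 \<or> f 3 = 1 \<or> f 3 = 2" "f 0 = 3 \<or> f 0 = 4 \<or> f 0 = 5" using x by linarith+
    then show ?thesis
      by (intro fin[of "(2 * f 3 + 2 * f 0) mod 3" "(2 * f 3 + f 0) mod 3" True])
        (auto simp: f f[unfolded One_nat_def] pi6_simps wel_def)
  qed
qed

definition swap6 :: "nat \<Rightarrow> nat" where
  "swap6 i = (if i < 3 then i + 3 else i - 3)"

text \<open>Conjugation with the exchange of the cycles negates \<open>b\<close>.\<close>

lemma wel_GK'_conj: "(\<lambda>(a, b, e) i. if i < 6 then swap6 (wel a b e (swap6 i)) else i) ` GK' = K6"
proof -
  have eq: "(\<lambda>i. if i < 6 then swap6 (wel a b False (swap6 i)) else i) = wel a c False"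
    if "\<forall>i\<in>{0,1,2,3,4,5}. swap6 (wel a b False (swap6 i)) = wel a c False i" for a b c
  proof
    fix i
    show "(if i < 6 then swap6 (wel a b False (swap6 i)) else i) = wel a c False i"
    proof (cases "i < 6")
      case True
      then show ?thesis using that less_6_cases[OF True] by auto
    qed (simp add: wel_def)
  qed
  have "(\<lambda>i. if i < 6 then swap6 (wel 0 0 False (swap6 i)) else i) = wel 0 0 False"
    "(\<lambda>i. if i < 6 then swap6 (wel 1 2 False (swap6 i)) else i) = wel 1 1 False"
    "(\<lambda>i. if i < 6 then swap6 (wel 2 1 False (swap6 i)) else i) = wel 2 2 False"
    by (rule eq, simp add: swap6_def wel_def)+
  then show ?thesis
    unfolding wel_GK[symmetric] GK_def GK'_def by (simp only: image_insert image_empty case_prod_conv)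
qed

text \<open>Being finite and nonempty, a subset of \<open>C3 x S3\<close> closed under products is a
  subgroup. The last assumption says that its projection to \<open>C3\<close> is not trivial, which
  keeps out \<open>C6\<close> and its subgroups, \<open>J6\<close> among them.\<close>

locale label_group =
  fixes G :: "(nat \<times> nat \<times> bool) set"
  assumes less: "(a, b, e) \<in> G \<Longrightarrow> a < 3 \<and> b < 3"
    and mult: "(a, b, e) \<in> G \<Longrightarrow> (a', b', e') \<in> G \<Longrightarrow>
      ((a + a') mod 3, (b + (if e then 2 * b' else b')) mod 3, e \<noteq> e') \<in> G"
    and nontrivial: "\<exists>a b e. (a, b, e) \<in> G \<and> a \<noteq> 0"
begin

lemma double:
  assumes "(a, b, False) \<in> G"
  shows "((2 * a) mod 3, (2 * b) mod 3, False) \<in> G"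
  using mult[OF assms assms] by (simp add: mult_2)

text \<open>The cube of the triple: the part in \<open>C3\<close> vanishes, and the reflection, an
  involution, returns to itself.\<close>

lemma odd_cube:
  assumes "(a, b, True) \<in> G"
  shows "(0, b, True) \<in> G"
proof -
  have 2: "((2 * a) mod 3, 0, False) \<in> G"
  proof -
    have "(b + 2 * b) mod 3 = 0" by simp
    then show ?thesis using mult[OF assms assms] by (simp add: mult_2)
  qed
  have "(a + (2 * a) mod 3) mod 3 = 0" by (simp add: mod_simps)
  then show ?thesis using mult[OF assms 2] less[OF assms] by simp
qed

text \<open>Cubing removes the \<open>C3\<close>-parts of \<open>y\<close> and of its product with
  \<open>x\<close>; the two reflections obtained generate \<open>S3\<close>. An element with
  \<open>a \<noteq> 0\<close>, freed of its \<open>S3\<close>-part, then contributes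
  \<open>C3\<close>.\<close>

lemma eq_GW:
  assumes x: "(a1, b1, False) \<in> G" "b1 \<noteq> 0" and y: "(a2, b2, True) \<in> G"
  shows "G = GW"
proof -
  have y1: "(0, b2, True) \<in> G" using odd_cube[OF y] .
  have "((a2 + a1) mod 3, (b2 + 2 * b1) mod 3, True) \<in> G" using mult[OF y x(1)] by simp
  from mult[OF odd_cube[OF this] y1] have "(0, (b2 + 2 * b1 + 2 * b2) mod 3, False) \<in> G"
    by (simp add: mod_simps)
  moreover have "(b2 + 2 * b1 + 2 * b2) mod 3 = (2 * b1) mod 3" by presburger
  ultimately have c: "(0, (2 * b1) mod 3, False) \<in> G" by simp
  have c': "(0, b1, False) \<in> G"
    using double[OF c] less[OF x(1)] less_3_cases[of b1] by auto
  have 0: "(0, 0, False) \<in> G" using mult[OF y1 y1] by simp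
  have even: "(0, b, False) \<in> G" if "b < 3" for b
    using c c' 0 x(2) less[OF x(1)] less_3_cases[of b1] less_3_cases[OF that] by auto
  have odd: "(0, b, True) \<in> G" if "b < 3" for b
  proof -
    have "(0, (b + 2 * b2) mod 3, False) \<in> G" by (intro even) simp
    from mult[OF this y1] have "(0, (b + 2 * b2 + b2) mod 3, True) \<in> G" by (simp add: mod_simps)
    moreover have "(b + 2 * b2 + b2) mod 3 = b" using that by presburger
    ultimately show ?thesis by simp
  qed
  obtain a3 b3 e3 where z: "(a3, b3, e3) \<in> G" "a3 \<noteq> 0" using nontrivial by blast
  have a3: "(a3, 0, False) \<in> G"
  proof (cases e3)
    case True
    then show ?thesis using mult[OF z(1) odd[of b3]] less[OF z(1)] by simp
  next
    case False
    have "(b3 + (2 * b3) mod 3) mod 3 = 0" by (simp add: mod_simps)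
    then show ?thesis using mult[OF z(1) even[of "(2 * b3) mod 3"]] less[OF z(1)] False by simp
  qed
  have "(2 * a3 mod 3, 0, False) \<in> G" using double[OF a3] by simp
  then have rot: "(a, 0, False) \<in> G" if "a < 3" for a
    using 0 a3 z(2) less[OF z(1)] less_3_cases[of a3] less_3_cases[OF that] by auto
  have "(a, b, e) \<in> G" if "a < 3" "b < 3" for a b e
    using mult[OF rot[OF that(1)], of 0 b e] that even[OF that(2)] odd[OF that(2)] by (cases e) auto
  then have "GW \<subseteq> G" by (auto simp: GW_def)
  moreover have "G \<subseteq> GW" by (auto simp: GW_def dest: less)
  ultimately show ?thesis by blast
qed

lemma even_line:
  assumes "\<forall>a b e. (a, b, e) \<in> G \<longrightarrow> \<not> e"
  shows "\<exists>k<3. (0, 0, False) \<in> G \<and> (1, k, False) \<in> G \<and> (2, (2 * k) mod 3, False) \<in> G"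
proof -
  obtain a b where z: "(a, b, False) \<in> G" "a \<noteq> 0" using nontrivial assms by (metis (full_types))
  have "\<exists>k<3. (1, k, False) \<in> G"
  proof (cases "a = 1")
    case True
    then show ?thesis using z less by blast
  next
    case False
    then have "a = 2" using less[OF z(1)] z(2) by auto
    then show ?thesis using double[OF z(1)] by (intro exI[of _ "2 * b mod 3"]) simp
  qed
  then obtain k where k: "k < 3" "(1, k, False) \<in> G" by blast
  have 2: "(2, (2 * k) mod 3, False) \<in> G" using double[OF k(2)] by simp
  have "(k + (2 * k) mod 3) mod 3 = 0" by (simp add: mod_simps)
  then have "(0, 0, False) \<in> G" using mult[OF k(2) 2] by simp
  then show ?thesis using k 2 by blast
qed

text \<open>Without reflections, \<open>G\<close> is a subspace of the plane over the field with
  three elements, not contained in the line \<open>a = 0\<close>: the whole plane, or the line of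
  slope 0, 1 or 2 through the origin.\<close>

lemma even_cases:
  assumes even: "\<forall>a b e. (a, b, e) \<in> G \<longrightarrow> \<not> e"
  shows "G = GA \<or> G = GM \<or> G = GK \<or> G = GK'"
proof -
  obtain k where k: "k < 3" and 0: "(0, 0, False) \<in> G" and 1: "(1, k, False) \<in> G"
    and 2: "(2, (2 * k) mod 3, False) \<in> G" using even_line[OF even] by blast
  show ?thesis
  proof (cases "G = {(0, 0, False), (1, k, False), (2, (2 * k) mod 3, False)}")
    case True
    then have "k = 0 \<Longrightarrow> G = GM" "k = 1 \<Longrightarrow> G = GK" "k = 2 \<Longrightarrow> G = GK'"
      by (simp_all add: GM_def GK_def GK'_def)
    then show ?thesis using less_3_cases[OF k] by blast
  next
    case False
    then have "\<not> G \<subseteq> {(0, 0, False), (1, k, False), (2, (2 * k) mod 3, False)}" using 0 1 2 by blast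
    then obtain x where "x \<in> G" "x \<notin> {(0, 0, False), (1, k, False), (2, (2 * k) mod 3, False)}" by blast
    moreover obtain a b e where "x = (a, b, e)" by (cases x)
    ultimately have x: "(a, b, e) \<in> G" "(a, b, e) \<notin> {(0, 0, False), (1, k, False), (2, (2 * k) mod 3, False)}"
      by simp_all
    moreover have "\<not> e" using even x(1) by blast
    ultimately have ab: "(a, b, False) \<in> G" "a < 3" "b < 3" using less[OF x(1)] by simp_all
    have ne: "b \<noteq> (a * k) mod 3"
      using x(2) \<open>\<not> e\<close> less_3_cases[OF ab(2)] k by auto
    \<comment> \<open>An element off the line, minus the element of the line with the same
      \<open>a\<close>, is a vertical vector; with the line it spans the plane.\<close>
    have "\<exists>c. c \<noteq> 0 \<and> (0, c, False) \<in> G"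
      using less_3_cases[OF ab(2)]
    proof (elim disjE)
      assume "a = 0"
      then show ?thesis using ab(1) ne by (intro exI[of _ b]) simp
    next
      assume "a = 1"
      then have "b \<noteq> k" using ne k by simp
      then have "(b + (2 * k) mod 3) mod 3 \<noteq> 0" using ab(3) k by presburger
      moreover have "(0, (b + (2 * k) mod 3) mod 3, False) \<in> G" using mult[OF ab(1) 2] \<open>a = 1\<close> by simp
      ultimately show ?thesis by blast
    next
      assume "a = 2"
      then have "b \<noteq> (2 * k) mod 3" using ne by simp
      then have "(b + k) mod 3 \<noteq> 0" using ab(3) k by presburger
      moreover have "(0, (b + k) mod 3, False) \<in> G" using mult[OF ab(1) 1] \<open>a = 2\<close> by simp
      ultimately show ?thesis by blast
    qed
    then obtain c where c: "c \<noteq> 0" "(0, c, False) \<in> G" by blast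
    have c3: "c = 1 \<or> c = 2" using less[OF c(2)] c(1) by linarith
    have c': "(0, (2 * c) mod 3, False) \<in> G" using double[OF c(2)] by simp
    have "y = 0 \<or> y = c \<or> y = (2 * c) mod 3" if "y < 3" for y
      using that c3 by presburger
    then have vert: "(0, y, False) \<in> G" if "y < 3" for y using that 0 c(2) c' by metis
    have line: "(x, (x * k) mod 3, False) \<in> G" if "x < 3" for x
      using less_3_cases[OF that] 0 1 2 k by (elim disjE) simp_all
    have "(x, y, False) \<in> G" if xy: "x < 3" "y < 3" for x y
    proof -
      have "(0, (y + 2 * (x * k)) mod 3, False) \<in> G" by (rule vert) simp
      from mult[OF line[OF xy(1)] this]
      have "(x mod 3, (x * k + (y + 2 * (x * k))) mod 3, False) \<in> G" by (simp only: if_False mod_add_eq add_0_right simp_thms)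
      moreover have "x * k + (y + 2 * (x * k)) = y + 3 * (x * k)" by simp
      ultimately show ?thesis using xy by (simp del: mult_Suc_right)
    qed
    then have "GA \<subseteq> G" by (auto simp: GA_def)
    moreover have "G \<subseteq> GA" using even by (auto simp: GA_def dest: less)
    ultimately show ?thesis by blast
  qed
qed

lemma eq_GM:
  assumes "G \<subseteq> GM"
  shows "G = GM"
proof -
  have "\<forall>a b e. (a, b, e) \<in> G \<longrightarrow> \<not> e" using assms by (auto simp: GM_def)
  from even_line[OF this] obtain k where k: "(0, 0, False) \<in> G" "(1, k, False) \<in> G"
    "(2, (2 * k) mod 3, False) \<in> G" by blast
  have "(1, k, False) \<in> GM" using k(2) assms by blast
  then have "k = 0" by (simp add: GM_def)
  then have "GM \<subseteq> G" using k by (simp add: GM_def)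
  then show ?thesis using assms by blast
qed

lemma eq_GK:
  assumes "G \<subseteq> GK"
  shows "G = GK"
proof -
  have "\<forall>a b e. (a, b, e) \<in> G \<longrightarrow> \<not> e" using assms by (auto simp: GK_def)
  from even_line[OF this] obtain k where k: "(0, 0, False) \<in> G" "(1, k, False) \<in> G"
    "(2, (2 * k) mod 3, False) \<in> G" by blast
  have "(1, k, False) \<in> GK" using k(2) assms by blast
  then have "k = 1" by (simp add: GK_def)
  then have "GK \<subseteq> G" using k by (simp add: GK_def)
  then show ?thesis using assms by blast
qed

lemma eq_GK':
  assumes "G \<subseteq> GK'"
  shows "G = GK'"
proof -
  have "\<forall>a b e. (a, b, e) \<in> G \<longrightarrow> \<not> e" using assms by (auto simp: GK'_def)
  from even_line[OF this] obtain k where k: "(0, 0, False) \<in> G" "(1, k, False) \<in> G"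
    "(2, (2 * k) mod 3, False) \<in> G" by blast
  have "(1, k, False) \<in> GK'" using k(2) assms by blast
  then have "k = 2" by (simp add: GK'_def)
  then have "GK' \<subseteq> G" using k by (simp add: GK'_def)
  then show ?thesis using assms by blast
qed

text \<open>\<open>GB\<close> is cyclic of order 6. By \<open>nontrivial\<close> its part of order 3
  lies in \<open>G\<close>, so only the presence of a reflection is in question.\<close>

lemma GB_cases:
  assumes sub: "G \<subseteq> GB"
  shows "G = GB \<or> G = GM"
proof (cases "\<exists>a b. (a, b, True) \<in> G")
  case False
  then have "G \<subseteq> GM" using sub by (auto simp: GB_def GM_def)
  then show ?thesis using eq_GM by blast
next
  case True
  then obtain a b where ab: "(a, b, True) \<in> G" by blast
  then have "(a, b, True) \<in> GB" using sub by blast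
  then have "b = 1" by (auto simp: GB_def)
  then have odd: "(0, 1, True) \<in> G" using odd_cube[OF ab] by simp
  obtain a3 b3 e3 where z: "(a3, b3, e3) \<in> G" "a3 \<noteq> 0" using nontrivial by blast
  then have a3: "a3 = 1 \<or> a3 = 2" using less[OF z(1)] by linarith
  have "(a3, b3, e3) \<in> GB" using z sub by blast
  then have "(b3 = 0 \<and> \<not> e3) \<or> (b3 = 1 \<and> e3)" by (auto simp: GB_def)
  moreover have "(a3, 0, False) \<in> G" if "b3 = 1" e3
  proof -
    have "((a3 + 0) mod 3, (b3 + 2 * 1) mod 3, False) \<in> G" using mult[OF z(1) odd] that by simp
    then show ?thesis using that less[OF z(1)] by simp
  qed
  ultimately have rot: "(a3, 0, False) \<in> G" using z(1) by auto
  then have rot': "((2 * a3) mod 3, 0, False) \<in> G" using double[OF rot] by simp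
  have rots: "(1, 0, False) \<in> G" "(2, 0, False) \<in> G" using a3 rot rot' by auto
  have "(0, 0, False) \<in> G" using mult[OF odd odd] by simp
  moreover have "(1, 1, True) \<in> G" using mult[OF rots(1) odd] by simp
  moreover have "(2, 1, True) \<in> G" using mult[OF rots(2) odd] by simp
  ultimately have "GB \<subseteq> G" using odd rots by (simp add: GB_def)
  then show ?thesis using sub by blast
qed

end

section \<open>The Galois group in terms of the parameter\<close>

context per3_data
begin

lemma algebraic_gm_tt: "algebraic (gm n)" "algebraic (tt n)"
proof -
  have alg: "algebraic z" if "z \<in> roots" for z
    using that minpolys roots_eq by (intro algebraicI'[of minpolys]) (auto simp: poly_over_def)
  have "gm n \<in> roots" by (auto simp: roots_def gm_def)
  then show "algebraic (gm n)" by (rule alg)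
  have "tt n \<in> roots" by (auto simp: roots_def tt_def)
  then show "algebraic (tt n)" by (rule alg)
qed

lemma G_less: "(a, b, e) \<in> G \<Longrightarrow> a < 3 \<and> b < 3"
  by (simp add: G_def)

lemma G_acts: "(a, b, e) \<in> G \<Longrightarrow> \<exists>\<tau>\<in>field_auts E. acts \<tau> a b e"
  by (simp add: G_def)

lemma moved_by_G:
  assumes "algebraic z" "z \<in> E" "z \<notin> \<rat>"
  shows "\<exists>a b e \<tau>. (a, b, e) \<in> G \<and> \<tau> \<in> field_auts E \<and> acts \<tau> a b e \<and> \<tau> z \<noteq> z"
proof -
  obtain \<tau> where \<tau>: "\<tau> \<in> field_auts E" "\<tau> z \<noteq> z"
    using splitting_field_aut_moving[OF minpolys roots_eq assms] by blast
  then show ?thesis using aut_acts[OF \<tau>(1)] unfolding G_def by blast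
qed

sublocale label_group G
proof
  show "(a, b, e) \<in> G \<Longrightarrow> a < 3 \<and> b < 3" for a b e by (rule G_less)
  show "((a + a') mod 3, (b + (if e then 2 * b' else b')) mod 3, e \<noteq> e') \<in> G"
    if "(a, b, e) \<in> G" "(a', b', e') \<in> G" for a b e a' b' e' using G_mult[OF that] .
  \<comment> \<open>Some automorphism moves the irrational \<open>gm 0\<close>, so its shift
    \<open>a\<close> is not zero.\<close>
  obtain a b e \<tau> where "(a, b, e) \<in> G" "acts \<tau> a b e" "\<tau> (gm 0) \<noteq> gm 0"
    using moved_by_G[OF algebraic_gm_tt(1) gm_in_E gm_0_irrational] by blast
  moreover from this have "a \<noteq> 0" unfolding acts_def by (metis add_0_right)
  ultimately show "\<exists>a b e. (a, b, e) \<in> G \<and> a \<noteq> 0" by blast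
qed

lemma tt_rational:
  assumes "tt j \<in> \<rat>" "(a, b, e) \<in> G"
  shows "(if e then b + 1 + 2 * j else b + j) mod 3 = j mod 3"
proof -
  obtain \<tau> where \<tau>: "\<tau> \<in> field_auts E" "acts \<tau> a b e" using G_acts[OF assms(2)] by blast
  then have "field_hom E \<tau>" by (simp add: field_auts_iff[OF E])
  from field_hom_Rats[OF E this assms(1)] have "\<tau> (tt j) = tt j" .
  moreover have "\<tau> (tt j) = tt (if e then b + 1 + 2 * j else b + j)" using \<tau>(2) by (simp add: acts_def)
  ultimately show ?thesis using tt_inj by simp
qed

lemma tt_irrational:
  assumes "tt j \<notin> \<rat>"
  shows "\<exists>a b e. (a, b, e) \<in> G \<and> (if e then b + 1 + 2 * j else b + j) mod 3 \<noteq> j mod 3"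
proof -
  obtain a b e \<tau> where G: "(a, b, e) \<in> G" "acts \<tau> a b e" "\<tau> (tt j) \<noteq> tt j"
    using moved_by_G[OF algebraic_gm_tt(2) tt_in_E assms] by blast
  have "\<tau> (tt j) = tt (if e then b + 1 + 2 * j else b + j)" using G(2) by (simp add: acts_def)
  then have "(if e then b + 1 + 2 * j else b + j) mod 3 \<noteq> j mod 3" using G(3) tt_cong by metis
  then show ?thesis using G(1) by blast
qed

definition delta :: complex where
  "delta = (t0 - t1) * (t1 - t2) * (t2 - t0)"

lemma delta_nonzero: "delta \<noteq> 0"
  using t_distinct by (simp add: delta_def)

lemma delta_in_E: "delta \<in> E"
  unfolding delta_def using t_in_E by (intro subfield_mult[OF E] subfield_diff[OF E])

lemma delta_square: "delta\<^sup>2 = of_rat (27 * v * (4 - v))"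
proof -
  define s1 where "s1 = t0 + t1 + t2"
  define s2 where "s2 = t0 * t1 + t1 * t2 + t2 * t0"
  define s3 where "s3 = t0 * t1 * t2"
  \<comment> \<open>The discriminant of a cubic in its elementary symmetric functions.\<close>
  have "delta\<^sup>2 = s1\<^sup>2 * s2\<^sup>2 - 4 * s2 ^ 3 - 4 * s1 ^ 3 * s3 + 18 * s1 * s2 * s3 - 27 * s3\<^sup>2"
    unfolding delta_def s1_def s2_def s3_def by algebra
  also have "\<dots> = 108 * of_rat v - 27 * (of_rat v)\<^sup>2"
    using e1 e2 e3 by (simp add: s1_def s2_def s3_def)
  also have "\<dots> = of_rat (27 * v * (4 - v))"
    by (simp add: of_rat_mult of_rat_diff power2_eq_square algebra_simps)
  finally show ?thesis .
qed

lemma algebraic_delta: "algebraic delta"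
proof (rule algebraicI'[of "[:- of_rat (27 * v * (4 - v)), 0, 1:]"])
  show "coeff [:- of_rat (27 * v * (4 - v)), 0, 1:] i \<in> \<rat>" for i
    by (auto simp: coeff_pCons split: nat.splits)
  show "poly [:- of_rat (27 * v * (4 - v)), 0, 1:] delta = 0"
    using delta_square by (simp add: power2_eq_square)
qed simp

lemma acts_delta:
  assumes \<tau>: "\<tau> \<in> field_auts E" "acts \<tau> a b e" and b: "b < 3"
  shows "\<tau> delta = (if e then - delta else delta)"
proof -
  have hom: "field_hom E \<tau>" using \<tau> by (simp add: field_auts_iff[OF E])
  have T: "\<tau> (tt n) = tt (if e then b + 1 + 2 * n else b + n)" for n
    using \<tau>(2) by (simp add: acts_def)
  note \<tau>t = T[of 0, unfolded tt_simps] T[of 1, unfolded tt_simps] T[of 2, unfolded tt_simps]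
  have "\<tau> delta = (\<tau> t0 - \<tau> t1) * (\<tau> t1 - \<tau> t2) * (\<tau> t2 - \<tau> t0)"
    unfolding delta_def using t_in_E
    by (simp add: field_hom_mult[OF E hom] field_hom_diff[OF E hom] subfield_intros[OF E])
  also have "\<dots> = (if e then - delta else delta)"
    unfolding \<tau>t delta_def using less_3_cases[OF b]
    by (elim disjE) (simp_all add: tt_def algebra_simps)
  finally show ?thesis .
qed

lemma delta_rational:
  assumes "delta \<in> \<rat>"
  shows "\<forall>a b e. (a, b, e) \<in> G \<longrightarrow> \<not> e"
proof (intro allI impI)
  fix a b e assume G: "(a, b, e) \<in> G"
  obtain \<tau> where \<tau>: "\<tau> \<in> field_auts E" "acts \<tau> a b e" using G_acts[OF G] by blast
  have hom: "field_hom E \<tau>" using \<tau> by (simp add: field_auts_iff[OF E])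
  have "\<tau> delta = delta" using field_hom_Rats[OF E hom assms] .
  then show "\<not> e" using acts_delta[OF \<tau>] G_less[OF G] delta_nonzero by auto
qed

lemma delta_irrational:
  assumes "delta \<notin> \<rat>"
  shows "\<exists>a b. (a, b, True) \<in> G"
proof -
  obtain a b e \<tau> where G: "(a, b, e) \<in> G" "\<tau> \<in> field_auts E" "acts \<tau> a b e" "\<tau> delta \<noteq> delta"
    using moved_by_G[OF algebraic_delta delta_in_E assms] by blast
  then have e using acts_delta[OF G(2,3)] G_less[OF G(1)] by (cases e) auto
  then show ?thesis using G(1) by auto
qed

lemma lab_rational:
  assumes "rat_pt (lab j)" "j < 6" "(a, b, e) \<in> G"
  shows "wel a b e j = j"
proof -
  obtain \<tau> where \<tau>: "\<tau> \<in> field_auts E" "acts \<tau> a b e" using G_acts[OF assms(3)] by blast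
  have hom: "field_hom E \<tau>" using \<tau> by (simp add: field_auts_iff[OF E])
  have "map_option \<tau> (lab j) = lab j"
    using assms(1) field_hom_Rats[OF E hom] by (cases "lab j") (auto simp: rat_pt_Some_iff)
  then have "lab (wel a b e j) = lab j"
    using acts_lab[OF \<tau>] G_less[OF assms(3)] assms(2) by simp
  then show ?thesis
    using bij_betw_imp_inj_on[OF lab_bij] wel_less_6[OF assms(2)] assms(2) by (auto dest: inj_onD)
qed

text \<open>The equation \<open>s^2 = 27 v (4 - v)\<close> describes a conic with the rational point
  \<open>v = s = 0\<close>. The lines through it reach all other rational points, and
  \<open>u\<close> is a Moebius change of the slope.\<close>

lemma alpha_iff: "v \<in> Im_alpha \<longleftrightarrow> delta \<in> \<rat>"
proof
  assume "v \<in> Im_alpha"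
  then obtain u where u: "1 - u + u\<^sup>2 \<noteq> 0" "v = (1 + u)\<^sup>2 / (1 - u + u\<^sup>2)"
    by (auto simp: Im_alpha_def alpha_def)
  define s where "s = 9 * (1 + u) * (1 - u) / (1 - u + u\<^sup>2)"
  have "27 * v * (4 - v) = s\<^sup>2"
  proof -
    have "4 - v = 3 * (1 - u)\<^sup>2 / (1 - u + u\<^sup>2)"
      using u(1) unfolding u(2) by (simp add: divide_simps) (simp add: algebra_simps power2_eq_square)
    then have eq: "27 * v * (4 - v) = 27 * ((1 + u)\<^sup>2 / (1 - u + u\<^sup>2)) * (3 * (1 - u)\<^sup>2 / (1 - u + u\<^sup>2))"
      using u(2) by simp
    have "27 * (p\<^sup>2 / d) * (3 * m\<^sup>2 / d) = (9 * p * m / d)\<^sup>2" for p m d :: rat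
      by (simp add: power2_eq_square)
    then have "27 * ((1 + u)\<^sup>2 / (1 - u + u\<^sup>2)) * (3 * (1 - u)\<^sup>2 / (1 - u + u\<^sup>2)) = s\<^sup>2"
      by (simp only: s_def)
    then show ?thesis unfolding eq .
  qed
  then have "delta\<^sup>2 = (of_rat s)\<^sup>2" using delta_square by (simp add: of_rat_power)
  then have "delta = of_rat s \<or> delta = - of_rat s" by (simp add: power2_eq_iff)
  then show "delta \<in> \<rat>" by auto
next
  assume "delta \<in> \<rat>"
  then obtain s :: rat where "delta = of_rat s" by (auto elim: Rats_cases)
  then have "of_rat (s\<^sup>2) = (of_rat (27 * v * (4 - v)) :: complex)"
    using delta_square by (simp add: of_rat_power)
  then have s: "s\<^sup>2 = 27 * v * (4 - v)" by (simp only: of_rat_eq_iff)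
  \<comment> \<open>The slope \<open>s / v\<close>, divided by 3.\<close>
  define m where "m = s / (3 * v)"
  have "v * (v * (3 + m\<^sup>2)) = 3 * v\<^sup>2 + s\<^sup>2 / 9"
    using v0 by (simp add: m_def power2_eq_square field_simps)
  also have "\<dots> = v * 12" unfolding s by (simp add: power2_eq_square field_simps)
  finally have vm: "v * (3 + m\<^sup>2) = 12" using v0 by simp
  show "v \<in> Im_alpha"
  \<comment> \<open>At \<open>m = -3\<close> the parameter \<open>u\<close> becomes infinite; the
    value of \<open>alpha\<close> there is 1, which is also \<open>alpha 0\<close>.\<close>
  proof (cases "m = - 3")
    case True
    then have "v = alpha 0" using vm by (simp add: alpha_def)
    then show ?thesis unfolding Im_alpha_def by force
  next
    case False
    define u where "u = (3 - m) / (3 + m)"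
    have m3: "3 + m \<noteq> 0" using False by (simp add: add_eq_0_iff2 add_eq_0_iff)
    have m9: "3 + m\<^sup>2 \<noteq> 0" using vm by auto
    have "1 + u = 6 / (3 + m)" using m3 by (simp add: u_def field_simps)
    moreover have den: "1 - u + u\<^sup>2 = 3 * (3 + m\<^sup>2) / (3 + m)\<^sup>2"
    proof -
      have "(3 + m)\<^sup>2 * (1 - u + u\<^sup>2) = (3 + m)\<^sup>2 - (3 + m) * ((3 + m) * u) + ((3 + m) * u)\<^sup>2"
        by (simp add: algebra_simps power2_eq_square)
      also have "(3 + m) * u = 3 - m" using m3 by (simp add: u_def)
      also have "(3 + m)\<^sup>2 - (3 + m) * (3 - m) + (3 - m)\<^sup>2 = 3 * (3 + m\<^sup>2)"
        by (simp add: algebra_simps power2_eq_square)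
      finally show ?thesis using m3 by (simp add: field_simps)
    qed
    moreover have "(6 / x)\<^sup>2 / (3 * w / x\<^sup>2) = 12 / w" if "x \<noteq> 0" "w \<noteq> 0" for x w :: rat
      using that by (simp add: field_simps)
    ultimately have "alpha u = 12 / (3 + m\<^sup>2)"
      using m3 m9 by (simp only: alpha_def)
    also have "\<dots> = v" using vm m9 by (simp add: field_simps)
    finally have "v = alpha u" ..
    moreover have "1 - u + u\<^sup>2 \<noteq> 0" unfolding den using m3 m9 by simp
    ultimately show ?thesis unfolding Im_alpha_def by blast
  qed
qed

lemma beta_if_rational_root:
  assumes "tt j \<in> \<rat>"
  shows "v \<in> Im_beta"
proof -
  obtain r :: rat where r: "tt j = of_rat r" using assms by (auto elim: Rats_cases)
  have "tt j ^ 3 - 3 * (tt j)\<^sup>2 + of_rat v = 0" unfolding t_roots by (auto simp: tt_def)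
  then have "of_rat (r ^ 3 - 3 * r\<^sup>2 + v) = (0 :: complex)"
    unfolding r by (simp add: of_rat_add of_rat_diff of_rat_mult of_rat_power)
  then have "r ^ 3 - 3 * r\<^sup>2 + v = 0" by (simp only: of_rat_eq_0_iff)
  then have "v = beta r" by (simp add: beta_def algebra_simps power2_eq_square power3_eq_cube)
  then show ?thesis by (simp add: Im_beta_def)
qed

lemma G3_is_K6: "G = GK \<or> G = GK' \<Longrightarrow> G3_is \<phi> K6"
proof (elim disjE)
  assume "G = GK"
  then show ?thesis using G3_is_G wel_GK by simp
next
  assume "G = GK'"
  have "G3_is \<phi> ((\<lambda>(a, b, e) i. if i < 6 then swap6 (wel a b e (swap6 i)) else i) ` G)"
  proof (rule G3_is_conj)
    fix i :: nat assume "i < 6"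
    then show "swap6 i < 6" "swap6 (swap6 i) = i" by (auto simp: swap6_def)
    show "swap6 (pi6 i) = pi6 (swap6 i)"
      using less_6_cases[OF \<open>i < 6\<close>] by (elim disjE) (simp_all add: pi6_simps swap6_def)
  qed
  then show ?thesis using \<open>G = GK'\<close> wel_GK'_conj by simp
qed

text \<open>Outside \<open>Im_alpha\<close> there is a reflection; outside \<open>Im_beta\<close>
  the root it fixes is moved by a further element. Together they yield an even element with
  \<open>b \<noteq> 0\<close>.\<close>

lemma G3_generic:
  assumes "v \<notin> Im_alpha" "v \<notin> Im_beta"
  shows "G3_is \<phi> W6"
proof -
  obtain a2 b2 where y: "(a2, b2, True) \<in> G" using delta_irrational assms(1) alpha_iff by blast
  \<comment> \<open>The index fixed by the reflection: \<open>2 j = b2 + 1\<close> modulo 3, and 2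
    is its own inverse.\<close>
  define j where "j = 2 * (b2 + 1)"
  obtain a b e where z: "(a, b, e) \<in> G" "(if e then b + 1 + 2 * j else b + j) mod 3 \<noteq> j mod 3"
    using tt_irrational beta_if_rational_root assms(2) by blast
  have "\<exists>a b. (a, b, False) \<in> G \<and> b \<noteq> 0"
  proof (cases e)
    case False
    then have "b \<noteq> 0" using z(2) by (intro notI) simp
    then show ?thesis using z(1) False by auto
  next
    \<comment> \<open>Two reflections fixing different roots multiply to a nontrivial
      rotation.\<close>
    case True
    have b: "b < 3" "b2 < 3" using G_less z(1) y by blast+
    have "(b + 1 + 2 * (2 * (b2 + 1))) mod 3 \<noteq> (2 * (b2 + 1)) mod 3" using z(2) True by (simp add: j_def)
    then have "(b2 + 2 * b) mod 3 \<noteq> 0" using b by presburger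
    moreover have "((a2 + a) mod 3, (b2 + 2 * b) mod 3, False) \<in> G"
      using G_mult[OF y z(1)] True by simp
    ultimately show ?thesis by blast
  qed
  then have "G = GW" using eq_GW y by blast
  then show ?thesis using G3_is_G wel_GW by simp
qed

lemma G3_alpha:
  assumes "v \<in> Im_alpha"
  shows "G3_is \<phi> A6 \<or> G3_is \<phi> K6 \<or> G3_is \<phi> M6"
proof -
  have "\<forall>a b e. (a, b, e) \<in> G \<longrightarrow> \<not> e" using assms alpha_iff delta_rational by blast
  from even_cases[OF this] show ?thesis
  proof (elim disjE)
    assume "G = GA" then show ?thesis using G3_is_G wel_GA by simp
  next
    assume "G = GM" then show ?thesis using G3_is_G wel_GM by simp
  qed (use G3_is_K6 in blast)+
qed

lemma G3_beta:
  assumes "t1 \<in> \<rat>"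
  shows "G3_is \<phi> B6 \<or> G3_is \<phi> M6"
proof -
  have "(a, b, e) \<in> GB" if G: "(a, b, e) \<in> G" for a b e
    using tt_rational[of 1, OF _ G] assms G_less[OF G] less_3_cases[of a] less_3_cases[of b]
    by (cases e) (auto simp: tt_simps GB_def)
  then have "G \<subseteq> GB" by auto
  from GB_cases[OF this] show ?thesis using G3_is_G wel_GB wel_GM by auto
qed

lemma G3_split:
  assumes "t0 \<in> \<rat>" "t1 \<in> \<rat>" "t2 \<in> \<rat>"
  shows "G3_is \<phi> M6"
proof -
  have "(a, b, e) \<in> GM" if G: "(a, b, e) \<in> G" for a b e
    using tt_rational[of 0, OF _ G] tt_rational[of 1, OF _ G] assms
      G_less[OF G] less_3_cases[of a] less_3_cases[of b]
    by (cases e) (auto simp: tt_simps GM_def)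
  then have "G \<subseteq> GM" by auto
  then show ?thesis using eq_GM G3_is_G wel_GM by simp
qed

text \<open>The stabiliser of a label contains no reflection: it is \<open>GK'\<close> for the
  labels 0, 1, 2 and \<open>GK\<close> for 3, 4, 5.\<close>

lemma G3_rational_point:
  assumes "rat_pt P" "P \<in> per3 \<phi>"
  shows "G3_is \<phi> K6"
proof -
  obtain j where j: "j < 6" "rat_pt (lab j)" using assms per3_eq by auto
  note fixed = lab_rational[OF j(2,1)]
  have "G \<subseteq> GK \<or> G \<subseteq> GK'"
  proof (cases "j < 3")
    case True
    have "(a, b, e) \<in> GK'" if G: "(a, b, e) \<in> G" for a b e
    proof -
      have "\<not> e" "(j + a + b) mod 3 = j" using fixed[OF G] True by (auto simp: wel_def split: if_splits)
      moreover from this have "(a = 0 \<and> b = 0) \<or> (a = 1 \<and> b = 2) \<or> (a = 2 \<and> b = 1)"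
        using G_less[OF G] True by presburger
      ultimately show ?thesis by (auto simp: GK'_def)
    qed
    then show ?thesis by auto
  next
    case False
    have "(a, b, e) \<in> GK" if G: "(a, b, e) \<in> G" for a b e
    proof -
      have "(j + a + b) mod 3 < 3" by simp
      then have "\<not> e" "3 + (j + a + 2 * b) mod 3 = j"
        using fixed[OF G] False j(1) by (auto simp: wel_def split: if_splits)
      moreover from this have "(a = 0 \<and> b = 0) \<or> (a = 1 \<and> b = 1) \<or> (a = 2 \<and> b = 2)"
        using G_less[OF G] by presburger
      ultimately show ?thesis by (auto simp: GK_def)
    qed
    then show ?thesis by auto
  qed
  then show ?thesis using eq_GK eq_GK' G3_is_K6 by blast
qed

text \<open>The hypotheses describe the 3-cycle of \<open>psi v\<close> through \<open>x\<close>,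
  \<open>y\<close>, \<open>z\<close>, with denominators cleared.\<close>

lemma G3_kappa:
  assumes x: "y * (v * x\<^sup>2 - 1) = 2 * x - 1" and y: "z * (v * y\<^sup>2 - 1) = 2 * y - 1"
    and z: "x * (v * z\<^sup>2 - 1) = 2 * z - 1" and ne: "x \<noteq> y"
  shows "G3_is \<phi> K6"
proof -
  have psi: "rf_eval (psi v) (Some (of_rat p)) = Some (of_rat q)"
    if "q * (v * p\<^sup>2 - 1) = 2 * p - 1" for p q
  proof -
    \<comment> \<open>A vanishing denominator would force \<open>p = 1/2\<close> and
      \<open>v = 4\<close>.\<close>
    have nz: "v * p\<^sup>2 - 1 \<noteq> 0"
    proof
      assume 0: "v * p\<^sup>2 - 1 = 0"
      then have "2 * p = 1" using that by simp
      then have "v = v * (2 * p) * (2 * p)" by (simp only: mult_1_right)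
      also have "\<dots> = 4 * (v * p\<^sup>2)" by (simp add: power2_eq_square)
      also have "v * p\<^sup>2 = 1" using 0 by simp
      finally show False using v4 by simp
    qed
    have "rf_eval (psi v) (Some (of_rat p)) = rf_eval (psi v) (hp (of_rat p) 1)" by (simp add: hp_def)
    also have "\<dots> = hp (2 * of_rat p - 1) (of_rat v * (of_rat p)\<^sup>2 - 1)" using psi_hp[OF v0, of "of_rat p" 1] by simp
    also have "\<dots> = hp (of_rat (2 * p - 1)) (of_rat (v * p\<^sup>2 - 1))"
      by (simp add: of_rat_diff of_rat_mult of_rat_power)
    also have "\<dots> = Some (of_rat q)" using nz unfolding that[symmetric] by (simp add: hp_def of_rat_mult)
    finally show ?thesis .
  qed
  have "periodic_pt (rf_eval (psi v)) 3 (Some (of_rat x))"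
    unfolding periodic_pt_3_iff using psi[OF x] psi[OF y] psi[OF z] ne by (simp add: numeral_3_eq_3)
  moreover have "inj S" by (auto intro!: injI simp: mob_eq_iff[OF detS])
  ultimately have per: "periodic_pt (rf_eval \<phi>) 3 (S (Some (of_rat x)))"
    using periodic_pt_conj[of S "rf_eval (psi v)" "rf_eval \<phi>", OF conjQ] by blast
  then have "S (Some (of_rat x)) \<in> per3 \<phi>"
    using periodic_alg_pt by (simp add: per3_def periodic_pt_3_iff)
  moreover have "rat_pt (S (Some (of_rat x)))"
    by (rule rat_pt_mob[OF detQ]) (simp add: rat_pt_Some_iff)
  ultimately show ?thesis using G3_rational_point by blast
qed

end

section \<open>Explicit roots of the cubic and explicit 3-cycles\<close>

lemma exists_cubic_roots:
  assumes "t1 ^ 3 - 3 * t1\<^sup>2 + w = (0 :: complex)"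
  shows "\<exists>t0 t2. t0 + t1 + t2 = 3 \<and> t0 * t1 + t1 * t2 + t2 * t0 = 0 \<and> t0 * t1 * t2 = - w"
proof -
  \<comment> \<open>The quadratic is the quotient of \<open>t^3 - 3t^2 + w\<close> by
    \<open>t - t1\<close>.\<close>
  have "\<not> constant (poly [:t1 * (t1 - 3), t1 - 3, 1:])" by (simp add: constant_degree)
  then obtain t0 where "poly [:t1 * (t1 - 3), t1 - 3, 1:] t0 = 0"
    using fundamental_theorem_of_algebra by blast
  then have t0: "t0\<^sup>2 + (t1 - 3) * t0 + t1 * (t1 - 3) = 0" by (simp add: power2_eq_square algebra_simps)
  define t2 where "t2 = 3 - t0 - t1"
  have "t0 + t1 + t2 = 3" by (simp add: t2_def)
  moreover have "t0 * t1 + t1 * t2 + t2 * t0 = - (t0\<^sup>2 + (t1 - 3) * t0 + t1 * (t1 - 3))"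
    unfolding t2_def by (simp add: power2_eq_square algebra_simps)
  moreover have "t0 * t1 * t2 + w = (t1 ^ 3 - 3 * t1\<^sup>2 + w) - t1 * (t0\<^sup>2 + (t1 - 3) * t0 + t1 * (t1 - 3))"
    unfolding t2_def by (simp add: power2_eq_square power3_eq_cube algebra_simps)
  then have "t0 * t1 * t2 = - w" unfolding assms t0 by (simp add: eq_neg_iff_add_eq_0)
  ultimately show ?thesis using t0 by auto
qed

lemma exists_root_gamma: "\<exists>g :: complex. g ^ 3 - 3 * g + 1 = 0"
proof -
  have "\<not> constant (poly [:1, - 3, 0, 1 :: complex:])" by (simp add: constant_degree)
  then obtain g where "poly [:1, - 3, 0, 1 :: complex:] g = 0" using fundamental_theorem_of_algebra by blast
  then show ?thesis by (intro exI[of _ g]) (simp add: power3_eq_cube algebra_simps)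
qed

lemma exists_root_t: "\<exists>t :: complex. t ^ 3 - 3 * t\<^sup>2 + w = 0"
proof -
  have "\<not> constant (poly [:w, 0, - 3, 1:])" by (simp add: constant_degree)
  then obtain t where "poly [:w, 0, - 3, 1:] t = 0" using fundamental_theorem_of_algebra by blast
  then show ?thesis by (intro exI[of _ t]) (simp add: power3_eq_cube power2_eq_square algebra_simps)
qed

lemma quadratic_pos: "1 + u + u\<^sup>2 > (0 :: rat)"
proof -
  have "1 + u + u\<^sup>2 = (u + 1 / 2)\<^sup>2 + 3 / 4" by (simp add: power2_eq_square field_simps)
  then show ?thesis using zero_le_power2[of "u + 1 / 2"] by linarith
qed

text \<open>The substitution of \<open>-1/(u + 1)\<close> for \<open>u\<close>, of order 3, permutes
  \<open>r0\<close>, \<open>r1\<close>, \<open>r2\<close> cyclically.\<close>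

lemma mu_roots:
  fixes u :: rat
  assumes "v = mu u" "u ^ 3 + 3 * u\<^sup>2 - 1 \<noteq> 0"
  defines "q \<equiv> 1 + u + u\<^sup>2"
  defines "r0 \<equiv> (2 * u + 1) * (u + 2) / q" and "r1 \<equiv> (u - 1) * (2 * u + 1) / q"
    and "r2 \<equiv> - ((u - 1) * (u + 2)) / q"
  shows "r0 + r1 + r2 = 3" "r0 * r1 + r1 * r2 + r2 * r0 = 0" "r0 * r1 * r2 = - v"
proof -
  have q: "q \<noteq> 0" using quadratic_pos[of u] by (simp add: q_def)
  have "r0 + r1 + r2 = ((2 * u + 1) * (u + 2) + (u - 1) * (2 * u + 1) - (u - 1) * (u + 2)) / q"
    by (simp add: r0_def r1_def r2_def add_divide_distrib diff_divide_distrib)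
  also have "(2 * u + 1) * (u + 2) + (u - 1) * (2 * u + 1) - (u - 1) * (u + 2) = 3 * q"
    by (simp add: q_def algebra_simps power2_eq_square)
  finally show "r0 + r1 + r2 = 3" using q by simp
  have "r0 * r1 + r1 * r2 + r2 * r0 = ((2 * u + 1) * (u + 2) * ((u - 1) * (2 * u + 1)) -
    (u - 1) * (2 * u + 1) * ((u - 1) * (u + 2)) - (u - 1) * (u + 2) * ((2 * u + 1) * (u + 2))) / (q * q)"
    by (simp add: r0_def r1_def r2_def add_divide_distrib diff_divide_distrib)
  also have "(2 * u + 1) * (u + 2) * ((u - 1) * (2 * u + 1)) -
    (u - 1) * (2 * u + 1) * ((u - 1) * (u + 2)) - (u - 1) * (u + 2) * ((2 * u + 1) * (u + 2)) = 0"
    by (simp add: algebra_simps)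
  finally show "r0 * r1 + r1 * r2 + r2 * r0 = 0" by simp
  define N where "N = u ^ 3 - 3 * u - 1"
  define D where "D = u ^ 3 + 3 * u\<^sup>2 - 1"
  have D: "D \<noteq> 0" using assms(2) by (simp add: D_def)
  have "v = (1 + N / D)\<^sup>2 / (1 - N / D + (N / D)\<^sup>2)" using assms(1) by (simp add: mu_def alpha_def N_def D_def)
  also have "\<dots> = ((D + N) / D)\<^sup>2 / ((D\<^sup>2 - N * D + N\<^sup>2) / D\<^sup>2)"
    using D by (simp add: add_divide_distrib diff_divide_distrib power_divide power2_eq_square)
  also have "\<dots> = (D + N)\<^sup>2 / (D\<^sup>2 - N * D + N\<^sup>2)" using D by (simp add: power_divide)
  \<comment> \<open>With \<open>\<omega>\<close> a primitive cube root of unity,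
    \<open>N + (N - D) \<omega>\<close> is the cube of \<open>u - \<omega>\<close>; the norms of
    these two numbers are \<open>D^2 - N D + N^2\<close> and \<open>q\<close>.\<close>
  also have "D\<^sup>2 - N * D + N\<^sup>2 = q ^ 3"
    unfolding D_def N_def q_def by algebra
  also have "D + N = (u - 1) * (2 * u + 1) * (u + 2)"
    unfolding D_def N_def by algebra
  finally have v: "v = ((u - 1) * (2 * u + 1) * (u + 2))\<^sup>2 / q ^ 3" .
  show "r0 * r1 * r2 = - v"
  proof -
    have "r0 * r1 * r2 = - ((2 * u + 1) * (u + 2) * ((u - 1) * (2 * u + 1)) * ((u - 1) * (u + 2))) / (q * q * q)"
      by (simp add: r0_def r1_def r2_def)
    also have "(2 * u + 1) * (u + 2) * ((u - 1) * (2 * u + 1)) * ((u - 1) * (u + 2)) =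
      ((u - 1) * (2 * u + 1) * (u + 2))\<^sup>2" by algebra
    also have "q * q * q = q ^ 3" by (simp add: power3_eq_cube)
    finally show ?thesis unfolding v by simp
  qed
qed

text \<open>The substitution of \<open>-1/(u + 1)\<close> for \<open>u\<close> leaves
  \<open>kappa\<close> unchanged and carries \<open>x\<close> to \<open>y\<close>, \<open>y\<close>
  to \<open>z\<close> and \<open>z\<close> to \<open>x\<close>, so the three equations are one
  equation in three guises.\<close>

lemma kappa_cycle:
  fixes u :: rat
  assumes v: "v = kappa u" "v \<noteq> 0" "v \<noteq> 1"
  defines "q \<equiv> 1 + u + u\<^sup>2" and "R \<equiv> u ^ 3 - 3 * u\<^sup>2 - 6 * u - 1"
  defines "x \<equiv> - (u * (u + 2) * q / R)" and "y \<equiv> - ((2 * u + 1) * q / ((u + 1) * R))"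
    and "z \<equiv> (u\<^sup>2 - 1) * q / (u * R)"
  shows "y * (v * x\<^sup>2 - 1) = 2 * x - 1" "z * (v * y\<^sup>2 - 1) = 2 * y - 1" "x * (v * z\<^sup>2 - 1) = 2 * z - 1"
    "x \<noteq> y"
proof -
  have q: "q \<noteq> 0" using quadratic_pos[of u] by (simp add: q_def)
  have vR: "v = R\<^sup>2 / q ^ 3" using v(1) by (simp add: kappa_def R_def q_def)
  have R: "R \<noteq> 0" using vR v(2) by auto
  \<comment> \<open>Both \<open>u = 0\<close> and \<open>u = -1\<close> give \<open>v = 1\<close>,
    for which infinity itself is 3-periodic.\<close>
  have u0: "u \<noteq> 0" using v(1,3) by (auto simp: kappa_def)
  have u1: "u + 1 \<noteq> 0"
  proof
    assume "u + 1 = 0"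
    then have "u = - 1" by simp
    then show False using v(1,3) by (simp add: kappa_def)
  qed
  have vsq: "v * (n * q / (d * R))\<^sup>2 = n\<^sup>2 / (d\<^sup>2 * q)" if "d \<noteq> 0" for n d
    using q R that unfolding vR by (simp add: field_simps power2_eq_square power3_eq_cube)
  have vx: "v * x\<^sup>2 = (u * (u + 2))\<^sup>2 / q" using vsq[of 1 "u * (u + 2)"] by (simp add: x_def)
  have vy: "v * y\<^sup>2 = (2 * u + 1)\<^sup>2 / ((u + 1)\<^sup>2 * q)" using vsq[OF u1, of "2 * u + 1"] by (simp add: y_def)
  have vz: "v * z\<^sup>2 = (u\<^sup>2 - 1)\<^sup>2 / (u\<^sup>2 * q)" using vsq[OF u0, of "u\<^sup>2 - 1"] by (simp add: z_def)
  have frac: "n * k * q / (d * R) * (m / (k\<^sup>2 * q) - 1) = n * (m - k\<^sup>2 * q) / (k * d * R)"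
    if "k \<noteq> 0" for n k d m
  proof -
    have "k * q * (m / (k\<^sup>2 * q) - 1) = (m - k\<^sup>2 * q) / k"
      using q that by (simp add: field_simps power2_eq_square)
    moreover have "n * k * q / (d * R) * (m / (k\<^sup>2 * q) - 1) = n * (k * q * (m / (k\<^sup>2 * q) - 1)) / (d * R)"
      by simp
    ultimately show ?thesis by (simp add: mult.assoc)
  qed
  have frac': "- (k * (2 * X + c)) / (k * c) = 2 * - (X / c) - 1" if "k \<noteq> 0" "c \<noteq> 0" for k c X :: rat
    using that by (simp add: field_simps)
  have "y * (v * x\<^sup>2 - 1) = - ((2 * u + 1) * ((u * (u + 2))\<^sup>2 - q) / ((u + 1) * R))"
    unfolding vx y_def using frac[of 1 "2 * u + 1" "u + 1" "(u * (u + 2))\<^sup>2"] by simp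
  also have "(2 * u + 1) * ((u * (u + 2))\<^sup>2 - q) = (u + 1) * (2 * (u * (u + 2) * q) + R)"
    unfolding q_def R_def by algebra
  also have "- ((u + 1) * (2 * (u * (u + 2) * q) + R) / ((u + 1) * R)) = 2 * x - 1"
    unfolding x_def using frac'[OF u1 R, of "u * (u + 2) * q"] by simp
  finally show "y * (v * x\<^sup>2 - 1) = 2 * x - 1" .
  have "z = (u - 1) * (u + 1) * q / (u * R)" by (simp add: z_def power2_eq_square algebra_simps)
  then have "z * (v * y\<^sup>2 - 1) = (u - 1) * ((2 * u + 1)\<^sup>2 - (u + 1)\<^sup>2 * q) / ((u + 1) * u * R)"
    unfolding vy using frac[OF u1, of "u - 1" u "(2 * u + 1)\<^sup>2"] by simp
  also have "(u - 1) * ((2 * u + 1)\<^sup>2 - (u + 1)\<^sup>2 * q) = - (u * (2 * ((2 * u + 1) * q) + (u + 1) * R))"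
    unfolding q_def R_def by algebra
  also have "(u + 1) * u * R = u * ((u + 1) * R)" by (simp add: ac_simps)
  also have "- (u * (2 * ((2 * u + 1) * q) + (u + 1) * R)) / (u * ((u + 1) * R)) = 2 * y - 1"
    unfolding y_def by (rule frac') (use u0 u1 R in auto)
  finally show "z * (v * y\<^sup>2 - 1) = 2 * y - 1" .
  have "x = - ((u + 2) * u * q / (1 * R))" by (simp add: x_def mult.commute)
  then have "x * (v * z\<^sup>2 - 1) = - ((u + 2) * ((u\<^sup>2 - 1)\<^sup>2 - u\<^sup>2 * q) / (u * R))"
    unfolding vz using frac[OF u0, of "u + 2" 1 "(u\<^sup>2 - 1)\<^sup>2"] by simp
  also have "(u + 2) * ((u\<^sup>2 - 1)\<^sup>2 - u\<^sup>2 * q) = u * R - 2 * ((u\<^sup>2 - 1) * q)"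
    unfolding q_def R_def by algebra
  also have "- ((u * R - 2 * ((u\<^sup>2 - 1) * q)) / (u * R)) = 2 * z - 1"
    unfolding z_def using u0 R by (simp add: diff_divide_distrib)
  finally show "x * (v * z\<^sup>2 - 1) = 2 * z - 1" .
  show "x \<noteq> y"
  proof
    assume "x = y"
    then have "u * (u + 2) * q / R = (2 * u + 1) * q / ((u + 1) * R)" by (simp add: x_def y_def)
    moreover have "a * k = b" if "a * q / R = b * q / (k * R)" "k \<noteq> 0" for a b k
      using that q R by (simp add: field_simps)
    ultimately have "u * (u + 2) * (u + 1) = 2 * u + 1" using u1 by blast
    then have "u ^ 3 + 3 * u\<^sup>2 - 1 = 0" by (simp add: algebra_simps power2_eq_square power3_eq_cube)
    \<comment> \<open>The roots of \<open>u^3 + 3u^2 - 1\<close> are the numbers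
      \<open>-1/\<gamma>\<close> with \<open>\<gamma>\<close> a root of
      \<open>x^3 - 3x + 1\<close>.\<close>
    moreover have "u ^ 3 * ((- 1 / u) ^ 3 - 3 * (- 1 / u) + 1) = u ^ 3 + 3 * u\<^sup>2 - 1"
      using u0 by (simp add: field_simps power2_eq_square power3_eq_cube)
    ultimately show False using no_rat_root[of "- 1 / u"] u0 by simp
  qed
qed

theorem theorem1p2:
  fixes \<phi> :: ratfun
  assumes "rf_ok \<phi>" and "rf_deg \<phi> = 2"
    and "\<exists>P. alg_pt P \<and> critical_pt \<phi> P \<and> periodic_pt (rf_eval \<phi>) 2 P"
    and "aut_nontrivial \<phi>"
  shows "(\<exists>v::rat. v \<notin> {0, 4} \<and> lin_conj_Q \<phi> (psi v)) \<and>
    (\<forall>v::rat. v \<notin> {0, 4} \<and> lin_conj_Q \<phi> (psi v) \<and> v \<noteq> 1 \<longrightarrow>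
       (v \<notin> Im_alpha \<union> Im_beta \<longrightarrow> G3_is \<phi> W6) \<and>
       (v \<in> Im_alpha \<longrightarrow> G3_is \<phi> A6 \<or> G3_is \<phi> K6 \<or> G3_is \<phi> M6) \<and>
       (v \<in> Im_beta \<longrightarrow> G3_is \<phi> B6 \<or> G3_is \<phi> M6) \<and>
       (v \<in> Im_mu \<longrightarrow> G3_is \<phi> M6) \<and>
       (v \<in> Im_kappa \<longrightarrow> G3_is \<phi> K6))"
proof (intro conjI allI impI)
  show "\<exists>v. v \<notin> {0, 4} \<and> lin_conj_Q \<phi> (psi v)" using lin_conj_psi_exists assms by blast
next
  fix v :: rat assume "v \<notin> {0, 4} \<and> lin_conj_Q \<phi> (psi v) \<and> v \<noteq> 1"
  then have v: "v \<noteq> 0" "v \<noteq> 4" "v \<noteq> 1" and conj: "lin_conj_Q \<phi> (psi v)" by auto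
  obtain A B C D :: rat where det: "A * D - B * C \<noteq> 0"
    and S: "\<And>P. mob (of_rat A) (of_rat B) (of_rat C) (of_rat D) (rf_eval (psi v) P) =
      rf_eval \<phi> (mob (of_rat A) (of_rat B) (of_rat C) (of_rat D) P)"
    using conj unfolding lin_conj_Q_def by blast
  obtain g :: complex where g: "g ^ 3 - 3 * g + 1 = 0" using exists_root_gamma by blast
  have data: "per3_data \<phi> v A B C D t0 t1 t2 g"
    if "t0 + t1 + t2 = 3" "t0 * t1 + t1 * t2 + t2 * t0 = 0" "t0 * t1 * t2 = - of_rat v" for t0 t1 t2
    by unfold_locales (use assms v det S g that in auto)
  obtain t1 :: complex where "t1 ^ 3 - 3 * t1\<^sup>2 + of_rat v = 0" using exists_root_t by blast
  then obtain t0 t2 where t: "t0 + t1 + t2 = 3" "t0 * t1 + t1 * t2 + t2 * t0 = 0" "t0 * t1 * t2 = - of_rat v"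
    using exists_cubic_roots by blast
  note gen = data[OF t]
  show "G3_is \<phi> W6" if "v \<notin> Im_alpha \<union> Im_beta" using per3_data.G3_generic[OF gen] that by blast
  show "G3_is \<phi> A6 \<or> G3_is \<phi> K6 \<or> G3_is \<phi> M6" if "v \<in> Im_alpha"
    using per3_data.G3_alpha[OF gen that] .
  show "G3_is \<phi> B6 \<or> G3_is \<phi> M6" if "v \<in> Im_beta"
  proof -
    obtain r where "v = beta r" using \<open>v \<in> Im_beta\<close> by (auto simp: Im_beta_def)
    then have "r ^ 3 - 3 * r\<^sup>2 + v = 0"
      by (simp add: beta_def algebra_simps power2_eq_square power3_eq_cube)
    from arg_cong[OF this, of "of_rat :: rat \<Rightarrow> complex"]
    have "of_rat r ^ 3 - 3 * (of_rat r)\<^sup>2 + of_rat v = (0 :: complex)"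
      by (simp add: of_rat_add of_rat_diff of_rat_mult of_rat_power)
    \<comment> \<open>The rational root is put in the place of \<open>t1\<close>, where
      \<open>G3_beta\<close> expects it.\<close>
    from exists_cubic_roots[OF this] obtain s0 s2 :: complex where
      s: "s0 + of_rat r + s2 = 3" "s0 * of_rat r + of_rat r * s2 + s2 * s0 = 0" "s0 * of_rat r * s2 = - of_rat v"
      by blast
    show ?thesis by (rule per3_data.G3_beta[OF data[OF s]]) simp
  qed
  show "G3_is \<phi> M6" if "v \<in> Im_mu"
  proof -
    obtain u where u: "v = mu u" "u ^ 3 + 3 * u\<^sup>2 - 1 \<noteq> 0" using \<open>v \<in> Im_mu\<close> by (auto simp: Im_mu_def)
    obtain r0 r1 r2 :: rat where r: "r0 + r1 + r2 = 3" "r0 * r1 + r1 * r2 + r2 * r0 = 0" "r0 * r1 * r2 = - v"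
      using mu_roots[OF u] by blast
    have "of_rat r0 + of_rat r1 + of_rat r2 = (3 :: complex)"
      "of_rat r0 * of_rat r1 + of_rat r1 * of_rat r2 + of_rat r2 * of_rat r0 = (0 :: complex)"
      "of_rat r0 * of_rat r1 * of_rat r2 = - (of_rat v :: complex)"
      using r by (simp_all flip: of_rat_add of_rat_mult of_rat_minus)
    from per3_data.G3_split[OF data[OF this]] show ?thesis by simp
  qed
  show "G3_is \<phi> K6" if "v \<in> Im_kappa"
  proof -
    obtain u where "v = kappa u" using \<open>v \<in> Im_kappa\<close> by (auto simp: Im_kappa_def)
    note c = kappa_cycle[OF this v(1,3)]
    show ?thesis by (rule per3_data.G3_kappa[OF gen c])
  qed
qed

end
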